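(* There exist absolute constants $c_3,c_4>0$ such that the following holds. Let $K$ be a centrally symmetric convex body in $\mathbb{R}^n$. For any $s\ge 1$ and any $\mathbf{t}=(t_1,\ldots,t_s)\in\mathbb{R}^s$, $$\frac{c_3}{C_2(X_K)}\,\|\mathbf{t}\|_2\ \le\ \|\mathbf{t}\|_{K^s,K}\ \le\ \big(c_4L_KC_2(X_K)\sqrt{n}\,M(K_{\rm iso})\big)\,\|\mathbf{t}\|_2,$$ where $C_2(X_K)$ is the cotype-$2$ constant of the normed space $X_K$ with unit ball $K$, and $K_{\rm iso}$ is an isotropic image of $K$.
   Context: A convex body in $\mathbb{R}^n$ is a compact convex set with non-empty interior; it is centrally symmetric if $-K=K$. $\|x\|_K=\inf\{r>0:x\in rK\}$, and $X_K=(\mathbb{R}^n,\|\cdot\|_K)$. A convex body $C$ is isotropic if it has volume $1$, its barycenter is at the origin, and there is a constant $L_C>0$ with $\int_C\langle x,\xi\rangle^2dx=L_C^2$ for all $\xi\in S^{n-1}$. For a centrally symmetric convex body $K$, an isotropic image $K_{\rm iso}$ of $K$ is an image $T(K)$ of $K$ under an invertible linear map $T$ which is isotropic (it exists and is unique up to orthogonal transformations), and $L_K:=L_{K_{\rm iso}}$ is the isotropic constant of $K$. $M(C)=\int_{S^{n-1}}\|\xi\|_C\,d\sigma(\xi)$, with $\sigma$ the rotationally invariant probability measure on $S^{n-1}$. $C_2(X_K)=\sup_kC_{2,k}(X_K)$, where $C_{2,k}(X_K)$ is the best constant $A>0$ such that $\big(\mathbb{E}_\epsilon\|\sum_{i=1}^k\epsilon_ix_i\|_K^2\big)^{1/2}\ge\frac1A\big(\sum_{i=1}^k\|x_i\|_K^2\big)^{1/2}$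 for all $x_1,\ldots,x_k\in X_K$, with $\epsilon_i$ independent uniform $\pm1$ signs. Finally, $$\|\mathbf{t}\|_{K^s,K}=\frac{1}{\mathrm{vol}_n(K)^s}\int_K\cdots\int_K\Big\|\sum_{j=1}^st_jx_j\Big\|_K\,dx_1\cdots dx_s .$$ "Absolute constant" means independent of $n,s,K,\mathbf{t}$. *)

theory Defs
  imports "HOL-Analysis.Analysis" "HOL-Probability.Probability"
begin

(* The statement quantifies over the dimension n underneath its constants, so R^n cannot be a
   type indexed by n.  We use the model of the library's topology Euclidean_space n: sequences
   nat => real vanishing from index n on, with coordinates indexed by 0, ..., n - 1. *)

abbreviation Rn :: "nat \<Rightarrow> (nat \<Rightarrow> real) set" where
  "Rn n \<equiv> topspace (Euclidean_space n)"

definition dot :: "nat \<Rightarrow> (nat \<Rightarrow> real) \<Rightarrow> (nat \<Rightarrow> real) \<Rightarrow> real" where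
  "dot n x y = (\<Sum>i<n. x i * y i)"

definition unit_sphere :: "nat \<Rightarrow> (nat \<Rightarrow> real) set" where
  "unit_sphere n = {x \<in> Rn n. L2_set x {..<n} = 1}"

(* Lebesgue measure of R^n, as a Borel measure on all sequences that is concentrated on Rn n. *)
definition lebesgue_Rn :: "nat \<Rightarrow> (nat \<Rightarrow> real) measure" where
  "lebesgue_Rn n =
     distr (\<Pi>\<^sub>M i\<in>{..<n}. (lborel :: real measure)) borel (\<lambda>x i. if i < n then x i else 0)"

definition vol :: "nat \<Rightarrow> (nat \<Rightarrow> real) set \<Rightarrow> real" where
  "vol n C = measure (lebesgue_Rn n) C"

definition linear_Rn :: "nat \<Rightarrow> ((nat \<Rightarrow> real) \<Rightarrow> (nat \<Rightarrow> real)) \<Rightarrow> bool" where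
  "linear_Rn n T \<longleftrightarrow> T ` Rn n \<subseteq> Rn n \<and>
     (\<forall>x\<in>Rn n. \<forall>y\<in>Rn n. \<forall>a b. T (\<lambda>i. a * x i + b * y i) = (\<lambda>i. a * T x i + b * T y i))"

definition invertible_linear_Rn :: "nat \<Rightarrow> ((nat \<Rightarrow> real) \<Rightarrow> (nat \<Rightarrow> real)) \<Rightarrow> bool" where
  "invertible_linear_Rn n T \<longleftrightarrow> linear_Rn n T \<and> bij_betw T (Rn n) (Rn n)"

definition orthogonal_Rn :: "nat \<Rightarrow> ((nat \<Rightarrow> real) \<Rightarrow> (nat \<Rightarrow> real)) \<Rightarrow> bool" where
  "orthogonal_Rn n U \<longleftrightarrow> linear_Rn n U \<and> (\<forall>x\<in>Rn n. \<forall>y\<in>Rn n. dot n (U x) (U y) = dot n x y)"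

definition convex_body :: "nat \<Rightarrow> (nat \<Rightarrow> real) set \<Rightarrow> bool" where
  "convex_body n K \<longleftrightarrow>
     compactin (Euclidean_space n) K \<and>
     (\<forall>x\<in>K. \<forall>y\<in>K. \<forall>u\<in>{0..1}. (\<lambda>i. (1 - u) * x i + u * y i) \<in> K) \<and>
     (Euclidean_space n) interior_of K \<noteq> {}"

definition centrally_symmetric :: "(nat \<Rightarrow> real) set \<Rightarrow> bool" where
  "centrally_symmetric K \<longleftrightarrow> (\<lambda>x i. - x i) ` K = K"

definition body_norm :: "(nat \<Rightarrow> real) set \<Rightarrow> (nat \<Rightarrow> real) \<Rightarrow> real" where
  "body_norm K x = Inf {r. r > 0 \<and> x \<in> (\<lambda>y i. r * y i) ` K}"

definition isotropic :: "nat \<Rightarrow> (nat \<Rightarrow> real) set \<Rightarrow> bool" where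
  "isotropic n C \<longleftrightarrow>
     convex_body n C \<and> vol n C = 1 \<and>
     (\<forall>i<n. (LINT x:C|lebesgue_Rn n. x i) = 0) \<and>
     (\<exists>L>0. \<forall>\<xi>\<in>unit_sphere n. (LINT x:C|lebesgue_Rn n. (dot n x \<xi>)\<^sup>2) = L\<^sup>2)"

definition isotropic_constant :: "nat \<Rightarrow> (nat \<Rightarrow> real) set \<Rightarrow> real" where
  "isotropic_constant n C =
     (THE L. L > 0 \<and> (\<forall>\<xi>\<in>unit_sphere n. (LINT x:C|lebesgue_Rn n. (dot n x \<xi>)\<^sup>2) = L\<^sup>2))"

definition isotropic_image :: "nat \<Rightarrow> (nat \<Rightarrow> real) set \<Rightarrow> (nat \<Rightarrow> real) set \<Rightarrow> bool" where
  "isotropic_image n K C \<longleftrightarrow> (\<exists>T. invertible_linear_Rn n T \<and> C = T ` K) \<and> isotropic n C"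

(* Invariance is under the full orthogonal group: for n = 1 the group SO(1) is trivial and would
   not determine the measure. *)
definition rotation_invariant_prob :: "nat \<Rightarrow> (nat \<Rightarrow> real) measure \<Rightarrow> bool" where
  "rotation_invariant_prob n \<sigma> \<longleftrightarrow>
     prob_space \<sigma> \<and>
     space \<sigma> = unit_sphere n \<and> sets \<sigma> = sets (restrict_space borel (unit_sphere n)) \<and>
     (\<forall>U. orthogonal_Rn n U \<longrightarrow> (\<forall>A\<in>sets \<sigma>. emeasure \<sigma> (U ` A) = emeasure \<sigma> A))"

definition mean_norm :: "(nat \<Rightarrow> real) measure \<Rightarrow> (nat \<Rightarrow> real) set \<Rightarrow> real" where
  "mean_norm \<sigma> C = (LINT \<xi>|\<sigma>. body_norm C \<xi>)"

definition signs :: "nat \<Rightarrow> (nat \<Rightarrow> real) pmf" where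
  "signs k = Pi_pmf {..<k} 1 (\<lambda>_. pmf_of_set {-1, 1})"

definition cotype2_const_k :: "nat \<Rightarrow> (nat \<Rightarrow> real) set \<Rightarrow> nat \<Rightarrow> real" where
  "cotype2_const_k n K k = Inf {A. A > 0 \<and>
     (\<forall>x :: nat \<Rightarrow> nat \<Rightarrow> real. (\<forall>j<k. x j \<in> Rn n) \<longrightarrow>
        sqrt (measure_pmf.expectation (signs k)
                (\<lambda>\<epsilon>. (body_norm K (\<lambda>i. \<Sum>j<k. \<epsilon> j * x j i))\<^sup>2))
          \<ge> 1 / A * sqrt (\<Sum>j<k. (body_norm K (x j))\<^sup>2))}"

(* A supremum of reals: the family is bounded because any norm on R^n is equivalent to the
   Euclidean norm, for which the constant is 1. *)
definition cotype2_const :: "nat \<Rightarrow> (nat \<Rightarrow> real) set \<Rightarrow> real" where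
  "cotype2_const n K = (SUP k\<in>{1..}. cotype2_const_k n K k)"

definition multi_norm :: "nat \<Rightarrow> nat \<Rightarrow> (nat \<Rightarrow> real) set \<Rightarrow> (nat \<Rightarrow> real) \<Rightarrow> real" where
  "multi_norm n s K t = 1 / vol n K ^ s *
     (LINT x:({..<s} \<rightarrow>\<^sub>E K)|(\<Pi>\<^sub>M j\<in>{..<s}. lebesgue_Rn n).
        body_norm K (\<lambda>i. \<Sum>j<s. t j * x j i))"

end

theory Submission
  imports Defs
begin

text \<open>
  Let $X_1, \dots, X_s$ be independent and uniform in $K$, let $q$ be the norm with unit ball $K$,
  and let $C_2$ be its cotype 2 constant. The quantity to be estimated is the expectation of
  $q(\sum_j t_j X_j)$.

  Both bounds rest on one inequality, \<open>cotype2_expectation\<close>: if random vectors $Y_j$ can be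
  multiplied by arbitrary signs without changing $E\, q(\sum_j Y_j)$, then
  $(\sum_j (E\, q(Y_j))^2)^{1/2} \le \sqrt 2\, C_2\, E\, q(\sum_j Y_j)$.
  Indeed, one may average the right hand side over all signs; for fixed $Y_j$ the first moment over
  the signs controls the second one (the inequality of Khinchine and Kahane,
  \<open>kahane_1_2\<close>), cotype bounds the second moment from below by $\sum_j q(Y_j)^2$, and
  Minkowski's inequality moves the expectation inside the square root.

  The lower bound is the case $Y_j = t_j X_j$, because $E\, q(X_j) \ge 1/4$: two disjoint translates
  of half the body fit into $K$.

  For the upper bound, let $T$ carry $K$ to the isotropic body $C$, and let $p$ be the norm with unit
  ball $C$, so that $p \circ T = q$ and $p$ has the same cotype constant. The vector
  $X = T(\sum_j t_j X_j)$ has covariance matrix $a^2 I$ with $a = L_K \|t\|_2$. Suppose for a moment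
  that $X$ takes only finitely many values $x_j$, with probabilities $w_j$, and put
  $y_j = \sqrt{w_j}\, x_j$. Then $\sum_j y_j y_j^T = a^2 I$, so for independent standard Gaussian
  $\eta_j$ the vector $\sum_j \eta_j y_j$ is rotation invariant, and the expectation of its $p$-norm is
  its mean Euclidean length times $M(C)$, hence at most $a \sqrt n\, M(C)$. The inequality above for
  $Y_j = \eta_j y_j$, with $E|\eta_j| = \sqrt{2/\pi}$, yields
  $(\sum_j w_j\, p(x_j)^2)^{1/2} \le \sqrt\pi\, C_2\, a \sqrt n\, M(C)$
  (\<open>cotype2_isotropic_system\<close>), and the left hand side is at least $E\, p(X)$. A general
  $X$ is rounded to a fine grid, and a few small vectors make the covariance exactly scalar
  (\<open>cotype2_almost_isotropic_system\<close>, \<open>cotype2_isotropic_vector\<close>).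

  Two facts about invariant measures are needed, and both follow from Fubini's theorem. Lebesgue
  measure is multiplied by a constant under an invertible linear map, since the image measure is
  again translation invariant (\<open>lebesgue_Rn_swap\<close>). Two probability measures that are
  invariant under reflections in hyperplanes, one of them on the sphere, can be compared by
  integrating over pairs of points with nearby directions
  (\<open>householder_invariant_integral_le\<close>). Reflections suffice, because a reflection of
  $R^n$ lifts along $\eta \mapsto \sum_j \eta_j y_j$ to a reflection of the Gaussian variables.
\<close>

section \<open>Averages over random signs\<close>

text \<open>Recursion on the number of signs makes every identity below an induction that splits off the last
sign. Signs with index at least $k$ have the value 1, which is the default value in
\<^const>\<open>signs\<close>.\<close>

primrec sign_average :: "nat \<Rightarrow> ((nat \<Rightarrow> real) \<Rightarrow> real) \<Rightarrow> real" where
  "sign_average 0 F = F (\<lambda>_. 1)"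
| "sign_average (Suc k) F =
     (sign_average k (\<lambda>\<epsilon>. F (\<epsilon>(k := 1))) + sign_average k (\<lambda>\<epsilon>. F (\<epsilon>(k := -1)))) / 2"

lemma finite_set_signs: "finite (set_pmf (signs k))"
  by (auto simp: signs_def set_Pi_pmf intro!: finite_PiE_dflt)

lemma expectation_signs: "measure_pmf.expectation (signs k) F = sign_average k F"
proof (induction k arbitrary: F)
  case 0
  show ?case by (simp add: signs_def)
next
  case (Suc k)
  have *: "signs (Suc k) = pmf_of_set {-1, 1} \<bind> (\<lambda>y. map_pmf (\<lambda>f. f(k := y)) (signs k))"
    unfolding signs_def lessThan_Suc
    by (subst Pi_pmf_insert') (auto simp: map_pmf_def)
  show ?case
    unfolding * by (subst pmf_expectation_bind_pmf_of_set)
      (auto simp: finite_set_signs Suc.IH field_simps)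
qed

lemma sign_average_add: "sign_average k (\<lambda>\<epsilon>. F \<epsilon> + G \<epsilon>) = sign_average k F + sign_average k G"
  by (induction k arbitrary: F G) (auto simp: field_simps)

lemma sign_average_cmult: "sign_average k (\<lambda>\<epsilon>. c * F \<epsilon>) = c * sign_average k F"
  by (induction k arbitrary: F) (auto simp: field_simps)

lemma sign_average_mono:
  "(\<And>\<epsilon>. (\<And>i. \<epsilon> i = 1 \<or> \<epsilon> i = -1) \<Longrightarrow> F \<epsilon> \<le> G \<epsilon>) \<Longrightarrow> sign_average k F \<le> sign_average k G"
proof (induction k arbitrary: F G)
  case (Suc k)
  have "sign_average k (\<lambda>\<epsilon>. F (\<epsilon>(k := c))) \<le> sign_average k (\<lambda>\<epsilon>. G (\<epsilon>(k := c)))"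
    if "c = 1 \<or> c = -1" for c
    using that by (intro Suc.IH Suc.prems) auto
  from this[of 1] this[of "-1"] show ?case by simp
qed auto

lemma sign_average_const: "sign_average k (\<lambda>_. c) = c"
  by (induction k) auto

lemma sign_average_sum:
  "finite I \<Longrightarrow> sign_average k (\<lambda>\<epsilon>. \<Sum>i\<in>I. F i \<epsilon>) = (\<Sum>i\<in>I. sign_average k (F i))"
  by (induction I rule: finite_induct) (auto simp: sign_average_const sign_average_add)

lemma sign_average_nonneg: "(\<And>\<epsilon>. 0 \<le> F \<epsilon>) \<Longrightarrow> 0 \<le> sign_average k F"
  using sign_average_mono[of "\<lambda>_. 0" F k] by (simp add: sign_average_const)

lemma sign_average_neg:
  "(\<And>\<epsilon>. G \<epsilon> = F (\<lambda>i. if i < k then - \<epsilon> i else \<epsilon> i)) \<Longrightarrow> sign_average k G = sign_average k F"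
proof (induction k arbitrary: F G)
  case (Suc k)
  have "sign_average k (\<lambda>\<epsilon>. G (\<epsilon>(k := - c))) = sign_average k (\<lambda>\<epsilon>. F (\<epsilon>(k := c)))" for c
    by (intro Suc.IH) (auto simp: Suc.prems intro!: arg_cong[where f = F])
  from this[of 1] this[of "-1"] show ?case by simp
qed simp

text \<open>On the Walsh function indexed by a set $S \subseteq \{0, \dots, k-1\}$ this operator is multiplication by
$|S|$, so \<open>dirichlet_form\<close> is $\sum_S |S| \hat F(S)^2$.\<close>

definition flip_laplacian :: "nat \<Rightarrow> ((nat \<Rightarrow> real) \<Rightarrow> real) \<Rightarrow> (nat \<Rightarrow> real) \<Rightarrow> real" where
  "flip_laplacian k F \<epsilon> = (\<Sum>i<k. (F \<epsilon> - F (\<epsilon>(i := - \<epsilon> i))) / 2)"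

definition dirichlet_form :: "nat \<Rightarrow> ((nat \<Rightarrow> real) \<Rightarrow> real) \<Rightarrow> real" where
  "dirichlet_form k F = sign_average k (\<lambda>\<epsilon>. F \<epsilon> * flip_laplacian k F \<epsilon>)"

definition even_part :: "nat \<Rightarrow> ((nat \<Rightarrow> real) \<Rightarrow> real) \<Rightarrow> (nat \<Rightarrow> real) \<Rightarrow> real" where
  "even_part k F \<epsilon> = (F (\<epsilon>(k := 1)) + F (\<epsilon>(k := -1))) / 2"

definition odd_part :: "nat \<Rightarrow> ((nat \<Rightarrow> real) \<Rightarrow> real) \<Rightarrow> (nat \<Rightarrow> real) \<Rightarrow> real" where
  "odd_part k F \<epsilon> = (F (\<epsilon>(k := 1)) - F (\<epsilon>(k := -1))) / 2"

lemma split_parts: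
  "F (\<epsilon>(k := 1)) = even_part k F \<epsilon> + odd_part k F \<epsilon>"
  "F (\<epsilon>(k := -1)) = even_part k F \<epsilon> - odd_part k F \<epsilon>"
  by (auto simp: even_part_def odd_part_def field_simps)

lemma sign_average_Suc: "sign_average (Suc k) F = sign_average k (even_part k F)"
proof -
  have "even_part k F = (\<lambda>\<epsilon>. (1/2) * (F (\<epsilon>(k := 1)) + F (\<epsilon>(k := -1))))"
    by (auto simp: even_part_def)
  then show ?thesis by (simp only: sign_average_cmult sign_average_add) simp
qed

lemma sign_average_square_Suc:
  "sign_average (Suc k) (\<lambda>\<epsilon>. (F \<epsilon>)\<^sup>2) =
     sign_average k (\<lambda>\<epsilon>. (even_part k F \<epsilon>)\<^sup>2) + sign_average k (\<lambda>\<epsilon>. (odd_part k F \<epsilon>)\<^sup>2)"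
  unfolding sign_average_Suc sign_average_add[symmetric]
  by (intro arg_cong[where f = "sign_average k"] ext)
     (simp add: even_part_def odd_part_def power2_eq_square field_simps)

lemma flip_laplacian_Suc:
  "flip_laplacian (Suc k) F (\<epsilon>(k := 1)) =
     flip_laplacian k (even_part k F) \<epsilon> + flip_laplacian k (odd_part k F) \<epsilon> + odd_part k F \<epsilon>"
  "flip_laplacian (Suc k) F (\<epsilon>(k := -1)) =
     flip_laplacian k (even_part k F) \<epsilon> - flip_laplacian k (odd_part k F) \<epsilon> - odd_part k F \<epsilon>"
proof -
  have tw: "\<epsilon>(k := c, i := d) = \<epsilon>(i := d, k := c)" if "i < k" for i c d
    using that by (intro fun_upd_twist) auto
  have "flip_laplacian (Suc k) F (\<epsilon>(k := c)) =
     (\<Sum>i<k. (F (\<epsilon>(k := c)) - F (\<epsilon>(i := - \<epsilon> i, k := c))) / 2) +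
     (F (\<epsilon>(k := c)) - F (\<epsilon>(k := - c))) / 2" for c
    by (auto simp: flip_laplacian_def tw intro!: sum.cong)
  from this[of 1] this[of "-1"] show
  "flip_laplacian (Suc k) F (\<epsilon>(k := 1)) =
     flip_laplacian k (even_part k F) \<epsilon> + flip_laplacian k (odd_part k F) \<epsilon> + odd_part k F \<epsilon>"
  "flip_laplacian (Suc k) F (\<epsilon>(k := -1)) =
     flip_laplacian k (even_part k F) \<epsilon> - flip_laplacian k (odd_part k F) \<epsilon> - odd_part k F \<epsilon>"
    by (simp_all add: flip_laplacian_def split_parts sum.distrib[symmetric] sum_subtractf[symmetric]
          diff_divide_distrib add_divide_distrib algebra_simps)
qed

text \<open>Writing $F = g + \epsilon_k h$ with $g$, $h$ independent of the last sign, the flips of the first $k$ signs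
act on $g$ and $h$ separately, and the flip of the last one reproduces $\epsilon_k h$.\<close>

lemma dirichlet_form_Suc:
  "dirichlet_form (Suc k) F = dirichlet_form k (even_part k F) + dirichlet_form k (odd_part k F)
     + sign_average k (\<lambda>\<epsilon>. (odd_part k F \<epsilon>)\<^sup>2)"
  unfolding dirichlet_form_def sign_average_Suc sign_average_add[symmetric]
  unfolding even_part_def[of k "\<lambda>\<epsilon>. F \<epsilon> * flip_laplacian (Suc k) F \<epsilon>"]
    flip_laplacian_Suc split_parts[of F]
  by (intro arg_cong[where f = "sign_average k"] ext) (simp add: power2_eq_square field_simps)

lemma dirichlet_form_nonneg: "0 \<le> dirichlet_form k F"
proof (induction k arbitrary: F)
  case 0
  show ?case by (simp add: dirichlet_form_def flip_laplacian_def)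
next
  case (Suc k)
  show ?case unfolding dirichlet_form_Suc by (intro add_nonneg_nonneg Suc sign_average_nonneg) auto
qed

text \<open>The spectral gap: the eigenvalue of every nonconstant Walsh function is at least 1.\<close>

lemma poincare_cube:
  "sign_average k (\<lambda>\<epsilon>. (F \<epsilon>)\<^sup>2) - (sign_average k F)\<^sup>2 \<le> dirichlet_form k F"
proof (induction k arbitrary: F)
  case 0
  show ?case by (simp add: dirichlet_form_def flip_laplacian_def)
next
  case (Suc k)
  show ?case
    unfolding dirichlet_form_Suc sign_average_square_Suc sign_average_Suc[of k F]
    using Suc.IH[of "even_part k F"] dirichlet_form_nonneg[of k "odd_part k F"] by linarith
qed

text \<open>Apart from the Walsh functions of single signs, whose coefficients are subtracted here, every
nonconstant Walsh function has eigenvalue at least 2. For even $F$ the subtracted terms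
vanish. In the induction step the odd part only needs the first gap.\<close>

lemma poincare_cube_second_gap:
  "2 * (sign_average k (\<lambda>\<epsilon>. (F \<epsilon>)\<^sup>2) - (sign_average k F)\<^sup>2)
     - (\<Sum>i<k. (sign_average k (\<lambda>\<epsilon>. \<epsilon> i * F \<epsilon>))\<^sup>2) \<le> dirichlet_form k F"
proof (induction k arbitrary: F)
  case 0
  show ?case by (simp add: dirichlet_form_def flip_laplacian_def)
next
  case (Suc k)
  have "even_part k (\<lambda>\<epsilon>. \<epsilon> i * F \<epsilon>) = (\<lambda>\<epsilon>. \<epsilon> i * even_part k F \<epsilon>)" if "i < k" for i
    using that by (auto simp: even_part_def field_simps)
  moreover have "even_part k (\<lambda>\<epsilon>. \<epsilon> k * F \<epsilon>) = odd_part k F"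
    by (auto simp: even_part_def odd_part_def)
  ultimately have *: "(\<Sum>i<Suc k. (sign_average (Suc k) (\<lambda>\<epsilon>. \<epsilon> i * F \<epsilon>))\<^sup>2) =
      (\<Sum>i<k. (sign_average k (\<lambda>\<epsilon>. \<epsilon> i * even_part k F \<epsilon>))\<^sup>2) + (sign_average k (odd_part k F))\<^sup>2"
    unfolding sign_average_Suc by simp
  have arith: "2 * (a + h - b) - (w + e) \<le> d + d' + h"
    if "2 * (a - b) - w \<le> d" "h - e \<le> d'" for a h b w e d d' :: real
    using that by (simp add: algebra_simps)
  show ?case
    unfolding dirichlet_form_Suc sign_average_square_Suc sign_average_Suc[of k F] *
    by (rule arith[OF Suc.IH poincare_cube])
qed

text \<open>Functions on $R^n$ are extended to all sequences by composing with this projection; measurability and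
linearity can then be stated without carriers.\<close>

definition truncate :: "nat \<Rightarrow> (nat \<Rightarrow> real) \<Rightarrow> nat \<Rightarrow> real" where
  "truncate n x = (\<lambda>i. if i < n then x i else 0)"

locale seminorm_Rn =
  fixes n :: nat and q :: "(nat \<Rightarrow> real) \<Rightarrow> real"
  assumes triangle: "q (\<lambda>i. x i + y i) \<le> q x + q y"
    and homogeneous: "q (\<lambda>i. c * x i) = \<bar>c\<bar> * q x"
    and depends: "q (truncate n x) = q x"
begin

lemma zero: "q (\<lambda>i. 0) = 0"
  using homogeneous[of 0 "\<lambda>i. 0"] by simp

lemma nonneg: "0 \<le> q x"
  using triangle[of x "\<lambda>i. -1 * x i"] homogeneous[of "-1" x] zero by simp

lemma sum_le: "finite J \<Longrightarrow> q (\<lambda>i. \<Sum>j\<in>J. x j i) \<le> (\<Sum>j\<in>J. q (x j))"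
proof (induction J rule: finite_induct)
  case (insert j J)
  then show ?case using triangle[of "x j" "\<lambda>i. \<Sum>j\<in>J. x j i"] by simp
qed (simp add: zero)

text \<open>The argument of Latala and Oleszkiewicz. Let $f$ be the seminorm of the sign sum $S$. The sums obtained
by flipping one sign add up to $(k - 2) S$, so the triangle inequality gives the pointwise bound
$\mathcal L f \le f$ for the flip Laplacian $\mathcal L$. As $f$ is even, the second spectral gap
yields $2 (E f^2 - (E f)^2) \le E (f \mathcal L f) \le E f^2$.\<close>

lemma kahane_1_2:
  "sign_average k (\<lambda>\<epsilon>. (q (\<lambda>i. \<Sum>j<k. \<epsilon> j * x j i))\<^sup>2)
     \<le> 2 * (sign_average k (\<lambda>\<epsilon>. q (\<lambda>i. \<Sum>j<k. \<epsilon> j * x j i)))\<^sup>2"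
proof -
  define f where "f \<epsilon> = q (\<lambda>i. \<Sum>j<k. \<epsilon> j * x j i)" for \<epsilon>
  have lap: "flip_laplacian k f \<epsilon> \<le> f \<epsilon>" for \<epsilon>
  proof -
    have flip: "(\<Sum>j<k. (\<epsilon>(l := - \<epsilon> l)) j * x j i) = (\<Sum>j<k. \<epsilon> j * x j i) - 2 * (\<epsilon> l * x l i)"
      if "l < k" for l i
    proof -
      have "(\<Sum>j<k. (\<epsilon>(l := - \<epsilon> l)) j * x j i) =
          (\<Sum>j<k. \<epsilon> j * x j i - (if j = l then 2 * (\<epsilon> l * x l i) else 0))"
        by (intro sum.cong) auto
      then show ?thesis using that by (simp add: sum_subtractf)
    qed
    have "\<bar>real k - 2\<bar> * f \<epsilon> = q (\<lambda>i. (real k - 2) * (\<Sum>j<k. \<epsilon> j * x j i))"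
      by (simp add: homogeneous f_def)
    also have "(\<lambda>i. (real k - 2) * (\<Sum>j<k. \<epsilon> j * x j i)) =
        (\<lambda>i. \<Sum>l<k. (\<Sum>j<k. (\<epsilon>(l := - \<epsilon> l)) j * x j i))"
    proof
      fix i
      have "(\<Sum>l<k. \<Sum>j<k. (\<epsilon>(l := - \<epsilon> l)) j * x j i) =
          (\<Sum>l<k. (\<Sum>j<k. \<epsilon> j * x j i) - 2 * (\<epsilon> l * x l i))"
        by (intro sum.cong refl flip) auto
      also have "\<dots> = (real k - 2) * (\<Sum>j<k. \<epsilon> j * x j i)"
        by (simp add: sum_subtractf sum_distrib_left[symmetric] left_diff_distrib)
      finally show "(real k - 2) * (\<Sum>j<k. \<epsilon> j * x j i) =
          (\<Sum>l<k. \<Sum>j<k. (\<epsilon>(l := - \<epsilon> l)) j * x j i)" ..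
    qed
    also have "q \<dots> \<le> (\<Sum>l<k. f (\<epsilon>(l := - \<epsilon> l)))"
      unfolding f_def by (rule sum_le) auto
    finally have "\<bar>real k - 2\<bar> * f \<epsilon> \<le> (\<Sum>l<k. f (\<epsilon>(l := - \<epsilon> l)))" .
    moreover have "(real k - 2) * f \<epsilon> \<le> \<bar>real k - 2\<bar> * f \<epsilon>"
      by (intro mult_right_mono) (auto simp: f_def nonneg)
    ultimately show ?thesis
      by (simp add: flip_laplacian_def sum_divide_distrib[symmetric] sum_subtractf algebra_simps)
  qed
  have "sign_average k (\<lambda>\<epsilon>. \<epsilon> l * f \<epsilon>) = 0" if "l < k" for l
  proof -
    have "f (\<lambda>i. if i < k then - \<epsilon> i else \<epsilon> i) = f \<epsilon>" for \<epsilon>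
    proof -
      have "f (\<lambda>i. if i < k then - \<epsilon> i else \<epsilon> i) = q (\<lambda>i. -1 * (\<Sum>j<k. \<epsilon> j * x j i))"
        unfolding f_def by (simp add: sum_negf[symmetric])
      then show ?thesis unfolding homogeneous by (simp add: f_def)
    qed
    then have "sign_average k (\<lambda>\<epsilon>. (-1) * (\<epsilon> l * f \<epsilon>)) = sign_average k (\<lambda>\<epsilon>. \<epsilon> l * f \<epsilon>)"
      using that by (intro sign_average_neg) auto
    then show ?thesis unfolding sign_average_cmult by simp
  qed
  then have "2 * (sign_average k (\<lambda>\<epsilon>. (f \<epsilon>)\<^sup>2) - (sign_average k f)\<^sup>2) \<le> dirichlet_form k f"
    using poincare_cube_second_gap[of k f] by simp
  also have "\<dots> \<le> sign_average k (\<lambda>\<epsilon>. (f \<epsilon>)\<^sup>2)"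
    unfolding dirichlet_form_def power2_eq_square
    by (intro sign_average_mono mult_left_mono lap) (auto simp: f_def nonneg)
  finally show ?thesis by (simp add: f_def[abs_def])
qed

end

section \<open>Lebesgue measure and linear maps\<close>

lemma measurable_fun_plus [measurable (raw)]:
  fixes f g :: "'c \<Rightarrow> nat \<Rightarrow> real"
  assumes "f \<in> M \<rightarrow>\<^sub>M borel" "g \<in> M \<rightarrow>\<^sub>M borel"
  shows "(\<lambda>p i. f p i + g p i) \<in> M \<rightarrow>\<^sub>M borel"
  using assms[THEN measurable_product_then_coordinatewise]
  by (intro measurable_coordinatewise_then_product borel_measurable_add)

lemma measurable_fun_diff [measurable (raw)]:
  fixes f g :: "'c \<Rightarrow> nat \<Rightarrow> real"
  assumes "f \<in> M \<rightarrow>\<^sub>M borel" "g \<in> M \<rightarrow>\<^sub>M borel"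
  shows "(\<lambda>p i. f p i - g p i) \<in> M \<rightarrow>\<^sub>M borel"
  using assms[THEN measurable_product_then_coordinatewise]
  by (intro measurable_coordinatewise_then_product borel_measurable_diff)

lemma measurable_fun_cmult [measurable (raw)]:
  fixes f :: "'c \<Rightarrow> nat \<Rightarrow> real"
  assumes "c \<in> M \<rightarrow>\<^sub>M borel" "f \<in> M \<rightarrow>\<^sub>M borel"
  shows "(\<lambda>p i. c p * f p i) \<in> M \<rightarrow>\<^sub>M borel"
  using assms(1) assms(2)[THEN measurable_product_then_coordinatewise]
  by (intro measurable_coordinatewise_then_product borel_measurable_times)

lemma measurable_fun_uminus [measurable (raw)]:
  fixes f :: "'c \<Rightarrow> nat \<Rightarrow> real"
  assumes "f \<in> M \<rightarrow>\<^sub>M borel"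
  shows "(\<lambda>p i. - f p i) \<in> M \<rightarrow>\<^sub>M borel"
  using assms[THEN measurable_product_then_coordinatewise]
  by (intro measurable_coordinatewise_then_product borel_measurable_uminus)

lemma measurable_fun_sum [measurable (raw)]:
  fixes f :: "'j \<Rightarrow> 'c \<Rightarrow> nat \<Rightarrow> real"
  assumes "\<And>j. j \<in> J \<Longrightarrow> f j \<in> M \<rightarrow>\<^sub>M borel"
  shows "(\<lambda>p i. \<Sum>j\<in>J. f j p i) \<in> M \<rightarrow>\<^sub>M borel"
  using assms[THEN measurable_product_then_coordinatewise]
  by (intro measurable_coordinatewise_then_product borel_measurable_sum)

lemma measurable_truncate_PiM [measurable]:
  "truncate n \<in> (\<Pi>\<^sub>M i\<in>{..<n}. (lborel :: real measure)) \<rightarrow>\<^sub>M borel"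
  unfolding truncate_def
proof (rule measurable_coordinatewise_then_product)
  fix i
  show "(\<lambda>x. if i < n then x i else 0) \<in> borel_measurable (Pi\<^sub>M {..<n} (\<lambda>i. lborel))"
  proof (cases "i < n")
    case True
    then have "(\<lambda>x. x i) \<in> (\<Pi>\<^sub>M i\<in>{..<n}. (lborel :: real measure)) \<rightarrow>\<^sub>M lborel"
      by (intro measurable_component_singleton) auto
    with True show ?thesis by (simp add: measurable_lborel1)
  qed auto
qed

lemma measurable_truncate [measurable]: "truncate n \<in> borel \<rightarrow>\<^sub>M borel"
  unfolding truncate_def by (rule measurable_coordinatewise_then_product) auto

lemma lebesgue_Rn_eq: "lebesgue_Rn n = distr (\<Pi>\<^sub>M i\<in>{..<n}. (lborel :: real measure)) borel (truncate n)"
  by (simp add: lebesgue_Rn_def truncate_def[abs_def])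

lemma sets_lebesgue_Rn [simp, measurable_cong]: "sets (lebesgue_Rn n) = sets borel"
  by (simp add: lebesgue_Rn_def)

lemma space_lebesgue_Rn [simp]: "space (lebesgue_Rn n) = UNIV"
  by (simp add: lebesgue_Rn_def)

lemma Rn_eq: "Rn n = {x. \<forall>i\<ge>n. x i = 0}"
  by (auto simp: topspace_Euclidean_space)

lemma truncate_in_Rn [simp]: "truncate n x \<in> Rn n"
  by (simp add: Rn_eq truncate_def)

lemma truncate_eq: "x \<in> Rn n \<Longrightarrow> truncate n x = x"
  by (auto simp: Rn_eq truncate_def fun_eq_iff)

lemma truncate_idem [simp]: "truncate n (truncate n x) = truncate n x"
  by (rule truncate_eq) (rule truncate_in_Rn)

lemma Rn_borel [measurable]: "Rn n \<in> sets borel"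
proof -
  have "Rn n = (\<Inter>i\<in>{n..}. {x. x i = 0})" by (auto simp: Rn_eq)
  also have "\<dots> \<in> sets borel" by (intro sets.countable_INT) auto
  finally show ?thesis .
qed

lemma AE_lebesgue_Rn: "AE x in lebesgue_Rn n. x \<in> Rn n"
  unfolding lebesgue_Rn_eq by (subst AE_distr_iff) (auto simp del: topspace_Euclidean_space)

lemma nn_integral_lebesgue_Rn:
  "f \<in> borel_measurable borel \<Longrightarrow>
     (\<integral>\<^sup>+x. f x \<partial>lebesgue_Rn n) = (\<integral>\<^sup>+x. f (truncate n x) \<partial>(\<Pi>\<^sub>M i\<in>{..<n}. (lborel :: real measure)))"
  unfolding lebesgue_Rn_eq by (rule nn_integral_distr) auto

interpretation lborel_product: product_sigma_finite "\<lambda>_::nat. lborel :: real measure"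
  by standard

lemma emeasure_lebesgue_Rn_box:
  assumes [measurable]: "\<And>i. B i \<in> sets borel"
  shows "emeasure (lebesgue_Rn n) {x. \<forall>i<n. x i \<in> B i} = (\<Prod>i<n. emeasure lborel (B i))"
proof -
  have "emeasure (lebesgue_Rn n) {x. \<forall>i<n. x i \<in> B i} =
      emeasure (\<Pi>\<^sub>M i\<in>{..<n}. (lborel :: real measure))
        (truncate n -` {x. \<forall>i<n. x i \<in> B i} \<inter> space (\<Pi>\<^sub>M i\<in>{..<n}. lborel))"
    unfolding lebesgue_Rn_eq by (rule emeasure_distr) auto
  also have "truncate n -` {x. \<forall>i<n. x i \<in> B i} \<inter> space (\<Pi>\<^sub>M i\<in>{..<n}. (lborel :: real measure))
      = Pi\<^sub>E {..<n} B"
    by (auto simp: truncate_def space_PiM PiE_iff)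
  also have "emeasure (\<Pi>\<^sub>M i\<in>{..<n}. (lborel :: real measure)) \<dots> = (\<Prod>i<n. emeasure lborel (B i))"
    by (rule lborel_product.emeasure_PiM) auto
  finally show ?thesis .
qed

lemma emeasure_lebesgue_Rn_cube:
  assumes "0 \<le> d"
  shows "emeasure (lebesgue_Rn n) {x. \<forall>i<n. x i \<in> {a i .. a i + d}} = ennreal (d ^ n)"
  by (subst emeasure_lebesgue_Rn_box) (auto simp: assms ennreal_power)

lemma sigma_finite_lebesgue_Rn: "sigma_finite_measure (lebesgue_Rn n)"
proof
  define A where "A m = {x :: nat \<Rightarrow> real. \<forall>i<n. x i \<in> {- real m .. - real m + 2 * real m}}" for m :: nat
  have "\<exists>m. x \<in> A m" for x
  proof -
    obtain m :: nat where "(\<Sum>i<n. \<bar>x i\<bar>) \<le> real m" using real_arch_simple by blast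
    moreover have "\<bar>x i\<bar> \<le> (\<Sum>i<n. \<bar>x i\<bar>)" if "i < n" for i
      using that by (intro member_le_sum) auto
    ultimately have "\<bar>x i\<bar> \<le> real m" if "i < n" for i using that by force
    then show ?thesis by (intro exI[of _ m]) (force simp: A_def)
  qed
  then have "\<Union> (range A) = space (lebesgue_Rn n)" by auto
  moreover have "emeasure (lebesgue_Rn n) (A m) \<noteq> \<infinity>" for m
    unfolding A_def by (subst emeasure_lebesgue_Rn_cube) auto
  moreover have "A m \<in> sets (lebesgue_Rn n)" for m
    by (simp add: A_def)
  ultimately show "\<exists>A. countable A \<and> A \<subseteq> sets (lebesgue_Rn n) \<and>
      \<Union> A = space (lebesgue_Rn n) \<and> (\<forall>a\<in>A. emeasure (lebesgue_Rn n) a \<noteq> \<infinity>)"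
    by (intro exI[of _ "range A"]) auto
qed

lemma nn_integral_translate:
  assumes v: "v \<in> Rn n" and [measurable]: "f \<in> borel_measurable borel"
  shows "(\<integral>\<^sup>+x. f (\<lambda>i. x i + v i) \<partial>lebesgue_Rn n) = (\<integral>\<^sup>+x. f x \<partial>lebesgue_Rn n)"
proof -
  let ?P = "\<Pi>\<^sub>M i\<in>{..<n}. (lborel :: real measure)"
  let ?g = "\<lambda>x. \<lambda>i\<in>{..<n}. x i + v i"
  have g [measurable]: "?g \<in> ?P \<rightarrow>\<^sub>M ?P"
    by (intro measurable_restrict) auto
  have P: "distr ?P ?P ?g = ?P"
  proof (rule lborel_product.PiM_eqI)
    fix A :: "nat \<Rightarrow> real set" assume "\<And>i. i \<in> {..<n} \<Longrightarrow> A i \<in> sets lborel"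
    then have A [measurable]: "A i \<in> sets borel" if "i < n" for i using that by auto
    have "emeasure (distr ?P ?P ?g) (Pi\<^sub>E {..<n} A) = emeasure ?P (?g -` Pi\<^sub>E {..<n} A \<inter> space ?P)"
      by (intro emeasure_distr g sets_PiM_I_finite) (auto simp: A)
    also have "?g -` Pi\<^sub>E {..<n} A \<inter> space ?P = Pi\<^sub>E {..<n} (\<lambda>i. (+) (v i) -` A i)"
      by (auto simp: space_PiM PiE_iff add.commute)
    also have "emeasure ?P \<dots> = (\<Prod>i<n. emeasure lborel ((+) (v i) -` A i))"
      using A by (intro lborel_product.emeasure_PiM)
        (auto intro!: measurable_sets_borel[where M = borel])
    also have "\<dots> = (\<Prod>i<n. emeasure (distr lborel borel ((+) (v i))) (A i))"
      using A by (intro prod.cong) (auto simp: emeasure_distr)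
    finally show "emeasure (distr ?P ?P ?g) (Pi\<^sub>E {..<n} A) = (\<Prod>i<n. emeasure lborel (A i))"
      by (simp only: lborel_distr_plus)
  qed auto
  have "(\<integral>\<^sup>+x. f (\<lambda>i. x i + v i) \<partial>lebesgue_Rn n) = (\<integral>\<^sup>+x. f (\<lambda>i. truncate n x i + v i) \<partial>?P)"
    by (rule nn_integral_lebesgue_Rn) measurable
  also have "\<dots> = (\<integral>\<^sup>+x. f (truncate n (?g x)) \<partial>?P)"
    using v by (intro nn_integral_cong arg_cong[where f = f]) (auto simp: truncate_def Rn_eq fun_eq_iff)
  also have "\<dots> = (\<integral>\<^sup>+x. f (truncate n x) \<partial>distr ?P ?P ?g)"
    by (subst nn_integral_distr) auto
  also have "\<dots> = (\<integral>\<^sup>+x. f x \<partial>lebesgue_Rn n)"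
    unfolding P by (rule nn_integral_lebesgue_Rn[symmetric]) simp
  finally show ?thesis .
qed

text \<open>Weil's argument for the uniqueness of invariant measures: in the double integral of
$a(T x)\, b(y)$, translate $y$ by $T x$, exchange the integrals, translate $x$ by $-S y$, exchange again
and translate $y$ by $T x$ once more. For $T = S = 1$ this shows invariance under
$x \mapsto - x$; for a fixed $b$ it then shows that the integral of $a \circ T$ is a constant multiple
of the integral of $a$.\<close>

lemma lebesgue_Rn_swap:
  assumes [measurable]: "T \<in> borel \<rightarrow>\<^sub>M borel" "S \<in> borel \<rightarrow>\<^sub>M borel"
    and [measurable]: "a \<in> borel_measurable borel" "b \<in> borel_measurable borel"
    and diff: "\<And>x y. T (\<lambda>i. x i - y i) = (\<lambda>i. T x i - T y i)"
    and TR: "\<And>x. T x \<in> Rn n" and SR: "\<And>x. S x \<in> Rn n" and TS: "\<And>x. T (S x) = truncate n x"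
  shows "(\<integral>\<^sup>+x. a (T x) \<partial>lebesgue_Rn n) * (\<integral>\<^sup>+y. b y \<partial>lebesgue_Rn n) =
         (\<integral>\<^sup>+x. b (T x) \<partial>lebesgue_Rn n) * (\<integral>\<^sup>+y. a (\<lambda>i. - y i) \<partial>lebesgue_Rn n)"
proof -
  let ?L = "lebesgue_Rn n"
  interpret L: sigma_finite_measure ?L by (rule sigma_finite_lebesgue_Rn)
  interpret LL: pair_sigma_finite ?L ?L ..
  have "(\<integral>\<^sup>+x. a (T x) \<partial>?L) * (\<integral>\<^sup>+y. b y \<partial>?L) = (\<integral>\<^sup>+x. a (T x) * (\<integral>\<^sup>+y. b y \<partial>?L) \<partial>?L)"
    by (rule nn_integral_multc[symmetric]) measurable
  also have "\<dots> = (\<integral>\<^sup>+x. a (T x) * (\<integral>\<^sup>+y. b (\<lambda>i. y i + T x i) \<partial>?L) \<partial>?L)"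
    by (intro nn_integral_cong arg_cong2[where f = "(*)"] refl nn_integral_translate[symmetric] TR) measurable
  also have "\<dots> = (\<integral>\<^sup>+x. \<integral>\<^sup>+y. a (T x) * b (\<lambda>i. y i + T x i) \<partial>?L \<partial>?L)"
    by (intro nn_integral_cong nn_integral_cmult[symmetric]) measurable
  also have "\<dots> = (\<integral>\<^sup>+y. \<integral>\<^sup>+x. a (T x) * b (\<lambda>i. y i + T x i) \<partial>?L \<partial>?L)"
    by (rule LL.Fubini') measurable
  also have "\<dots> = (\<integral>\<^sup>+y. \<integral>\<^sup>+x. a (\<lambda>i. T x i - y i) * b (T x) \<partial>?L \<partial>?L)"
  proof (rule nn_integral_cong_AE, rule AE_mp[OF AE_lebesgue_Rn], intro AE_I2 impI)
    fix y assume y: "y \<in> Rn n"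
    define v where "v = (\<lambda>i. - S y i)"
    have v: "v \<in> Rn n" using SR[of y] by (auto simp: v_def Rn_eq)
    have Tv: "T (\<lambda>i. x i + v i) = (\<lambda>i. T x i - y i)" for x
      using diff[of x "S y"] y by (simp add: v_def TS truncate_eq)
    have "(\<integral>\<^sup>+x. a (T x) * b (\<lambda>i. y i + T x i) \<partial>?L) =
        (\<integral>\<^sup>+x. a (T (\<lambda>i. x i + v i)) * b (\<lambda>i. y i + T (\<lambda>i. x i + v i) i) \<partial>?L)"
      by (rule nn_integral_translate[OF v, symmetric]) measurable
    then show "(\<integral>\<^sup>+x. a (T x) * b (\<lambda>i. y i + T x i) \<partial>?L) = (\<integral>\<^sup>+x. a (\<lambda>i. T x i - y i) * b (T x) \<partial>?L)"
      by (simp add: Tv)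
  qed
  also have "\<dots> = (\<integral>\<^sup>+x. \<integral>\<^sup>+y. a (\<lambda>i. T x i - y i) * b (T x) \<partial>?L \<partial>?L)"
    by (rule LL.Fubini'[symmetric]) measurable
  also have "\<dots> = (\<integral>\<^sup>+x. (\<integral>\<^sup>+y. a (\<lambda>i. T x i - y i) \<partial>?L) * b (T x) \<partial>?L)"
    by (intro nn_integral_cong nn_integral_multc) measurable
  also have "\<dots> = (\<integral>\<^sup>+x. (\<integral>\<^sup>+y. a (\<lambda>i. - y i) \<partial>?L) * b (T x) \<partial>?L)"
  proof -
    have "(\<integral>\<^sup>+y. a (\<lambda>i. T x i - y i) \<partial>?L) = (\<integral>\<^sup>+y. a (\<lambda>i. T x i - (y i + T x i)) \<partial>?L)" for x
      by (rule nn_integral_translate[OF TR, symmetric]) measurable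
    then have "(\<integral>\<^sup>+y. a (\<lambda>i. T x i - y i) \<partial>?L) = (\<integral>\<^sup>+y. a (\<lambda>i. - y i) \<partial>?L)" for x by simp
    then show ?thesis by (simp only:)
  qed
  also have "\<dots> = (\<integral>\<^sup>+y. a (\<lambda>i. - y i) \<partial>?L) * (\<integral>\<^sup>+x. b (T x) \<partial>?L)"
    by (rule nn_integral_cmult) measurable
  finally show ?thesis by (simp add: mult.commute)
qed

definition unit_cube :: "nat \<Rightarrow> (nat \<Rightarrow> real) set" where
  "unit_cube n = {x. \<forall>i<n. x i \<in> {0..1}}"

lemma unit_cube_measurable [measurable]: "unit_cube n \<in> sets borel"
  by (simp add: unit_cube_def)

lemma nn_integral_unit_cube: "(\<integral>\<^sup>+x. indicator (unit_cube n) x \<partial>lebesgue_Rn n) = 1"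
  using emeasure_lebesgue_Rn_cube[of 1 n "\<lambda>_. 0"] by (simp add: unit_cube_def)

lemma nn_integral_reflect:
  assumes [measurable]: "a \<in> borel_measurable borel"
  shows "(\<integral>\<^sup>+x. a (\<lambda>i. - x i) \<partial>lebesgue_Rn n) = (\<integral>\<^sup>+x. a x \<partial>lebesgue_Rn n)"
proof -
  have tr: "(\<integral>\<^sup>+x. f (truncate n x) \<partial>lebesgue_Rn n) = (\<integral>\<^sup>+x. f x \<partial>lebesgue_Rn n)" for f :: "_ \<Rightarrow> ennreal"
    by (rule nn_integral_cong_AE, rule AE_mp[OF AE_lebesgue_Rn], intro AE_I2)
      (metis truncate_eq)
  have "(\<integral>\<^sup>+x. a (truncate n x) \<partial>lebesgue_Rn n) * (\<integral>\<^sup>+y. indicator (unit_cube n) y \<partial>lebesgue_Rn n) =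
         (\<integral>\<^sup>+x. indicator (unit_cube n) (truncate n x) \<partial>lebesgue_Rn n) * (\<integral>\<^sup>+y. a (\<lambda>i. - y i) \<partial>lebesgue_Rn n)"
    by (rule lebesgue_Rn_swap[OF measurable_truncate measurable_truncate _ _ _
          truncate_in_Rn truncate_in_Rn truncate_idem]) (auto simp: truncate_def)
  then show ?thesis unfolding tr nn_integral_unit_cube by simp
qed

lemma nn_integral_linear:
  assumes [measurable]: "T \<in> borel \<rightarrow>\<^sub>M borel" "S \<in> borel \<rightarrow>\<^sub>M borel"
    and diff: "\<And>x y. T (\<lambda>i. x i - y i) = (\<lambda>i. T x i - T y i)"
    and TR: "\<And>x. T x \<in> Rn n" and SR: "\<And>x. S x \<in> Rn n" and TS: "\<And>x. T (S x) = truncate n x"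
  obtains c where "\<And>a. a \<in> borel_measurable borel \<Longrightarrow>
     (\<integral>\<^sup>+x. a (T x) \<partial>lebesgue_Rn n) = c * (\<integral>\<^sup>+x. a x \<partial>lebesgue_Rn n)"
proof
  fix a :: "(nat \<Rightarrow> real) \<Rightarrow> ennreal" assume [measurable]: "a \<in> borel_measurable borel"
  show "(\<integral>\<^sup>+x. a (T x) \<partial>lebesgue_Rn n) =
      (\<integral>\<^sup>+x. indicator (unit_cube n) (T x) \<partial>lebesgue_Rn n) * (\<integral>\<^sup>+x. a x \<partial>lebesgue_Rn n)"
    using lebesgue_Rn_swap[OF assms(1,2) _ _ diff TR SR TS, of a "indicator (unit_cube n)"]
    by (simp add: nn_integral_unit_cube nn_integral_reflect)
qed

text \<open>Applying the involution twice shows that its factor satisfies $c^2 = 1$.\<close>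

lemma nn_integral_linear_involution:
  assumes [measurable]: "T \<in> borel \<rightarrow>\<^sub>M borel"
    and diff: "\<And>x y. T (\<lambda>i. x i - y i) = (\<lambda>i. T x i - T y i)"
    and TR: "\<And>x. T x \<in> Rn n" and TT: "\<And>x. T (T x) = truncate n x"
    and [measurable]: "a \<in> borel_measurable borel"
  shows "(\<integral>\<^sup>+x. a (T x) \<partial>lebesgue_Rn n) = (\<integral>\<^sup>+x. a x \<partial>lebesgue_Rn n)"
proof -
  obtain c where c: "\<And>a. a \<in> borel_measurable borel \<Longrightarrow>
     (\<integral>\<^sup>+x. a (T x) \<partial>lebesgue_Rn n) = c * (\<integral>\<^sup>+x. a x \<partial>lebesgue_Rn n)"
    using nn_integral_linear[OF assms(1,1) diff TR TR TT] by blast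
  have tr: "(\<integral>\<^sup>+x. f (truncate n x) \<partial>lebesgue_Rn n) = (\<integral>\<^sup>+x. f x \<partial>lebesgue_Rn n)" for f :: "_ \<Rightarrow> ennreal"
    by (rule nn_integral_cong_AE, rule AE_mp[OF AE_lebesgue_Rn], intro AE_I2)
      (metis truncate_eq)
  have "(1::ennreal) = (\<integral>\<^sup>+x. indicator (unit_cube n) (T (T x)) \<partial>lebesgue_Rn n)"
    unfolding TT tr nn_integral_unit_cube ..
  also have "\<dots> = c * c"
    by (subst c, simp, subst c) (simp_all add: nn_integral_unit_cube)
  finally have cc: "c * c = 1" by simp
  have "c = 1"
  proof (rule antisym)
    show "c \<le> 1"
    proof (rule ccontr)
      assume "\<not> c \<le> 1"
      then have "1 < c" by simp
      then have "c * 1 \<le> c * c" by (intro mult_left_mono) auto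
      with cc \<open>1 < c\<close> show False by simp
    qed
    show "1 \<le> c"
    proof (rule ccontr)
      assume "\<not> 1 \<le> c"
      then have "c < 1" by simp
      then have "c * c \<le> c * 1" by (intro mult_left_mono) auto
      with cc \<open>c < 1\<close> show False by simp
    qed
  qed
  then show ?thesis using c[of a] by simp
qed


section \<open>Gaussian measure and reflections in hyperplanes\<close>

definition gaussian :: "nat \<Rightarrow> (nat \<Rightarrow> real) measure" where
  "gaussian n = density (lebesgue_Rn n) (\<lambda>x. ennreal (\<Prod>i<n. std_normal_density (x i)))"

lemma sets_gaussian [simp, measurable_cong]: "sets (gaussian n) = sets borel"
  by (simp add: gaussian_def)

lemma space_gaussian [simp]: "space (gaussian n) = UNIV"
  by (simp add: gaussian_def)

lemma prod_std_normal_density: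
  "(\<Prod>i<n. std_normal_density (x i)) = (1 / sqrt (2 * pi)) ^ n * exp (- (\<Sum>i<n. (x i)\<^sup>2) / 2)"
  by (induction n) (simp_all add: std_normal_density_def exp_add[symmetric] add_divide_distrib)

lemma nn_integral_gaussian_prod:
  assumes [measurable]: "\<And>i. f i \<in> borel_measurable borel"
  shows "(\<integral>\<^sup>+x. (\<Prod>i<n. f i (x i)) \<partial>gaussian n) =
     (\<Prod>i<n. \<integral>\<^sup>+t. ennreal (std_normal_density t) * f i t \<partial>lborel)"
proof -
  have "(\<integral>\<^sup>+x. (\<Prod>i<n. f i (x i)) \<partial>gaussian n) =
      (\<integral>\<^sup>+x. (\<Prod>i<n. ennreal (std_normal_density (x i)) * f i (x i)) \<partial>lebesgue_Rn n)"
    unfolding gaussian_def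
    by (subst nn_integral_density) (auto simp: prod.distrib prod_ennreal normal_density_nonneg)
  also have "\<dots> = (\<integral>\<^sup>+x. (\<Prod>i<n. ennreal (std_normal_density (truncate n x i)) * f i (truncate n x i))
      \<partial>(\<Pi>\<^sub>M i\<in>{..<n}. lborel))"
    by (rule nn_integral_lebesgue_Rn) measurable
  also have "\<dots> = (\<integral>\<^sup>+x. (\<Prod>i<n. ennreal (std_normal_density (x i)) * f i (x i)) \<partial>(\<Pi>\<^sub>M i\<in>{..<n}. lborel))"
    by (intro nn_integral_cong prod.cong) (auto simp: truncate_def)
  also have "\<dots> = (\<Prod>i<n. \<integral>\<^sup>+t. ennreal (std_normal_density t) * f i t \<partial>lborel)"
    by (rule lborel_product.product_nn_integral_prod) auto
  finally show ?thesis .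
qed

lemma nn_integral_std_normal: "(\<integral>\<^sup>+t. ennreal (std_normal_density t) \<partial>lborel) = 1"
  using prob_space.emeasure_space_1[OF prob_space_normal_density[of 1 0]]
  by (simp add: emeasure_density)

lemma prob_space_gaussian: "prob_space (gaussian n)"
proof
  have "emeasure (gaussian n) (space (gaussian n)) = (\<integral>\<^sup>+x. (\<Prod>i<n. 1) \<partial>gaussian n)"
    by simp
  also have "\<dots> = 1"
    by (subst nn_integral_gaussian_prod) (auto simp: nn_integral_std_normal)
  finally show "emeasure (gaussian n) (space (gaussian n)) = 1" .
qed

lemma nn_integral_gaussian_coordinate:
  assumes "j < n" and [measurable]: "f \<in> borel_measurable borel"
  shows "(\<integral>\<^sup>+x. f (x j) \<partial>gaussian n) = (\<integral>\<^sup>+t. ennreal (std_normal_density t) * f t \<partial>lborel)"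
proof -
  have "(\<integral>\<^sup>+x. f (x j) \<partial>gaussian n) = (\<integral>\<^sup>+x. (\<Prod>i<n. (if i = j then f (x i) else 1)) \<partial>gaussian n)"
    using assms(1) by (simp add: prod.delta)
  also have "\<dots> = (\<Prod>i<n. \<integral>\<^sup>+t. ennreal (std_normal_density t) * (if i = j then f t else 1) \<partial>lborel)"
    by (rule nn_integral_gaussian_prod) measurable
  also have "\<dots> = (\<Prod>i<n. if i = j then (\<integral>\<^sup>+t. ennreal (std_normal_density t) * f t \<partial>lborel) else 1)"
    by (intro prod.cong refl) (auto simp: nn_integral_std_normal)
  finally show ?thesis using assms(1) by (simp add: prod.delta)
qed

lemma gaussian_abs_moment:
  assumes "j < n"
  shows "integrable (gaussian n) (\<lambda>x. \<bar>x j\<bar>)" "(\<integral>x. \<bar>x j\<bar> \<partial>gaussian n) = sqrt (2 / pi)"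
proof -
  have "(\<integral>\<^sup>+x. ennreal \<bar>x j\<bar> \<partial>gaussian n) = (\<integral>\<^sup>+t. ennreal (std_normal_density t * \<bar>t\<bar>) \<partial>lborel)"
    by (subst nn_integral_gaussian_coordinate[OF assms]) (auto simp: ennreal_mult normal_density_nonneg)
  also have "\<dots> = ennreal (sqrt (2 / pi))"
    using std_normal_moment_abs_odd[of 0]
    by (intro nn_integral_eq_integrable[THEN iffD2])
      (auto simp: has_bochner_integral_iff normal_density_nonneg)
  finally have *: "(\<integral>\<^sup>+x. ennreal \<bar>x j\<bar> \<partial>gaussian n) = ennreal (sqrt (2 / pi))" .
  then have "has_bochner_integral (gaussian n) (\<lambda>x. \<bar>x j\<bar>) (sqrt (2 / pi))"
    by (intro has_bochner_integral_nn_integral) auto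
  then show "integrable (gaussian n) (\<lambda>x. \<bar>x j\<bar>)" "(\<integral>x. \<bar>x j\<bar> \<partial>gaussian n) = sqrt (2 / pi)"
    by (auto simp: has_bochner_integral_iff)
qed

lemma gaussian_second_moment:
  assumes "j < n"
  shows "integrable (gaussian n) (\<lambda>x. (x j)\<^sup>2)" "(\<integral>x. (x j)\<^sup>2 \<partial>gaussian n) = 1"
proof -
  have "(\<integral>\<^sup>+x. ennreal ((x j)\<^sup>2) \<partial>gaussian n) = (\<integral>\<^sup>+t. ennreal (std_normal_density t * t\<^sup>2) \<partial>lborel)"
    by (subst nn_integral_gaussian_coordinate[OF assms]) (auto simp: ennreal_mult normal_density_nonneg)
  also have "\<dots> = ennreal 1"
    using std_normal_moment_even[of 1]
    by (intro nn_integral_eq_integrable[THEN iffD2])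
      (auto simp: has_bochner_integral_iff normal_density_nonneg)
  finally have *: "(\<integral>\<^sup>+x. ennreal ((x j)\<^sup>2) \<partial>gaussian n) = ennreal 1" .
  then have "has_bochner_integral (gaussian n) (\<lambda>x. (x j)\<^sup>2) 1"
    by (intro has_bochner_integral_nn_integral) auto
  then show "integrable (gaussian n) (\<lambda>x. (x j)\<^sup>2)" "(\<integral>x. (x j)\<^sup>2 \<partial>gaussian n) = 1"
    by (auto simp: has_bochner_integral_iff)
qed

text \<open>The Gaussian density is a function of the Euclidean length, and Lebesgue measure is preserved by
linear involutions.\<close>

lemma gaussian_linear_involution:
  assumes T [measurable]: "T \<in> borel \<rightarrow>\<^sub>M borel"
    and diff: "\<And>x y. T (\<lambda>i. x i - y i) = (\<lambda>i. T x i - T y i)"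
    and TR: "\<And>x. T x \<in> Rn n" and TT: "\<And>x. T (T x) = truncate n x"
    and iso: "\<And>x. (\<Sum>i<n. (T x i)\<^sup>2) = (\<Sum>i<n. (x i)\<^sup>2)"
  shows "distr (gaussian n) borel T = gaussian n"
proof (rule measure_eqI)
  fix A assume "A \<in> sets (distr (gaussian n) borel T)"
  then have A [measurable]: "A \<in> sets borel" by simp
  have "T -` A \<in> sets borel" using measurable_sets_borel[OF T A] .
  then have "emeasure (distr (gaussian n) borel T) A =
     (\<integral>\<^sup>+x. ennreal (\<Prod>i<n. std_normal_density (x i)) * indicator (T -` A) x \<partial>lebesgue_Rn n)"
    by (subst emeasure_distr) (auto simp: gaussian_def emeasure_density)
  also have "\<dots> = (\<integral>\<^sup>+x. ennreal (\<Prod>i<n. std_normal_density (T x i)) * indicator A (T x) \<partial>lebesgue_Rn n)"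
    unfolding prod_std_normal_density iso by (intro nn_integral_cong) (auto split: split_indicator)
  also have "\<dots> = (\<integral>\<^sup>+x. ennreal (\<Prod>i<n. std_normal_density (x i)) * indicator A x \<partial>lebesgue_Rn n)"
    by (rule nn_integral_linear_involution[OF T diff TR TT]) measurable
  also have "\<dots> = emeasure (gaussian n) A"
    by (simp add: gaussian_def emeasure_density)
  finally show "emeasure (distr (gaussian n) borel T) A = emeasure (gaussian n) A" .
qed simp

text \<open>The reflection in the hyperplane orthogonal to $w$, followed by the projection to $R^n$. For
$w = 0$ the division by zero makes it the projection alone.\<close>

definition householder :: "nat \<Rightarrow> (nat \<Rightarrow> real) \<Rightarrow> (nat \<Rightarrow> real) \<Rightarrow> nat \<Rightarrow> real" where
  "householder n w x = (\<lambda>i. if i < n then x i - 2 * dot n x w / dot n w w * w i else 0)"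

lemma dot_diff_left: "dot n (\<lambda>i. x i - y i) z = dot n x z - dot n y z"
  by (simp add: dot_def left_diff_distrib sum_subtractf)

lemma dot_diff_right: "dot n z (\<lambda>i. x i - y i) = dot n z x - dot n z y"
  by (simp add: dot_def right_diff_distrib sum_subtractf)

lemma dot_cmult_left: "dot n (\<lambda>i. c * x i) z = c * dot n x z"
  by (simp add: dot_def sum_distrib_left mult.assoc)

lemma dot_commute: "dot n x y = dot n y x"
  by (simp add: dot_def mult.commute)

lemma dot_cong: "(\<And>i. i < n \<Longrightarrow> x i = x' i) \<Longrightarrow> (\<And>i. i < n \<Longrightarrow> y i = y' i) \<Longrightarrow> dot n x y = dot n x' y'"
  by (simp add: dot_def)

lemma dot_self: "dot n x x = (\<Sum>i<n. (x i)\<^sup>2)"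
  by (simp add: dot_def power2_eq_square)

lemma dot_householder_left:
  "dot n (householder n w x) z = dot n x z - 2 * dot n x w / dot n w w * dot n w z"
proof -
  have "dot n (householder n w x) z = dot n (\<lambda>i. x i - (2 * dot n x w / dot n w w) * w i) z"
    by (rule dot_cong) (auto simp: householder_def)
  then show ?thesis by (simp only: dot_diff_left dot_cmult_left)
qed

lemma dot_householder:
  "dot n (householder n w x) (householder n w y) = dot n x y"
proof (cases "dot n w w = 0")
  case True
  then have "dot n (householder n w x) (householder n w y) = dot n x y"
    by (intro dot_cong) (auto simp: householder_def)
  then show ?thesis .
next
  case False
  have "dot n x (householder n w y) = dot n x y - 2 * dot n y w / dot n w w * dot n w x"
    "dot n w (householder n w y) = - dot n y w"
    using False by (auto simp: dot_commute[of n _ "householder n w y"] dot_householder_left)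
      (auto simp: dot_commute)
  then show ?thesis
    using False by (simp add: dot_householder_left) (simp add: dot_commute field_simps)
qed

lemma householder_involution: "householder n w (householder n w x) = truncate n x"
proof (cases "dot n w w = 0")
  case True
  then show ?thesis by (auto simp: householder_def truncate_def)
next
  case False
  then have "dot n (householder n w x) w = - dot n x w"
    by (simp add: dot_householder_left)
  then show ?thesis
    using False by (auto simp: householder_def[of n w "householder n w x"] truncate_def)
      (auto simp: householder_def)
qed

lemma householder_in_Rn [simp]: "householder n w x \<in> Rn n"
  by (simp add: Rn_eq householder_def)

lemma measurable_dot [measurable]: "(\<lambda>x. dot n x y) \<in> borel_measurable borel"
  unfolding dot_def by measurable

lemma measurable_householder [measurable]: "householder n w \<in> borel \<rightarrow>\<^sub>M borel"
  unfolding householder_def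
  by (rule measurable_coordinatewise_then_product) measurable

lemma householder_diff:
  "householder n w (\<lambda>i. x i - y i) = (\<lambda>i. householder n w x i - householder n w y i)"
  by (auto simp: householder_def dot_diff_left algebra_simps diff_divide_distrib)

lemma householder_add_cmult:
  "householder n w (\<lambda>i. a * x i + b * y i) = (\<lambda>i. a * householder n w x i + b * householder n w y i)"
  by (auto simp: householder_def dot_def sum.distrib sum_distrib_left[symmetric] algebra_simps add_divide_distrib)

lemma gaussian_householder: "distr (gaussian n) borel (householder n w) = gaussian n"
  by (rule gaussian_linear_involution[OF measurable_householder householder_diff householder_in_Rn
        householder_involution dot_householder[of n w x x for x, unfolded dot_self]])

lemma gaussian_signs:
  assumes "\<And>i. \<epsilon> i = 1 \<or> \<epsilon> i = -1"
  shows "distr (gaussian n) borel (\<lambda>x i. if i < n then \<epsilon> i * x i else 0) = gaussian n"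
proof -
  have e: "\<epsilon> i * \<epsilon> i = 1" "(\<epsilon> i)\<^sup>2 = 1" for i using assms[of i] by auto
  show ?thesis
  proof (rule gaussian_linear_involution)
    show "(\<lambda>x i. if i < n then \<epsilon> i * x i else 0) \<in> (borel :: (nat \<Rightarrow> real) measure) \<rightarrow>\<^sub>M borel"
      by (rule measurable_coordinatewise_then_product) measurable
  qed (auto simp: Rn_eq truncate_def e power_mult_distrib mult.assoc[symmetric] right_diff_distrib)
qed

lemma gaussian_orthogonal:
  assumes "j < n" "k < n"
  shows "integrable (gaussian n) (\<lambda>x. x j * x k)"
    "(\<integral>x. x j * x k \<partial>gaussian n) = (if j = k then 1 else 0)"
proof -
  have "integrable (gaussian n) (\<lambda>x. (x j)\<^sup>2 + (x k)\<^sup>2)"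
    using assms by (intro Bochner_Integration.integrable_add gaussian_second_moment)
  then show "integrable (gaussian n) (\<lambda>x. x j * x k)"
  proof (rule Bochner_Integration.integrable_bound)
    have "\<bar>a * b\<bar> \<le> a\<^sup>2 + b\<^sup>2" for a b :: real
    proof -
      have "\<bar>2 * (a * b)\<bar> \<le> a\<^sup>2 + b\<^sup>2"
        using sum_squares_bound[of a b] sum_squares_bound[of "- a" b] by (simp add: abs_le_iff)
      moreover have "\<bar>2 * (a * b)\<bar> = 2 * \<bar>a * b\<bar>" by (simp add: abs_mult)
      ultimately show ?thesis by linarith
    qed
    then show "AE x in gaussian n. norm (x j * x k) \<le> norm ((x j)\<^sup>2 + (x k)\<^sup>2)"
      by (intro AE_I2) auto
  qed auto
  show "(\<integral>x. x j * x k \<partial>gaussian n) = (if j = k then 1 else 0)"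
  proof (cases "j = k")
    case True
    then show ?thesis using gaussian_second_moment(2)[OF assms(1)] by (simp add: power2_eq_square)
  next
    case False
    \<comment> \<open>Flipping the sign of one coordinate changes the sign of the integral.\<close>
    define \<epsilon> where "\<epsilon> i = (if i = j then -1 else 1 :: real)" for i
    have g: "distr (gaussian n) borel (\<lambda>x i. if i < n then \<epsilon> i * x i else 0) = gaussian n"
      by (rule gaussian_signs) (auto simp: \<epsilon>_def)
    have m [measurable]: "(\<lambda>x i. if i < n then \<epsilon> i * x i else 0) \<in> (borel :: (nat \<Rightarrow> real) measure) \<rightarrow>\<^sub>M borel"
      by (rule measurable_coordinatewise_then_product) measurable
    have "(\<integral>x. x j * x k \<partial>gaussian n) =
        (\<integral>x. (if j < n then \<epsilon> j * x j else 0) * (if k < n then \<epsilon> k * x k else 0) \<partial>gaussian n)"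
      by (subst g[symmetric], subst integral_distr) auto
    also have "\<dots> = (\<integral>x. - (x j * x k) \<partial>gaussian n)"
      using False assms by (simp add: \<epsilon>_def)
    finally show ?thesis using False by simp
  qed
qed


section \<open>Cotype and sign-invariant families of random vectors\<close>

abbreviation l2norm :: "nat \<Rightarrow> (nat \<Rightarrow> real) \<Rightarrow> real" where
  "l2norm n x \<equiv> L2_set x {..<n}"

definition basis_vec :: "nat \<Rightarrow> nat \<Rightarrow> real" where
  "basis_vec j = (\<lambda>i. if i = j then 1 else 0)"

context seminorm_Rn
begin

text \<open>A Lipschitz constant of $q$ for the maximum norm, hence also for the Euclidean norm.\<close>

definition bound :: real where
  "bound = (\<Sum>j<n. q (basis_vec j))"

lemma bound_nonneg: "0 \<le> bound"
  unfolding bound_def by (intro sum_nonneg nonneg)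

lemma le_weighted_sum: "q x \<le> (\<Sum>j<n. \<bar>x j\<bar> * q (basis_vec j))"
proof -
  have "truncate n x = (\<lambda>i. \<Sum>j<n. x j * basis_vec j i)"
    by (auto simp: truncate_def basis_vec_def fun_eq_iff if_distrib[of "(*) _"] cong: if_cong)
  then have "q x = q (\<lambda>i. \<Sum>j<n. x j * basis_vec j i)"
    using depends[of x] by simp
  also have "\<dots> \<le> (\<Sum>j<n. q (\<lambda>i. x j * basis_vec j i))"
    by (rule sum_le) simp
  finally show ?thesis by (simp add: homogeneous)
qed

lemma le_bound_coordinates:
  assumes "\<And>j. j < n \<Longrightarrow> \<bar>x j\<bar> \<le> d"
  shows "q x \<le> d * bound"
proof -
  have "q x \<le> (\<Sum>j<n. d * q (basis_vec j))"
    by (rule order_trans[OF le_weighted_sum])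
      (intro sum_mono mult_right_mono nonneg, use assms in auto)
  then show ?thesis by (simp add: bound_def sum_distrib_left)
qed

lemma le_bound_l2norm: "q x \<le> bound * l2norm n x"
  using le_bound_coordinates[of x "l2norm n x"] member_le_L2_set[of "{..<n}" _ "\<lambda>i. \<bar>x i\<bar>"]
  by (simp add: mult.commute L2_set_def)

lemma diff_le: "\<bar>q x - q y\<bar> \<le> q (\<lambda>i. x i - y i)"
proof -
  have "q (\<lambda>i. y i - x i) = q (\<lambda>i. x i - y i)"
    using homogeneous[of "-1" "\<lambda>i. x i - y i"] by simp
  then show ?thesis
    using triangle[of y "\<lambda>i. x i - y i"] triangle[of x "\<lambda>i. y i - x i"] by simp
qed

lemma continuous: "continuous_on UNIV q"
  unfolding continuous_on_eq_continuous_at[OF open_UNIV]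
proof
  fix x :: "nat \<Rightarrow> real"
  let ?b = "\<lambda>y. \<Sum>j<n. \<bar>y j - x j\<bar> * q (basis_vec j)"
  have "continuous_on UNIV ?b"
    by (intro continuous_intros continuous_on_product_coordinates)
  then have "isCont ?b x"
    using continuous_on_eq_continuous_at[OF open_UNIV] by blast
  then have "(?b \<longlongrightarrow> ?b x) (at x)"
    by (rule isContD)
  then have "(?b \<longlongrightarrow> 0) (at x)" by simp
  then have "((\<lambda>y. q y - q x) \<longlongrightarrow> 0) (at x)"
  proof (rule Lim_null_comparison[rotated], intro always_eventually allI)
    fix y show "norm (q y - q x) \<le> ?b y"
      using diff_le[of y x] le_weighted_sum[of "\<lambda>i. y i - x i"] by simp
  qed
  then show "isCont q x"
    by (simp add: isCont_def LIM_zero_iff)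
qed

lemma measurable_seminorm [measurable]: "q \<in> borel_measurable borel"
  by (rule borel_measurable_continuous_onI[OF continuous])

end

lemma seminorm_l2norm: "seminorm_Rn n (l2norm n)"
proof
  show "l2norm n (\<lambda>i. x i + y i) \<le> l2norm n x + l2norm n y" for x y
    by (rule L2_set_triangle_ineq)
  show "l2norm n (\<lambda>i. c * x i) = \<bar>c\<bar> * l2norm n x" for c x
    by (simp add: L2_set_def power_mult_distrib sum_distrib_left[symmetric] real_sqrt_mult)
  show "l2norm n (truncate n x) = l2norm n x" for x
    by (simp add: L2_set_def truncate_def)
qed

lemmas measurable_l2norm [measurable] = seminorm_Rn.measurable_seminorm[OF seminorm_l2norm]

lemma l2norm_dot: "l2norm n x = sqrt (dot n x x)"
  by (simp add: L2_set_def dot_self)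

lemma l2norm_square: "(l2norm n x)\<^sup>2 = dot n x x"
  by (simp add: l2norm_dot dot_self sum_nonneg)

lemma l2norm_householder [simp]: "l2norm n (householder n w x) = l2norm n x"
  by (simp add: l2norm_dot dot_householder)

text \<open>The cotype 2 inequality with constant $A$, in squared form and for an arbitrary real function, so that it
can be transported along linear maps.\<close>

definition cotype2_bound :: "((nat \<Rightarrow> real) \<Rightarrow> real) \<Rightarrow> real \<Rightarrow> bool" where
  "cotype2_bound q A \<longleftrightarrow> (\<forall>k (x :: nat \<Rightarrow> nat \<Rightarrow> real).
     (\<Sum>j<k. (q (x j))\<^sup>2) \<le> A\<^sup>2 * sign_average k (\<lambda>\<epsilon>. (q (\<lambda>i. \<Sum>j<k. \<epsilon> j * x j i))\<^sup>2))"

text \<open>Minkowski's inequality in $\ell_2$: pair the random vector $(Z_j)$ with its mean and apply the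
Cauchy-Schwarz inequality before integrating.\<close>

lemma L2_set_integral_le:
  assumes J: "finite J"
    and int: "\<And>j. j \<in> J \<Longrightarrow> integrable M (Z j)"
    and nonneg: "\<And>j \<omega>. j \<in> J \<Longrightarrow> 0 \<le> Z j \<omega>"
  shows "integrable M (\<lambda>\<omega>. L2_set (\<lambda>j. Z j \<omega>) J)"
    "L2_set (\<lambda>j. \<integral>\<omega>. Z j \<omega> \<partial>M) J \<le> (\<integral>\<omega>. L2_set (\<lambda>j. Z j \<omega>) J \<partial>M)"
proof -
  have meas [measurable]: "Z j \<in> borel_measurable M" if "j \<in> J" for j
    using int[OF that] by simp
  show i: "integrable M (\<lambda>\<omega>. L2_set (\<lambda>j. Z j \<omega>) J)"
  proof (rule Bochner_Integration.integrable_bound)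
    show "integrable M (\<lambda>\<omega>. \<Sum>j\<in>J. Z j \<omega>)" using int by auto
    show "(\<lambda>\<omega>. L2_set (\<lambda>j. Z j \<omega>) J) \<in> borel_measurable M"
      unfolding L2_set_def by measurable
    show "AE \<omega> in M. norm (L2_set (\<lambda>j. Z j \<omega>) J) \<le> norm (\<Sum>j\<in>J. Z j \<omega>)"
      using nonneg by (intro AE_I2) (auto simp: sum_nonneg intro!: L2_set_le_sum)
  qed
  define u where "u j = (\<integral>\<omega>. Z j \<omega> \<partial>M)" for j
  have u: "0 \<le> u j" if "j \<in> J" for j
    unfolding u_def using nonneg[OF that] by simp
  define s where "s = L2_set u J"
  have s: "0 \<le> s" by (simp add: s_def)
  have "s * s = (\<Sum>j\<in>J. u j * u j)"
    by (simp add: s_def L2_set_def sum_nonneg power2_eq_square[symmetric])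
  also have "\<dots> = (\<integral>\<omega>. (\<Sum>j\<in>J. u j * Z j \<omega>) \<partial>M)"
    using int by (simp add: u_def)
  also have "\<dots> \<le> (\<integral>\<omega>. s * L2_set (\<lambda>j. Z j \<omega>) J \<partial>M)"
  proof (rule integral_mono)
    show "integrable M (\<lambda>\<omega>. \<Sum>j\<in>J. u j * Z j \<omega>)" using int by auto
    show "integrable M (\<lambda>\<omega>. s * L2_set (\<lambda>j. Z j \<omega>) J)" using i by simp
    show "(\<Sum>j\<in>J. u j * Z j \<omega>) \<le> s * L2_set (\<lambda>j. Z j \<omega>) J" for \<omega>
    proof -
      have "(\<Sum>j\<in>J. u j * Z j \<omega>) = (\<Sum>j\<in>J. \<bar>u j\<bar> * \<bar>Z j \<omega>\<bar>)"
        using u nonneg by (intro sum.cong) auto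
      then show ?thesis unfolding s_def using L2_set_mult_ineq[of u "\<lambda>j. Z j \<omega>" J] by simp
    qed
  qed
  also have "\<dots> = s * (\<integral>\<omega>. L2_set (\<lambda>j. Z j \<omega>) J \<partial>M)" by simp
  finally have le: "s * s \<le> s * (\<integral>\<omega>. L2_set (\<lambda>j. Z j \<omega>) J \<partial>M)" .
  have "s \<le> (\<integral>\<omega>. L2_set (\<lambda>j. Z j \<omega>) J \<partial>M)"
  proof (cases "s = 0")
    case True
    then show ?thesis by simp
  next
    case False
    then show ?thesis using le s by (simp add: mult_le_cancel_left)
  qed
  then show "L2_set (\<lambda>j. \<integral>\<omega>. Z j \<omega> \<partial>M) J \<le> (\<integral>\<omega>. L2_set (\<lambda>j. Z j \<omega>) J \<partial>M)"
    by (simp add: s_def u_def[abs_def])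
qed

lemma sign_average_integral:
  assumes "\<And>\<epsilon>. (\<And>i. \<epsilon> i = 1 \<or> \<epsilon> i = -1) \<Longrightarrow> integrable M (F \<epsilon>)"
  shows "integrable M (\<lambda>\<omega>. sign_average k (\<lambda>\<epsilon>. F \<epsilon> \<omega>)) \<and>
     (\<integral>\<omega>. sign_average k (\<lambda>\<epsilon>. F \<epsilon> \<omega>) \<partial>M) = sign_average k (\<lambda>\<epsilon>. \<integral>\<omega>. F \<epsilon> \<omega> \<partial>M)"
  using assms
proof (induction k arbitrary: F)
  case 0
  then show ?case by simp
next
  case (Suc k)
  have *: "integrable M (\<lambda>\<omega>. sign_average k (\<lambda>\<epsilon>. F (\<epsilon>(k := c)) \<omega>)) \<and>
     (\<integral>\<omega>. sign_average k (\<lambda>\<epsilon>. F (\<epsilon>(k := c)) \<omega>) \<partial>M) =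
       sign_average k (\<lambda>\<epsilon>. \<integral>\<omega>. F (\<epsilon>(k := c)) \<omega> \<partial>M)" if "c = 1 \<or> c = -1" for c
    using that by (intro Suc.IH Suc.prems) auto
  from *[of 1] *[of "-1"] show ?case by simp
qed

lemma sign_average_cong:
  "(\<And>\<epsilon>. (\<And>i. \<epsilon> i = 1 \<or> \<epsilon> i = -1) \<Longrightarrow> F \<epsilon> = G \<epsilon>) \<Longrightarrow> sign_average k F = sign_average k G"
  by (intro antisym sign_average_mono) auto

context seminorm_Rn
begin

text \<open>The common source of both bounds of the theorem. The sign hypothesis lets the right hand side be
averaged over all signs; the pointwise chain is then cotype 2, \<open>kahane_1_2\<close> and Minkowski's
inequality.\<close>

lemma cotype2_expectation:
  fixes k :: nat and Y :: "nat \<Rightarrow> 'w \<Rightarrow> nat \<Rightarrow> real"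
  assumes A: "cotype2_bound q A" "0 < A"
    and Y [measurable]: "\<And>j. j < k \<Longrightarrow> Y j \<in> M \<rightarrow>\<^sub>M borel"
    and int: "\<And>j. j < k \<Longrightarrow> integrable M (\<lambda>\<omega>. q (Y j \<omega>))"
    and sign: "\<And>\<epsilon>. (\<And>i. \<epsilon> i = 1 \<or> \<epsilon> i = -1) \<Longrightarrow>
      (\<integral>\<omega>. q (\<lambda>i. \<Sum>j<k. \<epsilon> j * Y j \<omega> i) \<partial>M) = (\<integral>\<omega>. q (\<lambda>i. \<Sum>j<k. Y j \<omega> i) \<partial>M)"
  shows "L2_set (\<lambda>j. \<integral>\<omega>. q (Y j \<omega>) \<partial>M) {..<k} \<le> sqrt 2 * A * (\<integral>\<omega>. q (\<lambda>i. \<Sum>j<k. Y j \<omega> i) \<partial>M)"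
proof -
  have int\<epsilon>: "integrable M (\<lambda>\<omega>. q (\<lambda>i. \<Sum>j<k. \<epsilon> j * Y j \<omega> i))"
    if \<epsilon>: "\<And>i. \<epsilon> i = 1 \<or> \<epsilon> i = -1" for \<epsilon>
  proof (rule Bochner_Integration.integrable_bound)
    show "integrable M (\<lambda>\<omega>. \<Sum>j<k. q (Y j \<omega>))" using int by auto
    show "(\<lambda>\<omega>. q (\<lambda>i. \<Sum>j<k. \<epsilon> j * Y j \<omega> i)) \<in> borel_measurable M"
      by measurable
    have "q (\<lambda>i. \<Sum>j<k. \<epsilon> j * Y j \<omega> i) \<le> (\<Sum>j<k. q (Y j \<omega>))" for \<omega>
    proof -
      have "\<bar>\<epsilon> j\<bar> = 1" for j using \<epsilon>[of j] by auto
      then show ?thesis using sum_le[where J = "{..<k}" and x = "\<lambda>j i. \<epsilon> j * Y j \<omega> i"] by (simp add: homogeneous)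
    qed
    then show "AE \<omega> in M. norm (q (\<lambda>i. \<Sum>j<k. \<epsilon> j * Y j \<omega> i)) \<le> norm (\<Sum>j<k. q (Y j \<omega>))"
      by (intro AE_I2) (auto simp: nonneg sum_nonneg)
  qed
  have avg: "integrable M (\<lambda>\<omega>. sign_average k (\<lambda>\<epsilon>. q (\<lambda>i. \<Sum>j<k. \<epsilon> j * Y j \<omega> i)))"
    "(\<integral>\<omega>. sign_average k (\<lambda>\<epsilon>. q (\<lambda>i. \<Sum>j<k. \<epsilon> j * Y j \<omega> i)) \<partial>M) =
      (\<integral>\<omega>. q (\<lambda>i. \<Sum>j<k. Y j \<omega> i) \<partial>M)"
    using sign_average_integral[where F = "\<lambda>\<epsilon> \<omega>. q (\<lambda>i. \<Sum>j<k. \<epsilon> j * Y j \<omega> i)", OF int\<epsilon>]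
      sign_average_cong[of "\<lambda>\<epsilon>. \<integral>\<omega>. q (\<lambda>i. \<Sum>j<k. \<epsilon> j * Y j \<omega> i) \<partial>M", OF sign, of k]
    by (simp_all add: sign_average_const)
  have "L2_set (\<lambda>j. \<integral>\<omega>. q (Y j \<omega>) \<partial>M) {..<k} \<le> (\<integral>\<omega>. L2_set (\<lambda>j. q (Y j \<omega>)) {..<k} \<partial>M)"
    using int by (intro L2_set_integral_le) (auto simp: nonneg)
  also have "\<dots> \<le> (\<integral>\<omega>. sqrt 2 * A * sign_average k (\<lambda>\<epsilon>. q (\<lambda>i. \<Sum>j<k. \<epsilon> j * Y j \<omega> i)) \<partial>M)"
  proof (rule integral_mono)
    show "integrable M (\<lambda>\<omega>. L2_set (\<lambda>j. q (Y j \<omega>)) {..<k})"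
      using int by (intro L2_set_integral_le) (auto simp: nonneg)
    show "integrable M (\<lambda>\<omega>. sqrt 2 * A * sign_average k (\<lambda>\<epsilon>. q (\<lambda>i. \<Sum>j<k. \<epsilon> j * Y j \<omega> i)))"
      using avg by simp
    fix \<omega>
    let ?S = "\<lambda>\<epsilon>. q (\<lambda>i. \<Sum>j<k. \<epsilon> j * Y j \<omega> i)"
    have "(\<Sum>j<k. (q (Y j \<omega>))\<^sup>2) \<le> A\<^sup>2 * sign_average k (\<lambda>\<epsilon>. (?S \<epsilon>)\<^sup>2)"
      using A(1)[unfolded cotype2_bound_def, rule_format, of "\<lambda>j. Y j \<omega>" k] .
    also have "\<dots> \<le> A\<^sup>2 * (2 * (sign_average k ?S)\<^sup>2)"
      by (intro mult_left_mono kahane_1_2) auto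
    also have "\<dots> = (sqrt 2 * A * sign_average k ?S)\<^sup>2"
      by (simp add: power_mult_distrib)
    finally show "L2_set (\<lambda>j. q (Y j \<omega>)) {..<k} \<le> sqrt 2 * A * sign_average k ?S"
      unfolding L2_set_def using A(2)
      by (intro real_le_lsqrt) (auto intro!: sum_nonneg mult_nonneg_nonneg sign_average_nonneg nonneg)
  qed
  also have "\<dots> = sqrt 2 * A * (\<integral>\<omega>. q (\<lambda>i. \<Sum>j<k. Y j \<omega> i) \<partial>M)"
    using avg by simp
  finally show ?thesis .
qed

end


section \<open>Reflection-invariant measures and means over the sphere\<close>

lemma l2norm_nonneg: "0 \<le> l2norm n x" by simp

lemma l2norm_eq_0_iff: "l2norm n x = 0 \<longleftrightarrow> (\<forall>i<n. x i = 0)"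
  by (auto simp: L2_set_eq_0_iff)

lemma householder_swap:
  assumes "l2norm n x = l2norm n z"
  shows "householder n (\<lambda>i. x i - z i) x = truncate n z"
proof -
  let ?w = "\<lambda>i. x i - z i"
  have xx: "dot n x x = dot n z z"
    using assms by (metis l2norm_square)
  have ww: "dot n ?w ?w = 2 * dot n x ?w"
    using xx by (simp add: dot_diff_left dot_diff_right dot_commute)
  show ?thesis
  proof (cases "dot n ?w ?w = 0")
    case True
    then have "l2norm n ?w = 0" by (simp add: l2norm_dot)
    then have "x i = z i" if "i < n" for i using that unfolding l2norm_eq_0_iff by simp
    then show ?thesis using True by (auto simp: householder_def truncate_def)
  next
    case False
    then have "2 * dot n x ?w / dot n ?w ?w = 1" unfolding ww by simp
    then show ?thesis by (auto simp: householder_def truncate_def fun_eq_iff)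
  qed
qed

text \<open>The direction of $y$ is within distance $r$ of $\xi$. Multiplying by the length of $y$ avoids a division
and makes the relation false for $y = 0$. As it is invariant under simultaneous reflections, it serves as the kernel in
the comparison of two invariant measures.\<close>

definition near :: "nat \<Rightarrow> real \<Rightarrow> (nat \<Rightarrow> real) \<Rightarrow> (nat \<Rightarrow> real) \<Rightarrow> bool" where
  "near n r y \<xi> \<longleftrightarrow> l2norm n (\<lambda>i. y i - l2norm n y * \<xi> i) < r * l2norm n y"

lemma near_householder: "near n r (householder n w y) (householder n w \<xi>) \<longleftrightarrow> near n r y \<xi>"
proof -
  have "(\<lambda>i. householder n w y i - c * householder n w \<xi> i) = householder n w (\<lambda>i. y i - c * \<xi> i)" for c
    using householder_add_cmult[of n w 1 y "- c" \<xi>] by simp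
  then show ?thesis by (simp add: near_def)
qed

lemma l2norm_cmult: "l2norm n (\<lambda>i. c * x i) = \<bar>c\<bar> * l2norm n x"
  using seminorm_Rn.homogeneous[OF seminorm_l2norm] .

lemma l2norm_truncate [simp]: "l2norm n (truncate n x) = l2norm n x"
  using seminorm_Rn.depends[OF seminorm_l2norm] .

lemma near_truncate [simp]:
  "near n r (truncate n y) \<xi> \<longleftrightarrow> near n r y \<xi>" "near n r y (truncate n \<xi>) \<longleftrightarrow> near n r y \<xi>"
proof -
  have "l2norm n (\<lambda>i. truncate n y i - c * \<xi> i) = l2norm n (\<lambda>i. y i - c * \<xi> i)"
    "l2norm n (\<lambda>i. y i - c * truncate n \<xi> i) = l2norm n (\<lambda>i. y i - c * \<xi> i)" for c
    by (auto simp: L2_set_def truncate_def)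
  then show "near n r (truncate n y) \<xi> \<longleftrightarrow> near n r y \<xi>" "near n r y (truncate n \<xi>) \<longleftrightarrow> near n r y \<xi>"
    by (auto simp: near_def)
qed

lemma near_scale: "0 < c \<Longrightarrow> near n r (\<lambda>i. c * y i) \<xi> \<longleftrightarrow> near n r y \<xi>"
proof -
  assume c: "0 < c"
  have "l2norm n (\<lambda>i. c * y i - \<bar>c\<bar> * l2norm n y * \<xi> i) = \<bar>c\<bar> * l2norm n (\<lambda>i. y i - l2norm n y * \<xi> i)"
    using c by (subst l2norm_cmult[symmetric]) (simp add: right_diff_distrib mult.assoc)
  then show ?thesis using c by (simp add: near_def l2norm_cmult mult.left_commute)
qed

lemma near_measurable [measurable]:
  assumes [measurable]: "f \<in> M \<rightarrow>\<^sub>M borel" "g \<in> M \<rightarrow>\<^sub>M borel"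
  shows "Measurable.pred M (\<lambda>p. near n r (f p) (g p))"
  unfolding near_def by measurable

text \<open>Since reflections here include the projection to $R^n$, such a measure is concentrated on $R^n$. Every two points of
the same Euclidean length are exchanged by a reflection, so invariance under reflections
replaces invariance under the whole orthogonal group.\<close>

locale householder_invariant =
  fixes n :: nat and \<nu> :: "(nat \<Rightarrow> real) measure"
  assumes prob: "prob_space \<nu>" and sets_eq [simp, measurable_cong]: "sets \<nu> = sets borel"
    and invariant: "\<And>w. distr \<nu> borel (householder n w) = \<nu>"
begin

lemma nn_integral_householder:
  assumes [measurable]: "f \<in> borel_measurable borel"
  shows "(\<integral>\<^sup>+x. f (householder n w x) \<partial>\<nu>) = (\<integral>\<^sup>+x. f x \<partial>\<nu>)"
  by (subst (2) invariant[of w, symmetric], subst nn_integral_distr) auto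

end

lemma open_near: "open {\<xi>. near n r y \<xi>}"
  unfolding near_def
proof (rule open_Collect_less)
  show "continuous_on UNIV (\<lambda>\<xi>. l2norm n (\<lambda>i. y i - l2norm n y * \<xi> i))"
    unfolding L2_set_def by (intro continuous_intros continuous_on_product_coordinates)
qed simp

lemma (in householder_invariant) emeasure_near_constant:
  assumes "0 < l2norm n y" "l2norm n e = 1"
  shows "emeasure \<nu> {\<xi>. near n r y \<xi>} = emeasure \<nu> {\<xi>. near n r e \<xi>}"
proof -
  let ?z = "\<lambda>i. l2norm n y * e i"
  define w where "w = (\<lambda>i. y i - ?z i)"
  have "l2norm n y = l2norm n ?z" using assms by (simp add: l2norm_cmult)
  then have hy: "householder n w y = truncate n ?z"
    unfolding w_def by (rule householder_swap)
  have m: "{\<xi>. near n r y \<xi>} \<in> sets borel" for y by (rule borel_open[OF open_near])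
  have "emeasure \<nu> {\<xi>. near n r y \<xi>} = (\<integral>\<^sup>+\<xi>. indicator {\<xi>. near n r y \<xi>} \<xi> \<partial>\<nu>)"
    using m by simp
  also have "\<dots> = (\<integral>\<^sup>+\<xi>. indicator {\<xi>. near n r (householder n w y) \<xi>} (householder n w \<xi>) \<partial>\<nu>)"
    by (simp add: near_householder indicator_def)
  also have "\<dots> = (\<integral>\<^sup>+\<xi>. indicator {\<xi>. near n r (householder n w y) \<xi>} \<xi> \<partial>\<nu>)"
    using m by (intro nn_integral_householder) auto
  also have "\<dots> = emeasure \<nu> {\<xi>. near n r (householder n w y) \<xi>}"
    using m by simp
  also have "{\<xi>. near n r (householder n w y) \<xi>} = {\<xi>. near n r e \<xi>}"
    unfolding hy using assms by (simp add: near_scale)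
  finally show ?thesis .
qed

text \<open>All caps of radius $r$ have the same measure, and countably many of them cover the sphere, so this measure is not
zero.\<close>

lemma (in householder_invariant) emeasure_near_pos:
  assumes sphere: "AE \<xi> in \<nu>. l2norm n \<xi> = 1" and e: "l2norm n e = 1" and r: "0 < r"
  shows "emeasure \<nu> {\<xi>. near n r e \<xi>} > 0"
proof (rule ccontr)
  assume "\<not> ?thesis"
  then have zero: "emeasure \<nu> {\<xi>. near n r y \<xi>} = 0" if "l2norm n y = 1" for y
    using emeasure_near_constant[of y e r] that e by (simp add: not_less)
  define F where "F = (\<lambda>y. {\<xi>. near n r y \<xi>}) ` {y. l2norm n y = 1}"
  obtain F' where F': "F' \<subseteq> F" "countable F'" "\<Union>F' = \<Union>F"
  proof (rule Lindelof)
    show "open B" if "B \<in> F" for B using that open_near by (auto simp: F_def)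
  qed
  have "\<Union>F' \<in> null_sets \<nu>"
  proof -
    have "B \<in> null_sets \<nu>" if "B \<in> F'" for B
      using that F'(1) zero open_near by (auto simp: F_def null_sets_def)
    then have "(\<Union>B\<in>F'. B) \<in> null_sets \<nu>" by (intro null_sets_UN' F') auto
    then show ?thesis by simp
  qed
  then have "AE \<xi> in \<nu>. \<xi> \<notin> \<Union>F" unfolding F'(3) by (rule AE_not_in)
  with sphere have "AE \<xi> in \<nu>. False"
  proof eventually_elim
    fix \<xi> assume \<xi>: "l2norm n \<xi> = 1" and "\<xi> \<notin> \<Union>F"
    moreover have "near n r \<xi> \<xi>" using \<xi> r by (simp add: near_def) (simp add: L2_set_def)
    ultimately show False using \<xi> by (auto simp: F_def)
  qed
  then show False using prob prob_space.AE_False by blast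
qed

text \<open>Integrate $|y|\, q(\xi)$ over the pairs $(y, \xi)$ for which $y$ has nearly the direction $\xi$. The inner
integral over $\xi$ is about $q(y)$ times the measure $c$ of a cap, while the inner integral over $y$ is
$q(\xi)$ times a constant $h$; and $h = c \cdot E|y|$ by Fubini's theorem with $q$ replaced by 1. The cap
measure cancels, and the term with $r$ accounts for the variation of $q$ inside a cap.\<close>

lemma (in seminorm_Rn) householder_invariant_nn_integral_le:
  assumes \<nu>: "householder_invariant n \<nu>" and \<tau>: "householder_invariant n \<tau>"
    and sphere: "AE \<xi> in \<tau>. l2norm n \<xi> = 1" and e: "l2norm n e = 1" and r: "0 < r"
  shows "(\<integral>\<^sup>+y. ennreal (q y) \<partial>\<nu>) \<le>
    (\<integral>\<^sup>+y. ennreal (l2norm n y) \<partial>\<nu>) * ((\<integral>\<^sup>+\<xi>. ennreal (q \<xi>) \<partial>\<tau>) + ennreal (bound * r))"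
proof -
  interpret \<nu>: householder_invariant n \<nu> by fact
  interpret \<tau>: householder_invariant n \<tau> by fact
  interpret N: prob_space \<nu> by (rule \<nu>.prob)
  interpret T: prob_space \<tau> by (rule \<tau>.prob)
  interpret NT: pair_sigma_finite \<nu> \<tau> ..
  define k :: "(nat \<Rightarrow> real) \<Rightarrow> (nat \<Rightarrow> real) \<Rightarrow> ennreal"
    where "k y \<xi> = ennreal (l2norm n y) * indicator {p. near n r y p} \<xi>" for y \<xi>
  define c where "c = emeasure \<tau> {\<xi>. near n r e \<xi>}"
  have near_borel [measurable]: "{\<xi>. near n r y \<xi>} \<in> sets borel" for y
    by (rule borel_open[OF open_near])
  have k_meas [measurable]: "(\<lambda>p. k (f p) (g p)) \<in> borel_measurable M"
    if [measurable]: "f \<in> M \<rightarrow>\<^sub>M borel" "g \<in> M \<rightarrow>\<^sub>M borel" for f g and M :: "'z measure"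
  proof -
    have "(\<lambda>p. k (f p) (g p)) =
        (\<lambda>p. ennreal (l2norm n (f p)) * (if near n r (f p) (g p) then 1 else 0))"
      by (auto simp: k_def)
    then show ?thesis by simp
  qed
  have c_pos: "0 < c"
    unfolding c_def by (rule \<tau>.emeasure_near_pos[OF sphere e r])
  have c_le: "c \<le> 1"
    unfolding c_def by (rule T.measure_le_1) 
  have k_int: "(\<integral>\<^sup>+\<xi>. k y \<xi> \<partial>\<tau>) = ennreal (l2norm n y) * c" for y
  proof (cases "l2norm n y = 0")
    case True
    then show ?thesis by (simp add: k_def)
  next
    case False
    then have pos: "0 < l2norm n y" using l2norm_nonneg[of y n] by linarith
    have "(\<integral>\<^sup>+\<xi>. k y \<xi> \<partial>\<tau>) = ennreal (l2norm n y) * emeasure \<tau> {\<xi>. near n r y \<xi>}"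
      unfolding k_def by (subst nn_integral_cmult) auto
    then show ?thesis using \<tau>.emeasure_near_constant[OF pos e] by (simp add: c_def)
  qed
  define h where "h \<xi> = (\<integral>\<^sup>+y. k y \<xi> \<partial>\<nu>)" for \<xi>
  have h_const: "h \<xi> = h e" if \<xi>: "l2norm n \<xi> = 1" for \<xi>
  proof -
    define w where "w = (\<lambda>i. \<xi> i - e i)"
    have hw: "householder n w \<xi> = truncate n e"
      unfolding w_def by (rule householder_swap) (simp add: \<xi> e)
    have "h \<xi> = (\<integral>\<^sup>+y. k (householder n w y) (householder n w \<xi>) \<partial>\<nu>)"
      unfolding h_def k_def by (simp add: near_householder indicator_def)
    also have "\<dots> = (\<integral>\<^sup>+y. k y (householder n w \<xi>) \<partial>\<nu>)"
      by (rule \<nu>.nn_integral_householder) measurable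
    also have "\<dots> = h e"
      unfolding h_def k_def hw by (simp add: indicator_def)
    finally show ?thesis .
  qed
  have h_meas [measurable]: "h \<in> borel_measurable borel"
    unfolding h_def by measurable
  have "h e = (\<integral>\<^sup>+\<xi>. h \<xi> \<partial>\<tau>)"
  proof -
    have "(\<integral>\<^sup>+\<xi>. h \<xi> \<partial>\<tau>) = (\<integral>\<^sup>+\<xi>. h e \<partial>\<tau>)"
      by (intro nn_integral_cong_AE) (use sphere in eventually_elim, rule h_const)
    then show ?thesis by (simp add: T.emeasure_space_1)
  qed
  also have "\<dots> = (\<integral>\<^sup>+y. (\<integral>\<^sup>+\<xi>. k y \<xi> \<partial>\<tau>) \<partial>\<nu>)"
    unfolding h_def by (rule NT.Fubini') measurable
  also have "\<dots> = (\<integral>\<^sup>+y. ennreal (l2norm n y) \<partial>\<nu>) * c"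
    unfolding k_int by (rule nn_integral_multc) measurable
  finally have he: "h e = (\<integral>\<^sup>+y. ennreal (l2norm n y) \<partial>\<nu>) * c" .
  have "(\<integral>\<^sup>+y. ennreal (q y) \<partial>\<nu>) * c = (\<integral>\<^sup>+y. ennreal (q y) * c \<partial>\<nu>)"
    by (rule nn_integral_multc[symmetric]) measurable
  also have "\<dots> \<le> (\<integral>\<^sup>+y. (\<integral>\<^sup>+\<xi>. k y \<xi> * (ennreal (q \<xi>) + ennreal (bound * r)) \<partial>\<tau>) \<partial>\<nu>)"
  proof (rule nn_integral_mono)
    fix y
    show "ennreal (q y) * c \<le> (\<integral>\<^sup>+\<xi>. k y \<xi> * (ennreal (q \<xi>) + ennreal (bound * r)) \<partial>\<tau>)"
    proof (cases "l2norm n y = 0")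
      case True
      then have "q y = 0" using le_bound_l2norm[of y] nonneg[of y] by simp
      then show ?thesis by simp
    next
      case False
      then have pos: "0 < l2norm n y" using l2norm_nonneg[of y n] by linarith
      have "ennreal (q y) * c = ennreal (q y) * emeasure \<tau> {\<xi>. near n r y \<xi>}"
        unfolding c_def using \<tau>.emeasure_near_constant[OF pos e] by simp
      also have "\<dots> = (\<integral>\<^sup>+\<xi>. ennreal (q y) * indicator {\<xi>. near n r y \<xi>} \<xi> \<partial>\<tau>)"
        by (subst nn_integral_cmult) auto
      also have "\<dots> \<le> (\<integral>\<^sup>+\<xi>. k y \<xi> * (ennreal (q \<xi>) + ennreal (bound * r)) \<partial>\<tau>)"
      proof (rule nn_integral_mono)
        fix \<xi>
        show "ennreal (q y) * indicator {\<xi>. near n r y \<xi>} \<xi> \<le>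
            k y \<xi> * (ennreal (q \<xi>) + ennreal (bound * r))"
        proof (cases "near n r y \<xi>")
          case True
          have "q y \<le> q (\<lambda>i. l2norm n y * \<xi> i) + q (\<lambda>i. y i - l2norm n y * \<xi> i)"
            using triangle[of "\<lambda>i. l2norm n y * \<xi> i" "\<lambda>i. y i - l2norm n y * \<xi> i"] by simp
          also have "\<dots> \<le> l2norm n y * q \<xi> + bound * (r * l2norm n y)"
            using True pos
            using order_trans[OF le_bound_l2norm mult_left_mono[OF _ bound_nonneg],
                of "\<lambda>i. y i - l2norm n y * \<xi> i" "r * l2norm n y"]
            by (simp add: homogeneous near_def)
          also have "\<dots> = l2norm n y * (q \<xi> + bound * r)" by (simp add: algebra_simps)
          finally have "ennreal (q y) \<le> ennreal (l2norm n y * (q \<xi> + bound * r))"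
            by (rule ennreal_leI)
          also have "\<dots> = ennreal (l2norm n y) * (ennreal (q \<xi>) + ennreal (bound * r))"
            using r by (simp add: ennreal_mult ennreal_plus nonneg bound_nonneg)
          finally show ?thesis using True by (simp add: k_def)
        qed (simp add: k_def)
      qed
      finally show ?thesis .
    qed
  qed
  also have "\<dots> = (\<integral>\<^sup>+\<xi>. (\<integral>\<^sup>+y. k y \<xi> * (ennreal (q \<xi>) + ennreal (bound * r)) \<partial>\<nu>) \<partial>\<tau>)"
    by (rule NT.Fubini'[symmetric]) measurable
  also have "\<dots> = (\<integral>\<^sup>+\<xi>. h \<xi> * (ennreal (q \<xi>) + ennreal (bound * r)) \<partial>\<tau>)"
    unfolding h_def by (intro nn_integral_cong nn_integral_multc) measurable
  also have "\<dots> = (\<integral>\<^sup>+\<xi>. h e * (ennreal (q \<xi>) + ennreal (bound * r)) \<partial>\<tau>)"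
    by (intro nn_integral_cong_AE) (use sphere in eventually_elim, simp add: h_const)
  also have "\<dots> = h e * ((\<integral>\<^sup>+\<xi>. ennreal (q \<xi>) \<partial>\<tau>) + ennreal (bound * r))"
    by (simp add: nn_integral_cmult nn_integral_add T.emeasure_space_1)
  finally have "c * (\<integral>\<^sup>+y. ennreal (q y) \<partial>\<nu>) \<le>
      c * ((\<integral>\<^sup>+y. ennreal (l2norm n y) \<partial>\<nu>) * ((\<integral>\<^sup>+\<xi>. ennreal (q \<xi>) \<partial>\<tau>) + ennreal (bound * r)))"
    unfolding he by (simp add: mult_ac)
  then show ?thesis
    using c_pos c_le by (subst (asm) ennreal_mult_le_mult_iff) (auto simp: top_unique)
qed

text \<open>Letting the radius of the caps tend to zero gives polar integration for a seminorm.\<close>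

lemma (in seminorm_Rn) householder_invariant_integral_le:
  assumes \<nu>: "householder_invariant n \<nu>" and \<tau>: "householder_invariant n \<tau>"
    and sphere: "AE \<xi> in \<tau>. l2norm n \<xi> = 1" and n: "0 < n"
    and int: "integrable \<nu> (l2norm n)"
  shows "integrable \<nu> q" "integrable \<tau> q" "(\<integral>y. q y \<partial>\<nu>) \<le> (\<integral>y. l2norm n y \<partial>\<nu>) * (\<integral>\<xi>. q \<xi> \<partial>\<tau>)"
proof -
  interpret \<nu>: householder_invariant n \<nu> by fact
  interpret \<tau>: householder_invariant n \<tau> by fact
  interpret T: prob_space \<tau> by (rule \<tau>.prob)
  define e where "e = basis_vec 0"
  have e: "l2norm n e = 1"
    using n by (simp add: e_def basis_vec_def L2_set_def if_distrib[of "\<lambda>x. x\<^sup>2"] cong: if_cong)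
  show i1: "integrable \<nu> q"
  proof (rule Bochner_Integration.integrable_bound)
    show "integrable \<nu> (\<lambda>y. bound * l2norm n y)" using int by simp
    show "AE y in \<nu>. norm (q y) \<le> norm (bound * l2norm n y)"
      using le_bound_l2norm by (intro AE_I2) (auto simp: nonneg bound_nonneg)
  qed measurable
  show i2: "integrable \<tau> q"
  proof (rule T.integrable_const_bound)
    show "AE \<xi> in \<tau>. norm (q \<xi>) \<le> bound"
      using sphere
    proof eventually_elim
      fix \<xi> assume "l2norm n \<xi> = 1"
      then show "norm (q \<xi>) \<le> bound" using le_bound_l2norm[of \<xi>] by (simp add: nonneg)
    qed
  qed measurable
  let ?L = "\<integral>y. l2norm n y \<partial>\<nu>"
  have L: "0 \<le> ?L" by simp
  have le: "(\<integral>y. q y \<partial>\<nu>) \<le> ?L * ((\<integral>\<xi>. q \<xi> \<partial>\<tau>) + bound * r)" if r: "0 < r" for r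
  proof -
    have "ennreal (\<integral>y. q y \<partial>\<nu>) \<le> ennreal ?L * (ennreal (\<integral>\<xi>. q \<xi> \<partial>\<tau>) + ennreal (bound * r))"
      using householder_invariant_nn_integral_le[OF \<nu> \<tau> sphere e r]
      by (simp add: nn_integral_eq_integral i1 i2 int nonneg)
    also have "\<dots> = ennreal (?L * ((\<integral>\<xi>. q \<xi> \<partial>\<tau>) + bound * r))"
      using r L by (simp add: ennreal_mult ennreal_plus nonneg bound_nonneg)
    finally show ?thesis
      using r by (subst (asm) ennreal_le_iff) (auto intro!: mult_nonneg_nonneg add_nonneg_nonneg simp: nonneg bound_nonneg)
  qed
  have "((\<lambda>r. ?L * ((\<integral>\<xi>. q \<xi> \<partial>\<tau>) + bound * r)) \<longlongrightarrow> ?L * ((\<integral>\<xi>. q \<xi> \<partial>\<tau>) + bound * 0)) (at_right 0)"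
    by (intro tendsto_intros)
  then have "(\<integral>y. q y \<partial>\<nu>) \<le> ?L * ((\<integral>\<xi>. q \<xi> \<partial>\<tau>) + bound * 0)"
  proof (rule tendsto_lowerbound)
    show "\<forall>\<^sub>F r in at_right 0. (\<integral>y. q y \<partial>\<nu>) \<le> ?L * ((\<integral>\<xi>. q \<xi> \<partial>\<tau>) + bound * r)"
      using le by (auto simp: eventually_at_filter)
  qed simp
  then show "(\<integral>y. q y \<partial>\<nu>) \<le> ?L * (\<integral>\<xi>. q \<xi> \<partial>\<tau>)" by simp
qed

text \<open>The given measure lives on the subspace of the sphere; its image on the Borel sets of all sequences is a
reflection-invariant measure to which the comparison applies.\<close>

lemma rotation_invariant_distr:
  assumes \<sigma>: "rotation_invariant_prob n \<sigma>"
  shows "(\<lambda>\<xi>. \<xi>) \<in> \<sigma> \<rightarrow>\<^sub>M borel"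
    "householder_invariant n (distr \<sigma> borel (\<lambda>\<xi>. \<xi>))"
    "AE \<xi> in distr \<sigma> borel (\<lambda>\<xi>. \<xi>). l2norm n \<xi> = 1"
proof -
  have sp: "space \<sigma> = unit_sphere n" and se: "sets \<sigma> = sets (restrict_space borel (unit_sphere n))"
    and P: "prob_space \<sigma>"
    and inv: "\<And>U A. orthogonal_Rn n U \<Longrightarrow> A \<in> sets \<sigma> \<Longrightarrow> emeasure \<sigma> (U ` A) = emeasure \<sigma> A"
    using \<sigma> by (auto simp: rotation_invariant_prob_def)
  interpret prob_space \<sigma> by (rule P)
  show id [measurable]: "(\<lambda>\<xi>. \<xi>) \<in> \<sigma> \<rightarrow>\<^sub>M borel"
    unfolding measurable_cong_sets[OF se refl] by (intro measurable_restrict_space1) simp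
  show "AE \<xi> in distr \<sigma> borel (\<lambda>\<xi>. \<xi>). l2norm n \<xi> = 1"
    by (subst AE_distr_iff) (auto simp: sp unit_sphere_def intro!: AE_I2)
  show "householder_invariant n (distr \<sigma> borel (\<lambda>\<xi>. \<xi>))"
  proof (rule householder_invariant.intro)
    show "prob_space (distr \<sigma> borel (\<lambda>\<xi>. \<xi>))" by (rule prob_space_distr) simp
    fix w
    let ?H = "householder n w"
    have HH: "?H (?H x) = x" if "x \<in> unit_sphere n" for x
      using that by (simp add: householder_involution truncate_eq unit_sphere_def del: topspace_Euclidean_space)
    have Hs: "?H x \<in> unit_sphere n" if "x \<in> unit_sphere n" for x
      using that by (simp add: unit_sphere_def del: topspace_Euclidean_space)
    have orth: "orthogonal_Rn n ?H"
      unfolding orthogonal_Rn_def linear_Rn_def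
      by (auto simp: dot_householder householder_add_cmult simp del: topspace_Euclidean_space)
    show "distr (distr \<sigma> borel (\<lambda>\<xi>. \<xi>)) borel ?H = distr \<sigma> borel (\<lambda>\<xi>. \<xi>)"
    proof (rule measure_eqI)
      fix A assume "A \<in> sets (distr (distr \<sigma> borel (\<lambda>\<xi>. \<xi>)) borel ?H)"
      then have A [measurable]: "A \<in> sets borel" by simp
      have HA [measurable]: "?H -` A \<in> sets borel"
        by (rule measurable_sets_borel[OF measurable_householder A])
      have set: "B \<inter> unit_sphere n \<in> sets \<sigma>" if "B \<in> sets borel" for B
        unfolding se sets_restrict_space using that by (auto simp: Int_commute)
      have "?H ` (?H -` A \<inter> unit_sphere n) = A \<inter> unit_sphere n"
      proof (intro equalityI subsetI)
        fix x assume "x \<in> A \<inter> unit_sphere n"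
        then show "x \<in> ?H ` (?H -` A \<inter> unit_sphere n)"
          using HH Hs by (intro image_eqI[of _ _ "?H x"]) auto
      qed (use Hs in auto)
      then have "emeasure \<sigma> (A \<inter> unit_sphere n) = emeasure \<sigma> (?H -` A \<inter> unit_sphere n)"
        using inv[OF orth set[OF HA]] by simp
      then show "emeasure (distr (distr \<sigma> borel (\<lambda>\<xi>. \<xi>)) borel ?H) A = emeasure (distr \<sigma> borel (\<lambda>\<xi>. \<xi>)) A"
        by (simp add: emeasure_distr sp)
    qed simp
  qed simp
qed


section \<open>Gaussian combinations of isotropic systems of vectors\<close>

lemma integral_sum_gaussian_squares:
  fixes z :: "nat \<Rightarrow> real"
  shows "integrable (gaussian N) (\<lambda>\<eta>. (\<Sum>j<N. \<eta> j * z j)\<^sup>2)"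
    "(\<integral>\<eta>. (\<Sum>j<N. \<eta> j * z j)\<^sup>2 \<partial>gaussian N) = (\<Sum>j<N. (z j)\<^sup>2)"
proof -
  have eq: "(\<Sum>j<N. \<eta> j * z j)\<^sup>2 = (\<Sum>j<N. \<Sum>k<N. (z j * z k) * (\<eta> j * \<eta> k))" for \<eta> :: "nat \<Rightarrow> real"
    by (simp add: power2_eq_square sum_product mult_ac)
  show "integrable (gaussian N) (\<lambda>\<eta>. (\<Sum>j<N. \<eta> j * z j)\<^sup>2)"
    unfolding eq by (intro Bochner_Integration.integrable_sum integrable_mult_right gaussian_orthogonal) auto
  have "(\<integral>\<eta>. (\<Sum>j<N. \<eta> j * z j)\<^sup>2 \<partial>gaussian N) =
      (\<Sum>j<N. \<Sum>k<N. (z j * z k) * (\<integral>\<eta>. \<eta> j * \<eta> k \<partial>gaussian N))"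
    unfolding eq using gaussian_orthogonal(1)
    by (subst Bochner_Integration.integral_sum; (intro sum.cong refl)?)
      (auto intro!: Bochner_Integration.integrable_sum)
  also have "\<dots> = (\<Sum>j<N. \<Sum>k<N. if j = k then (z j)\<^sup>2 else 0)"
    by (intro sum.cong refl) (auto simp: gaussian_orthogonal power2_eq_square)
  finally show "(\<integral>\<eta>. (\<Sum>j<N. \<eta> j * z j)\<^sup>2 \<partial>gaussian N) = (\<Sum>j<N. (z j)\<^sup>2)" by simp
qed

definition gaussian_combination :: "nat \<Rightarrow> nat \<Rightarrow> (nat \<Rightarrow> nat \<Rightarrow> real) \<Rightarrow> (nat \<Rightarrow> real) \<Rightarrow> nat \<Rightarrow> real" where
  "gaussian_combination n N y \<eta> = truncate n (\<lambda>i. \<Sum>j<N. \<eta> j * y j i)"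

lemma measurable_gaussian_combination [measurable]: "gaussian_combination n N y \<in> borel \<rightarrow>\<^sub>M borel"
  unfolding gaussian_combination_def by measurable

text \<open>Let $Y$ be the linear map $\eta \mapsto \sum_j \eta_j y_j$. The hypothesis on the $y_j$ says $Y Y^T = b^2 I$, and
therefore the reflection at $w$ after $Y$ equals $Y$ after the reflection of $R^N$ at $w' = Y^T w$. The latter
preserves the Gaussian measure.\<close>

lemma householder_invariant_gaussian_combination:
  assumes gram: "\<And>k l. k < n \<Longrightarrow> l < n \<Longrightarrow> (\<Sum>j<N. y j k * y j l) = (if k = l then b\<^sup>2 else 0)"
    and b: "0 < b"
  shows "householder_invariant n (distr (gaussian N) borel (gaussian_combination n N y))"
proof (rule householder_invariant.intro)
  let ?Y = "gaussian_combination n N y"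
  interpret prob_space "gaussian N" by (rule prob_space_gaussian)
  show "prob_space (distr (gaussian N) borel ?Y)" by (rule prob_space_distr) simp
  fix w :: "nat \<Rightarrow> real"
  define w' where "w' j = (\<Sum>k<n. w k * y j k)" for j
  have w'y: "(\<Sum>j<N. w' j * y j i) = b\<^sup>2 * w i" if "i < n" for i
  proof -
    have "(\<Sum>j<N. w' j * y j i) = (\<Sum>k<n. w k * (\<Sum>j<N. y j k * y j i))"
      unfolding w'_def sum_distrib_right sum_distrib_left
      by (subst sum.swap) (simp add: mult_ac)
    also have "\<dots> = (\<Sum>k<n. if k = i then b\<^sup>2 * w i else 0)"
      using that by (intro sum.cong refl) (auto simp: gram)
    finally show ?thesis using that by simp
  qed
  have \<eta>w': "dot N \<eta> w' = dot n (?Y \<eta>) w" for \<eta>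
  proof -
    have "dot N \<eta> w' = (\<Sum>k<n. (\<Sum>j<N. \<eta> j * y j k) * w k)"
      unfolding dot_def w'_def sum_distrib_right sum_distrib_left
      by (subst sum.swap) (simp add: mult_ac)
    then show ?thesis by (simp add: dot_def gaussian_combination_def truncate_def)
  qed
  have ww: "dot N w' w' = b\<^sup>2 * dot n w w"
  proof -
    have "dot N w' w' = (\<Sum>k<n. (\<Sum>j<N. w' j * y j k) * w k)"
      unfolding \<eta>w' by (simp add: dot_def gaussian_combination_def truncate_def)
    also have "\<dots> = (\<Sum>k<n. b\<^sup>2 * w k * w k)" by (simp add: w'y)
    finally show ?thesis by (simp add: dot_def sum_distrib_left mult_ac)
  qed
  have comm: "householder n w (?Y \<eta>) = ?Y (householder N w' \<eta>)" for \<eta>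
  proof
    fix i
    show "householder n w (?Y \<eta>) i = ?Y (householder N w' \<eta>) i"
    proof (cases "i < n")
      case True
      let ?c = "2 * dot n (?Y \<eta>) w / (b\<^sup>2 * dot n w w)"
      have "?Y (householder N w' \<eta>) i = (\<Sum>j<N. (\<eta> j - ?c * w' j) * y j i)"
      proof -
        have "householder N w' \<eta> j = \<eta> j - ?c * w' j" if "j < N" for j
          using that by (simp add: householder_def \<eta>w'[of \<eta>] ww)
        then show ?thesis using True by (simp add: gaussian_combination_def truncate_def)
      qed
      also have "\<dots> = (\<Sum>j<N. \<eta> j * y j i) - ?c * (\<Sum>j<N. w' j * y j i)"
        by (simp add: left_diff_distrib sum_subtractf sum_distrib_left mult.assoc)
      also have "\<dots> = ?Y \<eta> i - 2 * dot n (?Y \<eta>) w / dot n w w * w i"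
        using b True by (simp add: w'y) (simp add: gaussian_combination_def truncate_def)
      finally show ?thesis using True by (simp add: householder_def)
    qed (simp add: householder_def gaussian_combination_def truncate_def)
  qed
  have "distr (distr (gaussian N) borel ?Y) borel (householder n w) =
      distr (gaussian N) borel (householder n w \<circ> ?Y)"
    by (rule distr_distr) auto
  also have "householder n w \<circ> ?Y = ?Y \<circ> householder N w'"
    by (auto simp: comm)
  also have "distr (gaussian N) borel \<dots> = distr (distr (gaussian N) borel (householder N w')) borel ?Y"
    by (rule distr_distr[symmetric]) auto
  finally show "distr (distr (gaussian N) borel ?Y) borel (householder n w) = distr (gaussian N) borel ?Y"
    by (simp only: gaussian_householder)
qed simp

text \<open>The mean square length is $n b^2$, and the first moment is at most the root of the second.\<close>

lemma integral_l2norm_gaussian_combination: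
  assumes gram: "\<And>k l. k < n \<Longrightarrow> l < n \<Longrightarrow> (\<Sum>j<N. y j k * y j l) = (if k = l then b\<^sup>2 else 0)"
    and b: "0 < b" and n: "0 < n"
  shows "integrable (gaussian N) (\<lambda>\<eta>. l2norm n (gaussian_combination n N y \<eta>))"
    "(\<integral>\<eta>. l2norm n (gaussian_combination n N y \<eta>) \<partial>gaussian N) \<le> b * sqrt n"
proof -
  let ?l = "\<lambda>\<eta>. l2norm n (gaussian_combination n N y \<eta>)"
  interpret prob_space "gaussian N" by (rule prob_space_gaussian)
  have sq: "(?l \<eta>)\<^sup>2 = (\<Sum>i<n. (\<Sum>j<N. \<eta> j * y j i)\<^sup>2)" for \<eta>
    by (simp add: l2norm_square dot_self gaussian_combination_def truncate_def)
  have int: "integrable (gaussian N) (\<lambda>\<eta>. (?l \<eta>)\<^sup>2)"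
    unfolding sq by (intro Bochner_Integration.integrable_sum integral_sum_gaussian_squares)
  have val: "(\<integral>\<eta>. (?l \<eta>)\<^sup>2 \<partial>gaussian N) = real n * b\<^sup>2"
  proof -
    have "(\<integral>\<eta>. (?l \<eta>)\<^sup>2 \<partial>gaussian N) = (\<Sum>i<n. \<Sum>j<N. (y j i)\<^sup>2)"
      unfolding sq
      by (subst Bochner_Integration.integral_sum) (auto simp: integral_sum_gaussian_squares)
    then show ?thesis using gram by (simp add: power2_eq_square)
  qed
  define s where "s = b * sqrt n"
  have s: "0 < s" using b n by (simp add: s_def)
  \<comment> \<open>The arithmetic-geometric mean inequality, which becomes sharp after integration for this choice of $s$.\<close>
  have le: "?l \<eta> \<le> ((?l \<eta>)\<^sup>2 / s + s) / 2" for \<eta>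
  proof -
    have "2 * ?l \<eta> * s \<le> (?l \<eta>)\<^sup>2 + s\<^sup>2" by (rule sum_squares_bound)
    then show ?thesis using s by (simp add: field_simps power2_eq_square)
  qed
  have int2: "integrable (gaussian N) (\<lambda>\<eta>. ((?l \<eta>)\<^sup>2 / s + s) / 2)" using int by simp
  show i: "integrable (gaussian N) ?l"
    by (rule Bochner_Integration.integrable_bound[OF int2])
      (use le s in \<open>auto intro!: AE_I2 order_trans[OF le abs_ge_self]\<close>)
  have "(\<integral>\<eta>. ?l \<eta> \<partial>gaussian N) \<le> (\<integral>\<eta>. ((?l \<eta>)\<^sup>2 / s + s) / 2 \<partial>gaussian N)"
    by (rule integral_mono[OF i int2 le])
  also have "\<dots> = (real n * b\<^sup>2 / s + s) / 2"
    using int by (simp add: val prob_space[simplified])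
  also have "\<dots> = s"
    using s b n by (simp add: s_def field_simps power2_eq_square)
  finally show "(\<integral>\<eta>. ?l \<eta> \<partial>gaussian N) \<le> b * sqrt n" by (simp add: s_def)
qed

context seminorm_Rn
begin

text \<open>Compare the two estimates of $E\, q(\sum_j \eta_j y_j)$: cotype from below, rotation invariance from
above.\<close>

lemma cotype2_isotropic_system_nat:
  fixes N :: nat
  assumes A: "cotype2_bound q A" "0 < A" and n: "0 < n"
    and \<tau>: "householder_invariant n \<tau>" "AE \<xi> in \<tau>. l2norm n \<xi> = 1"
    and gram: "\<And>k l. k < n \<Longrightarrow> l < n \<Longrightarrow> (\<Sum>j<N. y j k * y j l) = (if k = l then b\<^sup>2 else 0)"
    and b: "0 < b"
  shows "L2_set (\<lambda>j. q (y j)) {..<N} \<le> sqrt pi * A * b * sqrt n * (\<integral>\<xi>. q \<xi> \<partial>\<tau>)"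
proof -
  let ?G = "gaussian N" and ?Y = "gaussian_combination n N y"
  let ?\<nu> = "distr ?G borel ?Y"
  note l2 = integral_l2norm_gaussian_combination[where n = n and N = N and y = y and b = b, OF gram b n]
  have qY: "q (?Y \<eta>) = q (\<lambda>i. \<Sum>j<N. \<eta> j * y j i)" for \<eta>
    by (simp add: gaussian_combination_def depends)
  have int_l2: "integrable ?\<nu> (l2norm n)"
    using l2(1) by (simp add: integrable_distr_eq)
  have nonneg_M: "0 \<le> (\<integral>\<xi>. q \<xi> \<partial>\<tau>)" by (simp add: nonneg)
  have "(\<integral>y. q y \<partial>?\<nu>) \<le> (\<integral>y. l2norm n y \<partial>?\<nu>) * (\<integral>\<xi>. q \<xi> \<partial>\<tau>)"
    by (rule householder_invariant_integral_le(3)[OF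
        householder_invariant_gaussian_combination[where n = n and N = N and y = y and b = b, OF gram b] \<tau> n int_l2])
  also have "\<dots> \<le> b * sqrt n * (\<integral>\<xi>. q \<xi> \<partial>\<tau>)"
    using l2(2) nonneg_M by (intro mult_right_mono) (auto simp: integral_distr)
  finally have upper: "(\<integral>\<eta>. q (\<lambda>i. \<Sum>j<N. \<eta> j * y j i) \<partial>?G) \<le> b * sqrt n * (\<integral>\<xi>. q \<xi> \<partial>\<tau>)"
    by (simp add: integral_distr qY)
  have coord [measurable]: "(\<lambda>\<eta>. \<eta> j) \<in> ?G \<rightarrow>\<^sub>M borel" for j by simp
  have "L2_set (\<lambda>j. \<integral>\<eta>. q (\<lambda>i. \<eta> j * y j i) \<partial>?G) {..<N} \<le>
      sqrt 2 * A * (\<integral>\<eta>. q (\<lambda>i. \<Sum>j<N. \<eta> j * y j i) \<partial>?G)"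
  proof (rule cotype2_expectation[OF A])
    show "(\<lambda>\<eta> i. \<eta> j * y j i) \<in> ?G \<rightarrow>\<^sub>M borel" for j by measurable
    show "integrable ?G (\<lambda>\<eta>. q (\<lambda>i. \<eta> j * y j i))" if "j < N" for j
      using gaussian_abs_moment(1)[OF that] by (simp add: homogeneous)
    fix \<epsilon> :: "nat \<Rightarrow> real" assume \<epsilon>: "\<And>i. \<epsilon> i = 1 \<or> \<epsilon> i = -1"
    let ?s = "\<lambda>x i. if i < N then \<epsilon> i * x i else 0"
    have [measurable]: "?s \<in> (borel :: (nat \<Rightarrow> real) measure) \<rightarrow>\<^sub>M borel"
      by (rule measurable_coordinatewise_then_product) measurable
    have "(\<integral>\<eta>. q (\<lambda>i. \<Sum>j<N. \<eta> j * y j i) \<partial>?G) =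
        (\<integral>\<eta>. q (\<lambda>i. \<Sum>j<N. \<eta> j * y j i) \<partial>distr ?G borel ?s)"
      by (simp only: gaussian_signs[OF \<epsilon>])
    also have "\<dots> = (\<integral>\<eta>. q (\<lambda>i. \<Sum>j<N. ?s \<eta> j * y j i) \<partial>?G)"
      by (rule integral_distr) measurable
    also have "\<dots> = (\<integral>\<eta>. q (\<lambda>i. \<Sum>j<N. \<epsilon> j * (\<eta> j * y j i)) \<partial>?G)"
      by (intro Bochner_Integration.integral_cong refl arg_cong[where f = q] ext sum.cong) auto
    finally show "(\<integral>\<eta>. q (\<lambda>i. \<Sum>j<N. \<epsilon> j * (\<eta> j * y j i)) \<partial>?G) =
        (\<integral>\<eta>. q (\<lambda>i. \<Sum>j<N. \<eta> j * y j i) \<partial>?G)" ..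
  qed
  also have "L2_set (\<lambda>j. \<integral>\<eta>. q (\<lambda>i. \<eta> j * y j i) \<partial>?G) {..<N} =
      L2_set (\<lambda>j. sqrt (2 / pi) * q (y j)) {..<N}"
    by (intro L2_set_cong refl) (simp add: homogeneous gaussian_abs_moment)
  also have "\<dots> = sqrt (2 / pi) * L2_set (\<lambda>j. q (y j)) {..<N}"
    by (rule L2_set_right_distrib[symmetric]) simp
  also have "sqrt 2 * A * (\<integral>\<eta>. q (\<lambda>i. \<Sum>j<N. \<eta> j * y j i) \<partial>?G) \<le>
      sqrt 2 * A * (b * sqrt n * (\<integral>\<xi>. q \<xi> \<partial>\<tau>))"
    using A(2) by (intro mult_left_mono upper) auto
  finally have "sqrt 2 * (L2_set (\<lambda>j. q (y j)) {..<N} / sqrt pi) \<le>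
      sqrt 2 * (A * b * sqrt n * (\<integral>\<xi>. q \<xi> \<partial>\<tau>))"
    by (simp add: real_sqrt_divide mult_ac)
  then have "L2_set (\<lambda>j. q (y j)) {..<N} / sqrt pi \<le> A * b * sqrt n * (\<integral>\<xi>. q \<xi> \<partial>\<tau>)"
    by (rule mult_left_le_imp_le) simp
  then show ?thesis by (simp add: field_simps)
qed

lemma cotype2_isotropic_system:
  assumes A: "cotype2_bound q A" "0 < A" and n: "0 < n"
    and \<tau>: "householder_invariant n \<tau>" "AE \<xi> in \<tau>. l2norm n \<xi> = 1"
    and J: "finite J"
    and gram: "\<And>k l. k < n \<Longrightarrow> l < n \<Longrightarrow> (\<Sum>j\<in>J. y j k * y j l) = (if k = l then b\<^sup>2 else 0)"
    and b: "0 < b"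
  shows "L2_set (\<lambda>j. q (y j)) J \<le> sqrt pi * A * b * sqrt n * (\<integral>\<xi>. q \<xi> \<partial>\<tau>)"
proof -
  obtain h where h: "bij_betw h {..<card J} J"
    using ex_bij_betw_nat_finite[OF J] by (auto simp: atLeast0LessThan)
  have "L2_set (\<lambda>j. q (y (h j))) {..<card J} \<le> sqrt pi * A * b * sqrt n * (\<integral>\<xi>. q \<xi> \<partial>\<tau>)"
  proof (rule cotype2_isotropic_system_nat[OF A n \<tau> _ b])
    fix k l assume "k < n" "l < n"
    then show "(\<Sum>j<card J. y (h j) k * y (h j) l) = (if k = l then b\<^sup>2 else 0)"
      using sum.reindex_bij_betw[OF h, of "\<lambda>j. y j k * y j l"] gram by simp
  qed
  then show ?thesis
    using sum.reindex_bij_betw[OF h, of "\<lambda>j. (q (y j))\<^sup>2"] by (simp add: L2_set_def)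
qed

text \<open>A system whose Gram matrix is close to $a^2 I$ is enlarged to one with Gram matrix exactly
$(a^2 + n d) I$; the left hand side only grows. With $D$ the deviation from $a^2 I$, the vectors
$\sqrt{|D_{kl}|/2}\,(e_k + \mathrm{sgn}(D_{kl})\, e_l)$ over all ordered pairs contribute $D$ and, in addition,
the sums $\sum_l |D_{kl}|$ on the diagonal. These sums are at most $n d$, so multiples of the
basis vectors fill the diagonal up.\<close>

lemma cotype2_almost_isotropic_system:
  fixes y :: "'j \<Rightarrow> nat \<Rightarrow> real"
  assumes A: "cotype2_bound q A" "0 < A" and n: "0 < n"
    and \<tau>: "householder_invariant n \<tau>" "AE \<xi> in \<tau>. l2norm n \<xi> = 1"
    and J: "finite J"
    and gram: "\<And>k l. k < n \<Longrightarrow> l < n \<Longrightarrow> \<bar>(\<Sum>j\<in>J. y j k * y j l) - (if k = l then a\<^sup>2 else 0)\<bar> \<le> d"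
    and a: "0 < a"
  shows "L2_set (\<lambda>j. q (y j)) J \<le> sqrt pi * A * sqrt (a\<^sup>2 + real n * d) * sqrt n * (\<integral>\<xi>. q \<xi> \<partial>\<tau>)"
proof -
  define D where "D k l = (if k = l then a\<^sup>2 else 0) - (\<Sum>j\<in>J. y j k * y j l)" for k l
  have D: "\<bar>D k l\<bar> \<le> d" if "k < n" "l < n" for k l
    using gram[OF that] unfolding D_def by (subst abs_minus_commute)
  have D_sym: "D k l = D l k" for k l by (simp add: D_def mult.commute)
  have d: "0 \<le> d" using D[OF n n] by linarith
  define P where "P = (\<lambda>(k, l) i. sqrt (\<bar>D k l\<bar> / 2) * (basis_vec k i + sgn (D k l) * basis_vec l i))"
  define R where "R = (\<lambda>k i. sqrt (real n * d - (\<Sum>l<n. \<bar>D k l\<bar>)) * basis_vec k i)"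
  define y' where "y' = case_sum y (case_sum P R)"
  define J' where "J' = J <+> (({..<n} \<times> {..<n}) <+> {..<n})"
  have J': "finite J'" using J by (simp add: J'_def)
  have rowsum: "(\<Sum>l<n. \<bar>D k l\<bar>) \<le> real n * d" if "k < n" for k
    using sum_mono[of "{..<n}" "\<lambda>l. \<bar>D k l\<bar>" "\<lambda>_. d"] D[OF that] by simp
  have gramP: "(\<Sum>p\<in>{..<n} \<times> {..<n}. P p k * P p l) = D k l + (if k = l then \<Sum>m<n. \<bar>D k m\<bar> else 0)"
    if kl: "k < n" "l < n" for k l
  proof -
    have PP: "P (u, v) k * P (u, v) l =
        (if u = k then if u = l then \<bar>D u v\<bar> / 2 else 0 else 0) +
        (if u = k then if v = l then D u v / 2 else 0 else 0) +
        (if v = k then if u = l then D u v / 2 else 0 else 0) +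
        (if v = k then if v = l then \<bar>D u v\<bar> / 2 else 0 else 0)" for u v
    proof -
      have s1: "sqrt (\<bar>D u v\<bar> / 2) * sqrt (\<bar>D u v\<bar> / 2) = \<bar>D u v\<bar> / 2" by simp
      have s2: "\<bar>D u v\<bar> * sgn (D u v) = D u v" by (simp add: sgn_if)
      have s3: "\<bar>D u v\<bar> * (sgn (D u v) * sgn (D u v)) = \<bar>D u v\<bar>" by (simp add: sgn_if)
      have "P (u, v) k * P (u, v) l = (sqrt (\<bar>D u v\<bar> / 2) * sqrt (\<bar>D u v\<bar> / 2)) *
          ((basis_vec u k + sgn (D u v) * basis_vec v k) * (basis_vec u l + sgn (D u v) * basis_vec v l))"
        by (simp only: P_def split_conv) (simp only: mult_ac)
      also have "\<dots> = \<bar>D u v\<bar> / 2 * (basis_vec u k * basis_vec u l) +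
          \<bar>D u v\<bar> * sgn (D u v) / 2 * (basis_vec u k * basis_vec v l) +
          \<bar>D u v\<bar> * sgn (D u v) / 2 * (basis_vec v k * basis_vec u l) +
          \<bar>D u v\<bar> * (sgn (D u v) * sgn (D u v)) / 2 * (basis_vec v k * basis_vec v l)"
        unfolding s1 by (simp add: algebra_simps)
      finally show ?thesis unfolding s2 s3 by (auto simp: basis_vec_def)
    qed
    have "(\<Sum>p\<in>{..<n} \<times> {..<n}. P p k * P p l) = (\<Sum>u<n. \<Sum>v<n. P (u, v) k * P (u, v) l)"
      by (subst sum.cartesian_product) (rule sum.cong, auto)
    also have "\<dots> = (\<Sum>u<n. \<Sum>v<n.
        (if u = k then if u = l then \<bar>D u v\<bar> / 2 else 0 else 0) +
        (if u = k then if v = l then D u v / 2 else 0 else 0) +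
        (if v = k then if u = l then D u v / 2 else 0 else 0) +
        (if v = k then if v = l then \<bar>D u v\<bar> / 2 else 0 else 0))"
      by (simp only: PP)
    also have "\<dots> = (if k = l then \<Sum>v<n. \<bar>D k v\<bar> / 2 else 0) + D k l / 2 + D l k / 2 +
        (if k = l then \<Sum>u<n. \<bar>D u k\<bar> / 2 else 0)"
    proof -
      have t1: "(\<Sum>u<n. \<Sum>v<n. (if u = k then if u = l then \<bar>D u v\<bar> / 2 else 0 else 0)) =
          (if k = l then \<Sum>v<n. \<bar>D k v\<bar> / 2 else 0)"
        by (subst sum.swap) (use kl in \<open>auto simp: sum.delta\<close>)
      have t2: "(\<Sum>u<n. \<Sum>v<n. (if u = k then if v = l then D u v / 2 else 0 else 0)) = D k l / 2"
        by (subst sum.swap) (use kl in \<open>auto simp: sum.delta\<close>)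
      have t3: "(\<Sum>u<n. \<Sum>v<n. (if v = k then if u = l then D u v / 2 else 0 else 0)) = D l k / 2"
        using kl by (auto simp: sum.delta)
      have t4: "(\<Sum>u<n. \<Sum>v<n. (if v = k then if v = l then \<bar>D u v\<bar> / 2 else 0 else 0)) =
          (if k = l then \<Sum>u<n. \<bar>D u k\<bar> / 2 else 0)"
        using kl by (auto simp: sum.delta)
      show ?thesis unfolding sum.distrib t1 t2 t3 t4 ..
    qed
    also have "\<dots> = D k l + (if k = l then \<Sum>m<n. \<bar>D k m\<bar> else 0)"
    proof -
      have "(\<Sum>u<n. \<bar>D u k\<bar>) = (\<Sum>u<n. \<bar>D k u\<bar>)"
        by (intro sum.cong refl arg_cong[where f = abs] D_sym)
      then show ?thesis using D_sym[of l k] by (auto simp: sum_divide_distrib[symmetric])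
    qed
    finally show ?thesis .
  qed
  have gramR: "(\<Sum>m<n. R m k * R m l) = (if k = l then real n * d - (\<Sum>m<n. \<bar>D k m\<bar>) else 0)"
    if kl: "k < n" "l < n" for k l
  proof -
    have "(\<Sum>m<n. R m k * R m l) =
        (\<Sum>m<n. if m = k then if k = l then real n * d - (\<Sum>m<n. \<bar>D k m\<bar>) else 0 else 0)"
      using rowsum kl by (intro sum.cong refl) (auto simp: R_def basis_vec_def)
    then show ?thesis using kl by simp
  qed
  have "L2_set (\<lambda>j. q (y' j)) J' \<le>
      sqrt pi * A * sqrt (a\<^sup>2 + real n * d) * sqrt n * (\<integral>\<xi>. q \<xi> \<partial>\<tau>)"
  proof (rule cotype2_isotropic_system[OF A n \<tau> J'])
    show "0 < sqrt (a\<^sup>2 + real n * d)" using a d by (simp add: add_pos_nonneg)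
    fix k l assume kl: "k < n" "l < n"
    have "(\<Sum>j\<in>J'. y' j k * y' j l) = (\<Sum>j\<in>J. y j k * y j l) +
        ((\<Sum>p\<in>{..<n} \<times> {..<n}. P p k * P p l) + (\<Sum>m<n. R m k * R m l))"
      unfolding J'_def by (simp add: sum.Plus J y'_def)
    then show "(\<Sum>j\<in>J'. y' j k * y' j l) = (if k = l then (sqrt (a\<^sup>2 + real n * d))\<^sup>2 else 0)"
      unfolding gramP[OF kl] gramR[OF kl] using d by (simp add: D_def)
  qed
  moreover have "L2_set (\<lambda>j. q (y j)) J \<le> L2_set (\<lambda>j. q (y' j)) J'"
    unfolding L2_set_def J'_def by (simp add: sum.Plus J y'_def sum_nonneg)
  ultimately show ?thesis by simp
qed

end

section \<open>Isotropic random vectors\<close>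

text \<open>Clamping the coordinates to $[-B, B]$ before rounding makes the range finite.\<close>

definition grid_round :: "nat \<Rightarrow> real \<Rightarrow> nat \<Rightarrow> (nat \<Rightarrow> real) \<Rightarrow> nat \<Rightarrow> real" where
  "grid_round n B m x = (\<lambda>i. if i < n then of_int \<lfloor>real m * max (- B) (min B (x i))\<rfloor> / real m else 0)"

lemma measurable_grid_round [measurable]: "grid_round n B m \<in> borel \<rightarrow>\<^sub>M borel"
  unfolding grid_round_def by (rule measurable_coordinatewise_then_product) measurable

lemma finite_range_grid_round:
  assumes "0 \<le> B"
  shows "finite (range (grid_round n B m))"
proof (rule finite_subset)
  let ?V = "(\<lambda>c. of_int c / real m) ` {\<lfloor>- (real m * B)\<rfloor> .. \<lfloor>real m * B\<rfloor>} :: real set"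
  show "finite {f :: nat \<Rightarrow> real. \<forall>i. (i \<in> {..<n} \<longrightarrow> f i \<in> ?V) \<and> (i \<notin> {..<n} \<longrightarrow> f i = 0)}"
    by (rule finite_set_of_finite_funs) auto
  have "\<lfloor>real m * max (- B) (min B t)\<rfloor> \<in> {\<lfloor>- (real m * B)\<rfloor> .. \<lfloor>real m * B\<rfloor>}" for t
  proof -
    have "real m * (- B) \<le> real m * max (- B) (min B t)" "real m * max (- B) (min B t) \<le> real m * B"
      using assms by (intro mult_left_mono; simp)+
    then show ?thesis by (auto intro!: floor_mono)
  qed
  then show "range (grid_round n B m) \<subseteq>
      {f. \<forall>i. (i \<in> {..<n} \<longrightarrow> f i \<in> ?V) \<and> (i \<notin> {..<n} \<longrightarrow> f i = 0)}"
    by (auto simp: grid_round_def)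
qed

lemma grid_round_near:
  assumes "\<bar>x i\<bar> \<le> B" "i < n" "0 < m"
  shows "\<bar>grid_round n B m x i - x i\<bar> \<le> 1 / real m"
proof -
  have "max (- B) (min B (x i)) = x i" using assms by auto
  then have g: "grid_round n B m x i = of_int \<lfloor>real m * x i\<rfloor> / real m"
    using assms by (simp add: grid_round_def)
  have "\<bar>of_int \<lfloor>real m * x i\<rfloor> - real m * x i\<bar> \<le> 1" by linarith
  then have "\<bar>of_int \<lfloor>real m * x i\<rfloor> - real m * x i\<bar> / real m \<le> 1 / real m"
    by (intro divide_right_mono) auto
  moreover have "grid_round n B m x i - x i = (of_int \<lfloor>real m * x i\<rfloor> - real m * x i) / real m"
    using assms by (simp add: g diff_divide_distrib)
  ultimately show ?thesis using assms by (simp add: abs_divide)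
qed

lemma (in prob_space) expectation_finite_range:
  fixes Z :: "'a \<Rightarrow> 'b" and g :: "'b \<Rightarrow> real"
  assumes F: "finite F" "\<And>\<omega>. \<omega> \<in> space M \<Longrightarrow> Z \<omega> \<in> F"
    and meas: "\<And>z. z \<in> F \<Longrightarrow> {\<omega> \<in> space M. Z \<omega> = z} \<in> sets M"
  shows "integrable M (\<lambda>\<omega>. g (Z \<omega>))"
    "expectation (\<lambda>\<omega>. g (Z \<omega>)) = (\<Sum>z\<in>F. prob {\<omega> \<in> space M. Z \<omega> = z} * g z)"
proof -
  have eq: "g (Z \<omega>) = (\<Sum>z\<in>F. g z * indicator {\<omega> \<in> space M. Z \<omega> = z} \<omega>)" if "\<omega> \<in> space M" for \<omega>
  proof -
    have "(\<Sum>z\<in>F. g z * indicator {\<omega> \<in> space M. Z \<omega> = z} \<omega>) = (\<Sum>z\<in>F. if z = Z \<omega> then g z else 0)"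
      using that by (intro sum.cong refl) auto
    then show ?thesis using F that by simp
  qed
  have i: "integrable M (\<lambda>\<omega>. g z * indicator {\<omega> \<in> space M. Z \<omega> = z} \<omega>)" if "z \<in> F" for z
    using meas[OF that] by (intro integrable_mult_right integrable_real_indicator) (auto simp: emeasure_eq_measure)
  have "integrable M (\<lambda>\<omega>. \<Sum>z\<in>F. g z * indicator {\<omega> \<in> space M. Z \<omega> = z} \<omega>)"
    by (intro Bochner_Integration.integrable_sum i)
  then show "integrable M (\<lambda>\<omega>. g (Z \<omega>))"
    using eq by (subst Bochner_Integration.integrable_cong[OF refl]) auto
  have "expectation (\<lambda>\<omega>. g (Z \<omega>)) = expectation (\<lambda>\<omega>. \<Sum>z\<in>F. g z * indicator {\<omega> \<in> space M. Z \<omega> = z} \<omega>)"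
    using eq by (intro Bochner_Integration.integral_cong) auto
  also have "\<dots> = (\<Sum>z\<in>F. expectation (\<lambda>\<omega>. g z * indicator {\<omega> \<in> space M. Z \<omega> = z} \<omega>))"
    by (rule Bochner_Integration.integral_sum[OF i])
  also have "\<dots> = (\<Sum>z\<in>F. prob {\<omega> \<in> space M. Z \<omega> = z} * g z)"
    using meas by (intro sum.cong refl) (simp add: mult.commute)
  finally show "expectation (\<lambda>\<omega>. g (Z \<omega>)) = (\<Sum>z\<in>F. prob {\<omega> \<in> space M. Z \<omega> = z} * g z)" .
qed

context seminorm_Rn
begin

text \<open>Rounding changes each second moment by at most $(2 B + 1)/m$. The rounded vector has finitely many values
$z$ with probabilities $p_z$, and the almost isotropic system $\sqrt{p_z}\, z$ bounds
$(\sum_z p_z\, q(z)^2)^{1/2}$, which dominates $\sum_z p_z\, q(z)$ by the Cauchy-Schwarz inequality.\<close>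

lemma cotype2_isotropic_vector_approx:
  assumes A: "cotype2_bound q A" "0 < A" and n: "0 < n"
    and \<tau>: "householder_invariant n \<tau>" "AE \<xi> in \<tau>. l2norm n \<xi> = 1"
    and P: "prob_space P" and X [measurable]: "X \<in> P \<rightarrow>\<^sub>M borel"
    and bounded: "AE \<omega> in P. \<forall>i<n. \<bar>X \<omega> i\<bar> \<le> B" and B: "0 \<le> B"
    and cov: "\<And>k l. k < n \<Longrightarrow> l < n \<Longrightarrow> (\<integral>\<omega>. X \<omega> k * X \<omega> l \<partial>P) = (if k = l then a\<^sup>2 else 0)"
    and a: "0 < a" and m: "0 < m"
  shows "(\<integral>\<omega>. q (X \<omega>) \<partial>P) \<le>
    sqrt pi * A * sqrt (a\<^sup>2 + real n * ((2 * B + 1) / real m)) * sqrt n * (\<integral>\<xi>. q \<xi> \<partial>\<tau>) + bound / real m"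
proof -
  interpret P: prob_space P by (rule P)
  let ?r = "grid_round n B m"
  define Z where "Z \<omega> = ?r (X \<omega>)" for \<omega>
  define F where "F = range ?r"
  define p where "p z = P.prob {\<omega> \<in> space P. Z \<omega> = z}" for z
  have Z [measurable]: "Z \<in> P \<rightarrow>\<^sub>M borel" unfolding Z_def by measurable
  have F: "finite F" unfolding F_def by (rule finite_range_grid_round[OF B])
  have ZF: "Z \<omega> \<in> F" for \<omega> by (simp add: Z_def F_def)
  have ev: "{\<omega> \<in> space P. Z \<omega> = z} \<in> sets P" for z
  proof -
    have "Z -` {z} \<inter> space P \<in> sets P" by (rule measurable_sets[OF Z]) simp
    then show ?thesis by (simp add: vimage_def Int_def conj_commute)
  qed
  note E = P.expectation_finite_range[OF F ZF ev, folded p_def]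
  have near: "AE \<omega> in P. \<forall>i<n. \<bar>Z \<omega> i - X \<omega> i\<bar> \<le> 1 / real m"
    using bounded by eventually_elim (auto simp: Z_def intro!: grid_round_near m)
  have m1: "1 / real m \<le> 1" using m by simp
  have intX: "integrable P (\<lambda>\<omega>. X \<omega> k * X \<omega> l)" if "k < n" "l < n" for k l
  proof (rule P.integrable_const_bound[where B = "B * B"])
    show "AE \<omega> in P. norm (X \<omega> k * X \<omega> l) \<le> B * B"
      using bounded by eventually_elim (use that B in \<open>auto simp: abs_mult intro!: mult_mono\<close>)
    show "(\<lambda>\<omega>. X \<omega> k * X \<omega> l) \<in> borel_measurable P"
      using measurable_product_then_coordinatewise[OF X] by measurable
  qed
  have intq: "integrable P (\<lambda>\<omega>. q (X \<omega>))"
  proof (rule P.integrable_const_bound[where B = "B * bound"])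
    show "AE \<omega> in P. norm (q (X \<omega>)) \<le> B * bound"
      using bounded by eventually_elim (auto simp: nonneg intro!: le_bound_coordinates)
  qed measurable
  define y where "y z = (\<lambda>i. sqrt (p z) * z i)" for z :: "nat \<Rightarrow> real"
  have p: "0 \<le> p z" for z by (simp add: p_def)
  have gram: "\<bar>(\<Sum>z\<in>F. y z k * y z l) - (if k = l then a\<^sup>2 else 0)\<bar> \<le> (2 * B + 1) / real m"
    if kl: "k < n" "l < n" for k l
  proof -
    have "(\<Sum>z\<in>F. y z k * y z l) = (\<Sum>z\<in>F. p z * (z k * z l))"
    proof (intro sum.cong refl)
      fix z
      have "y z k * y z l = (sqrt (p z) * sqrt (p z)) * (z k * z l)" by (simp only: y_def mult_ac)
      then show "y z k * y z l = p z * (z k * z l)" using p[of z] by simp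
    qed
    also have "\<dots> = (\<integral>\<omega>. Z \<omega> k * Z \<omega> l \<partial>P)" by (rule E(2)[symmetric])
    finally have "(\<Sum>z\<in>F. y z k * y z l) - (if k = l then a\<^sup>2 else 0) =
        (\<integral>\<omega>. Z \<omega> k * Z \<omega> l - X \<omega> k * X \<omega> l \<partial>P)"
      using E(1)[of "\<lambda>z. z k * z l"] intX[OF kl] cov[OF kl] by simp
    also have "\<bar>\<dots>\<bar> \<le> (\<integral>\<omega>. \<bar>Z \<omega> k * Z \<omega> l - X \<omega> k * X \<omega> l\<bar> \<partial>P)"
      by (rule integral_abs_bound)
    also have "\<dots> \<le> (\<integral>\<omega>. (2 * B + 1) / real m \<partial>P)"
    proof (rule integral_mono_AE)
      show "integrable P (\<lambda>\<omega>. \<bar>Z \<omega> k * Z \<omega> l - X \<omega> k * X \<omega> l\<bar>)"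
        using E(1)[of "\<lambda>z. z k * z l"] intX[OF kl] by auto
      show "AE \<omega> in P. \<bar>Z \<omega> k * Z \<omega> l - X \<omega> k * X \<omega> l\<bar> \<le> (2 * B + 1) / real m"
        using near bounded
      proof eventually_elim
        fix \<omega> assume 1: "\<forall>i<n. \<bar>Z \<omega> i - X \<omega> i\<bar> \<le> 1 / real m" and 2: "\<forall>i<n. \<bar>X \<omega> i\<bar> \<le> B"
        have "\<bar>Z \<omega> k\<bar> \<le> B + 1"
          using 1 2 kl m1 by (smt (verit, best))
        then have "\<bar>Z \<omega> k\<bar> * \<bar>Z \<omega> l - X \<omega> l\<bar> + \<bar>X \<omega> l\<bar> * \<bar>Z \<omega> k - X \<omega> k\<bar> \<le>
            (B + 1) * (1 / real m) + B * (1 / real m)"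
          using 1 2 kl B by (intro add_mono mult_mono) auto
        moreover have "Z \<omega> k * Z \<omega> l - X \<omega> k * X \<omega> l =
            Z \<omega> k * (Z \<omega> l - X \<omega> l) + X \<omega> l * (Z \<omega> k - X \<omega> k)"
          by (simp add: algebra_simps)
        then have "\<bar>Z \<omega> k * Z \<omega> l - X \<omega> k * X \<omega> l\<bar> \<le>
            \<bar>Z \<omega> k\<bar> * \<bar>Z \<omega> l - X \<omega> l\<bar> + \<bar>X \<omega> l\<bar> * \<bar>Z \<omega> k - X \<omega> k\<bar>"
          using abs_triangle_ineq[of "Z \<omega> k * (Z \<omega> l - X \<omega> l)" "X \<omega> l * (Z \<omega> k - X \<omega> k)"]
          by (simp only: abs_mult)
        moreover have "(B + 1) * (1 / real m) + B * (1 / real m) = (2 * B + 1) / real m"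
          by (simp add: add_divide_distrib[symmetric])
        ultimately show "\<bar>Z \<omega> k * Z \<omega> l - X \<omega> k * X \<omega> l\<bar> \<le> (2 * B + 1) / real m" by linarith
      qed
    qed simp
    finally show ?thesis by (simp add: P.prob_space[simplified])
  qed
  have L: "L2_set (\<lambda>z. q (y z)) F \<le> sqrt pi * A * sqrt (a\<^sup>2 + real n * ((2 * B + 1) / real m)) * sqrt n * (\<integral>\<xi>. q \<xi> \<partial>\<tau>)"
    by (rule cotype2_almost_isotropic_system[OF A n \<tau> F gram a])
  have "(\<integral>\<omega>. q (Z \<omega>) \<partial>P) = (\<Sum>z\<in>F. p z * q z)" by (rule E(2))
  also have "\<dots> = (\<Sum>z\<in>F. \<bar>sqrt (p z)\<bar> * \<bar>q (y z)\<bar>)"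
  proof (intro sum.cong refl)
    fix z
    have "sqrt (p z) * (sqrt (p z) * q z) = p z * q z"
      using p[of z] by (simp add: mult.assoc[symmetric])
    then show "p z * q z = \<bar>sqrt (p z)\<bar> * \<bar>q (y z)\<bar>"
      using p[of z] by (simp add: y_def homogeneous nonneg)
  qed
  also have "\<dots> \<le> L2_set (\<lambda>z. sqrt (p z)) F * L2_set (\<lambda>z. q (y z)) F"
    by (rule L2_set_mult_ineq)
  also have "L2_set (\<lambda>z. sqrt (p z)) F = 1"
    using E(2)[of "\<lambda>_. 1"] by (simp add: L2_set_def p P.prob_space[simplified])
  finally have qZ: "(\<integral>\<omega>. q (Z \<omega>) \<partial>P) \<le> L2_set (\<lambda>z. q (y z)) F" by simp
  have "(\<integral>\<omega>. q (X \<omega>) \<partial>P) \<le> (\<integral>\<omega>. q (Z \<omega>) + bound / real m \<partial>P)"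
  proof (rule integral_mono_AE[OF intq])
    show "integrable P (\<lambda>\<omega>. q (Z \<omega>) + bound / real m)" using E(1)[of q] by simp
    show "AE \<omega> in P. q (X \<omega>) \<le> q (Z \<omega>) + bound / real m"
      using near
    proof eventually_elim
      fix \<omega> assume "\<forall>i<n. \<bar>Z \<omega> i - X \<omega> i\<bar> \<le> 1 / real m"
      then have "q (\<lambda>i. Z \<omega> i - X \<omega> i) \<le> 1 / real m * bound"
        by (intro le_bound_coordinates) auto
      then show "q (X \<omega>) \<le> q (Z \<omega>) + bound / real m"
        using diff_le[of "Z \<omega>" "X \<omega>"] by simp
    qed
  qed
  also have "\<dots> = (\<integral>\<omega>. q (Z \<omega>) \<partial>P) + bound / real m"
    using E(1)[of q] by (simp add: P.prob_space[simplified])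
  finally show ?thesis using qZ L by linarith
qed

lemma cotype2_isotropic_vector:
  assumes A: "cotype2_bound q A" "0 < A" and n: "0 < n"
    and \<tau>: "householder_invariant n \<tau>" "AE \<xi> in \<tau>. l2norm n \<xi> = 1"
    and P: "prob_space P" and X: "X \<in> P \<rightarrow>\<^sub>M borel"
    and bounded: "AE \<omega> in P. \<forall>i<n. \<bar>X \<omega> i\<bar> \<le> B" and B: "0 \<le> B"
    and cov: "\<And>k l. k < n \<Longrightarrow> l < n \<Longrightarrow> (\<integral>\<omega>. X \<omega> k * X \<omega> l \<partial>P) = (if k = l then a\<^sup>2 else 0)"
    and a: "0 < a"
  shows "(\<integral>\<omega>. q (X \<omega>) \<partial>P) \<le> sqrt pi * A * a * sqrt n * (\<integral>\<xi>. q \<xi> \<partial>\<tau>)"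
proof -
  let ?f = "\<lambda>t. sqrt pi * A * sqrt (a\<^sup>2 + real n * ((2 * B + 1) * t)) * sqrt n * (\<integral>\<xi>. q \<xi> \<partial>\<tau>) + bound * t"
  have "(\<lambda>m. ?f (inverse (real (Suc m)))) \<longlonglongrightarrow> ?f 0"
    by (intro tendsto_intros LIMSEQ_inverse_real_of_nat)
  moreover have "(\<integral>\<omega>. q (X \<omega>) \<partial>P) \<le> ?f (inverse (real (Suc m)))" for m
    using cotype2_isotropic_vector_approx[OF A n \<tau> P X bounded B cov a, of "Suc m"]
    by (simp add: divide_inverse del: of_nat_Suc)
  ultimately have "(\<integral>\<omega>. q (X \<omega>) \<partial>P) \<le> ?f 0"
    by (intro LIMSEQ_le_const[where a = "\<integral>\<omega>. q (X \<omega>) \<partial>P"]) auto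
  then show ?thesis using a by simp
qed

end

section \<open>The norm of a symmetric convex body and its cotype 2 constant\<close>

locale symmetric_body =
  fixes n :: nat and K :: "(nat \<Rightarrow> real) set"
  assumes n_pos: "0 < n" and body: "convex_body n K" and symmetric: "centrally_symmetric K"

lemma convex_body_subset: "convex_body n K \<Longrightarrow> K \<subseteq> Rn n"
  using compactin_subset_topspace unfolding convex_body_def by blast

lemma convex_body_compact: "convex_body n K \<Longrightarrow> compact K"
proof -
  assume "convex_body n K"
  then have "compactin (product_topology (\<lambda>_. euclideanreal) UNIV) K"
    unfolding convex_body_def Euclidean_space_def by (auto simp: compactin_subtopology)
  then show ?thesis
    by (simp add: euclidean_product_topology)
qed

lemma convex_body_measurable: "convex_body n K \<Longrightarrow> K \<in> sets borel"
  by (rule borel_closed[OF compact_imp_closed[OF convex_body_compact]])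

lemma convex_body_bounded:
  assumes "convex_body n K"
  obtains B where "0 < B" "\<And>x i. x \<in> K \<Longrightarrow> i < n \<Longrightarrow> \<bar>x i\<bar> \<le> B"
proof -
  have "compact ((\<lambda>x. \<Sum>i<n. \<bar>x i\<bar>) ` K)"
    by (intro compact_continuous_image convex_body_compact[OF assms] continuous_intros
        continuous_on_product_then_coordinatewise continuous_on_id)
  then have "bounded ((\<lambda>x. \<Sum>i<n. \<bar>x i\<bar>) ` K)" by (rule compact_imp_bounded)
  then obtain B where B: "0 < B" "\<And>x. x \<in> K \<Longrightarrow> \<bar>\<Sum>i<n. \<bar>x i\<bar>\<bar> \<le> B"
    unfolding bounded_pos by auto
  have "\<bar>x i\<bar> \<le> B" if "x \<in> K" "i < n" for x i
  proof -
    have "\<bar>x i\<bar> \<le> (\<Sum>i<n. \<bar>x i\<bar>)" using that by (intro member_le_sum) auto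
    then show ?thesis using B(2)[OF that(1)] by linarith
  qed
  then show ?thesis using that B by blast
qed

text \<open>The topology is that of pointwise convergence; on $R^n$ only $n$ coordinates vary, so basic open sets contain
boxes.\<close>

lemma open_contains_box:
  assumes "openin (Euclidean_space n) U" "x \<in> U"
  obtains d where "0 < d" "\<And>y. y \<in> Rn n \<Longrightarrow> (\<And>i. i < n \<Longrightarrow> \<bar>y i - x i\<bar> \<le> d) \<Longrightarrow> y \<in> U"
proof -
  obtain V where V: "openin (product_topology (\<lambda>_. euclideanreal) UNIV) V"
    and U: "U = V \<inter> {x. \<forall>i\<ge>n. x i = 0}"
    using assms(1) by (auto simp: Euclidean_space_def openin_subtopology)
  obtain X where X: "x \<in> (\<Pi>\<^sub>E i\<in>UNIV. X i)" "\<And>i. open (X i)" "(\<Pi>\<^sub>E i\<in>UNIV. X i) \<subseteq> V"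
    using product_topology_open_contains_basis[OF V, of x] assms(2) U by auto
  have "\<exists>e>0. \<forall>t. \<bar>t - x i\<bar> < e \<longrightarrow> t \<in> X i" for i
    using X(1) X(2)[of i] unfolding open_dist by (auto simp: dist_real_def PiE_iff)
  then obtain e where e: "\<And>i. 0 < e i" "\<And>i t. \<bar>t - x i\<bar> < e i \<Longrightarrow> t \<in> X i"
    by metis
  define d where "d = Min (insert 1 (e ` {..<n})) / 2"
  have pos: "0 < Min (insert 1 (e ` {..<n}))" using e(1) by (subst Min_gr_iff) auto
  have less: "d < e i" if "i < n" for i
  proof -
    have "Min (insert 1 (e ` {..<n})) \<le> e i" using that by (intro Min_le) auto
    then show ?thesis using pos unfolding d_def by linarith
  qed
  show ?thesis
  proof (rule that)
    show "0 < d" using pos by (simp add: d_def)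
    fix y assume y: "y \<in> Rn n" "\<And>i. i < n \<Longrightarrow> \<bar>y i - x i\<bar> \<le> d"
    have "y i \<in> X i" for i
    proof (cases "i < n")
      case True
      then show ?thesis using y(2)[OF True] less[OF True] by (intro e(2)) linarith
    next
      case False
      then have "y i = x i" using y(1) assms(2) U by (auto simp: Rn_eq)
      then show ?thesis using X(1) by (auto simp: PiE_iff)
    qed
    then have "y \<in> V" using X(3) by (auto simp: PiE_iff)
    then show "y \<in> U" using y(1) U by (auto simp: Rn_eq)
  qed
qed

context symmetric_body
begin

lemma convexity: "x \<in> K \<Longrightarrow> y \<in> K \<Longrightarrow> 0 \<le> u \<Longrightarrow> u \<le> 1 \<Longrightarrow> (\<lambda>i. (1 - u) * x i + u * y i) \<in> K"
  using body unfolding convex_body_def by auto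

lemma uminus: "x \<in> K \<Longrightarrow> (\<lambda>i. - x i) \<in> K"
  using symmetric unfolding centrally_symmetric_def by blast

lemma subset_Rn: "K \<subseteq> Rn n"
  by (rule convex_body_subset[OF body])

text \<open>If the box of radius $d$ around $x_0$ lies in $K$, then by symmetry so does the one around $-x_0$, and the
midpoints of the two fill the box around the origin.\<close>

lemma contains_box: "\<exists>d>0. \<forall>x\<in>Rn n. (\<forall>i<n. \<bar>x i\<bar> \<le> d) \<longrightarrow> x \<in> K"
proof -
  obtain x0 where x0: "x0 \<in> (Euclidean_space n) interior_of K"
    using body unfolding convex_body_def by blast
  obtain d where d: "0 < d" "\<And>y. y \<in> Rn n \<Longrightarrow> (\<And>i. i < n \<Longrightarrow> \<bar>y i - x0 i\<bar> \<le> d) \<Longrightarrow> y \<in> K"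
  proof (rule open_contains_box[OF openin_interior_of x0])
    fix d :: real assume "0 < d" and "\<And>y. y \<in> Rn n \<Longrightarrow> (\<And>i. i < n \<Longrightarrow> \<bar>y i - x0 i\<bar> \<le> d) \<Longrightarrow>
      y \<in> Euclidean_space n interior_of K"
    then show thesis using interior_of_subset[of "Euclidean_space n" K] by (intro that) blast+
  qed
  have x0R: "x0 \<in> Rn n" using x0 interior_of_subset[of "Euclidean_space n" K] subset_Rn by blast
  show ?thesis
  proof (intro exI[of _ d] conjI d(1) ballI impI)
    fix x assume x: "x \<in> Rn n" "\<forall>i<n. \<bar>x i\<bar> \<le> d"
    have "(\<lambda>i. x0 i + x i) \<in> K" using x x0R by (intro d(2)) (auto simp: Rn_eq)
    moreover have "(\<lambda>i. x0 i - x i) \<in> K" using x x0R by (intro d(2)) (auto simp: Rn_eq)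
    then have "(\<lambda>i. - (x0 i - x i)) \<in> K" by (rule uminus)
    ultimately have "(\<lambda>i. (1 - 1/2) * (x0 i + x i) + 1/2 * (- (x0 i - x i))) \<in> K"
      by (rule convexity) auto
    also have "(\<lambda>i. (1 - 1/2) * (x0 i + x i) + 1/2 * (- (x0 i - x i))) = x"
      by (auto simp: field_simps)
    finally show "x \<in> K" .
  qed
qed

lemma zero_in: "(\<lambda>_. 0) \<in> K"
proof -
  obtain d where "0 < d" "\<forall>x\<in>Rn n. (\<forall>i<n. \<bar>x i\<bar> \<le> d) \<longrightarrow> x \<in> K"
    using contains_box by blast
  then show ?thesis by (auto simp: Rn_eq)
qed

definition dilations :: "(nat \<Rightarrow> real) \<Rightarrow> real set" where
  "dilations x = {r. r > 0 \<and> x \<in> (\<lambda>y i. r * y i) ` K}"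

lemma dilations_iff: "r \<in> dilations x \<longleftrightarrow> 0 < r \<and> (\<lambda>i. x i / r) \<in> K"
proof
  assume "r \<in> dilations x"
  then obtain y where r: "0 < r" "y \<in> K" "x = (\<lambda>i. r * y i)" by (auto simp: dilations_def)
  moreover from this have "(\<lambda>i. x i / r) = y" by auto
  ultimately show "0 < r \<and> (\<lambda>i. x i / r) \<in> K" by simp
next
  assume r: "0 < r \<and> (\<lambda>i. x i / r) \<in> K"
  then have "x = (\<lambda>i. r * (x i / r))" by auto
  with r show "r \<in> dilations x"
    unfolding dilations_def by (intro CollectI conjI image_eqI[of _ _ "\<lambda>i. x i / r"]) auto
qed

lemma dilations_nonempty:
  assumes "x \<in> Rn n"
  shows "dilations x \<noteq> {}"
proof -
  obtain d where d: "0 < d" "\<forall>x\<in>Rn n. (\<forall>i<n. \<bar>x i\<bar> \<le> d) \<longrightarrow> x \<in> K"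
    using contains_box by blast
  define r where "r = ((\<Sum>i<n. \<bar>x i\<bar>) + 1) / d"
  have "0 \<le> (\<Sum>i<n. \<bar>x i\<bar>)" by (intro sum_nonneg) auto
  then have s: "0 < (\<Sum>i<n. \<bar>x i\<bar>) + 1" by linarith
  then have r: "0 < r" using d(1) by (simp add: r_def)
  have "(\<lambda>i. x i / r) \<in> K"
  proof (rule d(2)[rule_format])
    show "(\<lambda>i. x i / r) \<in> Rn n" using assms by (auto simp: Rn_eq)
    fix i assume "i < n"
    then have "\<bar>x i\<bar> \<le> (\<Sum>i<n. \<bar>x i\<bar>)" by (intro member_le_sum) auto
    then have "\<bar>x i\<bar> \<le> r * d" using d(1) by (simp add: r_def)
    then show "\<bar>x i / r\<bar> \<le> d" using r by (simp add: abs_divide field_simps)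
  qed
  then show ?thesis using r dilations_iff by blast
qed

lemma dilations_bdd [simp]: "bdd_below (dilations x)"
  by (rule bdd_belowI[of _ 0]) (auto simp: dilations_def)

lemma body_norm_dilations: "body_norm K x = Inf (dilations x)"
  by (simp add: body_norm_def dilations_def)

definition q :: "(nat \<Rightarrow> real) \<Rightarrow> real" where
  "q x = body_norm K (truncate n x)"

lemma q_eq: "x \<in> Rn n \<Longrightarrow> body_norm K x = q x"
  by (simp add: q_def truncate_eq del: topspace_Euclidean_space)

lemma q_le: "r \<in> dilations (truncate n x) \<Longrightarrow> q x \<le> r"
  unfolding q_def body_norm_dilations by (rule cInf_lower) auto

lemma le_q: "(\<And>r. r \<in> dilations (truncate n x) \<Longrightarrow> t \<le> r) \<Longrightarrow> t \<le> q x"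
  unfolding q_def body_norm_dilations by (rule cInf_greatest[OF dilations_nonempty]) auto

lemma dilations_add:
  assumes "r \<in> dilations x" "s \<in> dilations y"
  shows "r + s \<in> dilations (\<lambda>i. x i + y i)"
proof -
  have rs: "0 < r" "0 < s" and K: "(\<lambda>i. x i / r) \<in> K" "(\<lambda>i. y i / s) \<in> K"
    using assms by (auto simp: dilations_iff)
  have "(\<lambda>i. (1 - s / (r + s)) * (x i / r) + s / (r + s) * (y i / s)) \<in> K"
    by (rule convexity[OF K]) (use rs in auto)
  also have "(\<lambda>i. (1 - s / (r + s)) * (x i / r) + s / (r + s) * (y i / s)) = (\<lambda>i. (x i + y i) / (r + s))"
  proof
    fix i
    have "1 - s / (r + s) = r / (r + s)" using rs by (simp add: field_simps)
    then show "(1 - s / (r + s)) * (x i / r) + s / (r + s) * (y i / s) = (x i + y i) / (r + s)"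
      using rs by (simp add: add_divide_distrib)
  qed
  finally show ?thesis using rs by (simp add: dilations_iff)
qed

lemma dilations_cmult:
  assumes "r \<in> dilations x" "c \<noteq> 0"
  shows "\<bar>c\<bar> * r \<in> dilations (\<lambda>i. c * x i)"
proof -
  have r: "0 < r" and K: "(\<lambda>i. x i / r) \<in> K" using assms by (auto simp: dilations_iff)
  have "(\<lambda>i. c * x i / (\<bar>c\<bar> * r)) \<in> K"
  proof (cases "0 < c")
    case True
    then show ?thesis using K by simp
  next
    case False
    then show ?thesis using uminus[OF K] assms(2) by (simp add: abs_of_neg)
  qed
  then show ?thesis using r assms by (simp add: dilations_iff)
qed

lemma truncate_add: "truncate n (\<lambda>i. x i + y i) = (\<lambda>i. truncate n x i + truncate n y i)"
  by (auto simp: truncate_def)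

lemma truncate_cmult: "truncate n (\<lambda>i. c * x i) = (\<lambda>i. c * truncate n x i)"
  by (auto simp: truncate_def)

lemma q_cmult_le: "c \<noteq> 0 \<Longrightarrow> q (\<lambda>i. c * x i) \<le> \<bar>c\<bar> * q x"
proof -
  assume c: "c \<noteq> 0"
  have "q (\<lambda>i. c * x i) / \<bar>c\<bar> \<le> q x"
  proof (rule le_q)
    fix r assume "r \<in> dilations (truncate n x)"
    then have "q (\<lambda>i. c * x i) \<le> \<bar>c\<bar> * r"
      using dilations_cmult[OF _ c] by (intro q_le) (simp add: truncate_cmult)
    then show "q (\<lambda>i. c * x i) / \<bar>c\<bar> \<le> r" using c by (simp add: field_simps)
  qed
  then show ?thesis using c by (simp add: field_simps)
qed

sublocale seminorm_Rn n q
proof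
  show "q (truncate n x) = q x" for x
    unfolding q_def by (simp only: truncate_idem)
  show "q (\<lambda>i. x i + y i) \<le> q x + q y" for x y
  proof -
    have "q (\<lambda>i. x i + y i) - r \<le> q y" if r: "r \<in> dilations (truncate n x)" for r
    proof (rule le_q)
      fix s assume "s \<in> dilations (truncate n y)"
      with r have "q (\<lambda>i. x i + y i) \<le> r + s"
        by (intro q_le) (simp add: truncate_add dilations_add)
      then show "q (\<lambda>i. x i + y i) - r \<le> s" by simp
    qed
    then have "q (\<lambda>i. x i + y i) - q y \<le> r" if "r \<in> dilations (truncate n x)" for r
      using that by (simp add: algebra_simps)
    then have "q (\<lambda>i. x i + y i) - q y \<le> q x" by (rule le_q)
    then show ?thesis by simp
  qed
  show "q (\<lambda>i. c * x i) = \<bar>c\<bar> * q x" for c x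
  proof (cases "c = 0")
    case False
    have "q x \<le> \<bar>1 / c\<bar> * q (\<lambda>i. c * x i)"
      using q_cmult_le[of "1 / c" "\<lambda>i. c * x i"] False by simp
    then have "\<bar>c\<bar> * q x \<le> q (\<lambda>i. c * x i)"
      using False by (simp add: field_simps)
    then show ?thesis using q_cmult_le[OF False, of x] by simp
  next
    case True
    have d: "r \<in> dilations (truncate n (\<lambda>i. 0))" if "0 < r" for r
      using that zero_in by (simp add: dilations_iff truncate_def)
    have "q (\<lambda>i. 0) \<le> 0"
      by (rule field_le_epsilon) (auto intro: q_le d)
    moreover have "0 \<le> q (\<lambda>i. 0)" by (rule le_q) (auto simp: dilations_def)
    ultimately show ?thesis using True by simp
  qed
qed

lemma q_le_1: "x \<in> K \<Longrightarrow> q x \<le> 1"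
  using subset_Rn by (intro q_le) (auto simp: dilations_iff truncate_eq simp del: topspace_Euclidean_space)

lemma q_less_1: "x \<in> Rn n \<Longrightarrow> q x < 1 \<Longrightarrow> x \<in> K"
proof -
  assume x: "x \<in> Rn n" and "q x < 1"
  then obtain r where r: "r \<in> dilations x" "r < 1"
    unfolding q_def body_norm_dilations truncate_eq[OF x]
    using cInf_less_iff[OF dilations_nonempty[OF x], of 1] by auto
  then have "0 < r" "(\<lambda>i. x i / r) \<in> K" by (auto simp: dilations_iff)
  then have "(\<lambda>i. (1 - r) * 0 + r * (x i / r)) \<in> K"
    using r by (intro convexity zero_in) auto
  then show "x \<in> K" using \<open>0 < r\<close> by simp
qed

lemma coordinate_le_q:
  obtains B where "0 < B" "\<And>x i. i < n \<Longrightarrow> \<bar>x i\<bar> \<le> B * q x"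
proof -
  obtain B where B: "0 < B" "\<And>x i. x \<in> K \<Longrightarrow> i < n \<Longrightarrow> \<bar>x i\<bar> \<le> B"
    using convex_body_bounded[OF body] by blast
  have "\<bar>x i\<bar> \<le> B * q x" if i: "i < n" for x i
  proof -
    have "\<bar>x i\<bar> / B \<le> q x"
    proof (rule le_q)
      fix r assume "r \<in> dilations (truncate n x)"
      then have r: "0 < r" "(\<lambda>i. truncate n x i / r) \<in> K" by (auto simp: dilations_iff)
      then have "\<bar>x i / r\<bar> \<le> B" using B(2)[OF r(2) i] i by (simp add: truncate_def)
      then show "\<bar>x i\<bar> / B \<le> r" using B(1) r(1) by (simp add: abs_divide field_simps)
    qed
    then show ?thesis using B(1) by (simp add: field_simps)
  qed
  then show ?thesis using that B by blast
qed

end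

lemma sign_average_square_linear:
  "sign_average k (\<lambda>\<epsilon>. (\<Sum>j<k. \<epsilon> j * a j)\<^sup>2) = (\<Sum>j<k. (a j)\<^sup>2)"
proof (induction k)
  case 0
  show ?case by simp
next
  case (Suc k)
  have "even_part k (\<lambda>\<epsilon>. \<Sum>j<Suc k. \<epsilon> j * a j) = (\<lambda>\<epsilon>. \<Sum>j<k. \<epsilon> j * a j)"
    "odd_part k (\<lambda>\<epsilon>. \<Sum>j<Suc k. \<epsilon> j * a j) = (\<lambda>\<epsilon>. a k)"
    by (auto simp: even_part_def odd_part_def)
  then show ?case
    unfolding sign_average_square_Suc using Suc by (simp add: sign_average_const)
qed

text \<open>The Euclidean norm satisfies the cotype 2 identity with constant 1, so every equivalent norm has finite
cotype constant.\<close>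

lemma (in seminorm_Rn) cotype2_bound_exists:
  assumes C: "\<And>x. l2norm n x \<le> C * q x"
  shows "cotype2_bound q (bound * C)"
  unfolding cotype2_bound_def
proof (intro allI)
  fix k and x :: "nat \<Rightarrow> nat \<Rightarrow> real"
  let ?S = "\<lambda>\<epsilon> i. \<Sum>j<k. \<epsilon> j * x j i"
  have "(\<Sum>j<k. (q (x j))\<^sup>2) \<le> (\<Sum>j<k. (bound * l2norm n (x j))\<^sup>2)"
    by (intro sum_mono power_mono le_bound_l2norm nonneg)
  also have "\<dots> = bound\<^sup>2 * (\<Sum>j<k. \<Sum>i<n. (x j i)\<^sup>2)"
    by (simp add: power_mult_distrib sum_distrib_left l2norm_square dot_self)
  also have "(\<Sum>j<k. \<Sum>i<n. (x j i)\<^sup>2) = sign_average k (\<lambda>\<epsilon>. \<Sum>i<n. (?S \<epsilon> i)\<^sup>2)"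
    by (subst sum.swap) (simp add: sign_average_sum sign_average_square_linear)
  also have "\<dots> \<le> sign_average k (\<lambda>\<epsilon>. C\<^sup>2 * (q (?S \<epsilon>))\<^sup>2)"
  proof (rule sign_average_mono)
    fix \<epsilon>
    have "(\<Sum>i<n. (?S \<epsilon> i)\<^sup>2) = (l2norm n (?S \<epsilon>))\<^sup>2" by (simp add: l2norm_square dot_self)
    also have "\<dots> \<le> (C * q (?S \<epsilon>))\<^sup>2" by (intro power_mono C) simp
    finally show "(\<Sum>i<n. (?S \<epsilon> i)\<^sup>2) \<le> C\<^sup>2 * (q (?S \<epsilon>))\<^sup>2" by (simp add: power_mult_distrib)
  qed
  finally show "(\<Sum>j<k. (q (x j))\<^sup>2) \<le> (bound * C)\<^sup>2 * sign_average k (\<lambda>\<epsilon>. (q (?S \<epsilon>))\<^sup>2)"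
    by (simp add: sign_average_cmult power_mult_distrib mult_left_mono mult.assoc)
qed

context symmetric_body
begin

text \<open>The admissible constants of the definition of the cotype constant for $k$ vectors, with $q$ in place of the
norm, so that the vectors range over all sequences.\<close>

definition cotype2_constants :: "nat \<Rightarrow> real set" where
  "cotype2_constants k = {A. A > 0 \<and> (\<forall>x :: nat \<Rightarrow> nat \<Rightarrow> real.
     sqrt (\<Sum>j<k. (q (x j))\<^sup>2) \<le> A * sqrt (sign_average k (\<lambda>\<epsilon>. (q (\<lambda>i. \<Sum>j<k. \<epsilon> j * x j i))\<^sup>2)))}"

lemma cotype2_const_k_eq: "cotype2_const_k n K k = Inf (cotype2_constants k)"
proof -
  have Rn_sum: "(\<lambda>i. \<Sum>j<k. \<epsilon> j * x j i) \<in> Rn n" if "\<forall>j<k. x j \<in> Rn n" for \<epsilon> and x :: "nat \<Rightarrow> nat \<Rightarrow> real"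
    using that by (auto simp: Rn_eq)
  let ?P = "\<lambda>A x. sqrt (\<Sum>j<k. (q (x j))\<^sup>2) \<le>
      A * sqrt (sign_average k (\<lambda>\<epsilon>. (q (\<lambda>i. \<Sum>j<k. \<epsilon> j * x j i))\<^sup>2))"
  have *: "(sqrt (measure_pmf.expectation (signs k) (\<lambda>\<epsilon>. (body_norm K (\<lambda>i. \<Sum>j<k. \<epsilon> j * x j i))\<^sup>2))
      \<ge> 1 / A * sqrt (\<Sum>j<k. (body_norm K (x j))\<^sup>2)) \<longleftrightarrow> ?P A x"
    if "0 < A" "\<forall>j<k. x j \<in> Rn n" for A and x :: "nat \<Rightarrow> nat \<Rightarrow> real"
  proof -
    have "(\<lambda>\<epsilon>. (body_norm K (\<lambda>i. \<Sum>j<k. \<epsilon> j * x j i))\<^sup>2) = (\<lambda>\<epsilon>. (q (\<lambda>i. \<Sum>j<k. \<epsilon> j * x j i))\<^sup>2)"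
      by (intro ext) (simp only: q_eq[OF Rn_sum[OF that(2)]])
    moreover have "(\<Sum>j<k. (body_norm K (x j))\<^sup>2) = (\<Sum>j<k. (q (x j))\<^sup>2)"
      using that(2) by (intro sum.cong refl) (simp add: q_eq del: topspace_Euclidean_space)
    ultimately show ?thesis
      using that(1) unfolding expectation_signs by (simp add: field_simps)
  qed
  have tr: "?P A (\<lambda>j. truncate n (x j)) \<longleftrightarrow> ?P A x" for A x
  proof -
    have "q (\<lambda>i. \<Sum>j<k. \<epsilon> j * truncate n (x j) i) = q (\<lambda>i. \<Sum>j<k. \<epsilon> j * x j i)" for \<epsilon>
    proof -
      have "truncate n (\<lambda>i. \<Sum>j<k. \<epsilon> j * truncate n (x j) i) = truncate n (\<lambda>i. \<Sum>j<k. \<epsilon> j * x j i)"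
        by (auto simp: truncate_def)
      then show ?thesis by (metis depends)
    qed
    then show ?thesis by (simp only: depends)
  qed
  let ?D = "{A. A > 0 \<and> (\<forall>x :: nat \<Rightarrow> nat \<Rightarrow> real. (\<forall>j<k. x j \<in> Rn n) \<longrightarrow>
      sqrt (measure_pmf.expectation (signs k) (\<lambda>\<epsilon>. (body_norm K (\<lambda>i. \<Sum>j<k. \<epsilon> j * x j i))\<^sup>2))
      \<ge> 1 / A * sqrt (\<Sum>j<k. (body_norm K (x j))\<^sup>2))}"
  have "?D = cotype2_constants k"
  proof (intro equalityI subsetI)
    fix A assume A: "A \<in> cotype2_constants k"
    then show "A \<in> ?D"
      using * unfolding cotype2_constants_def by blast
  next
    fix A assume "A \<in> ?D"
    then have A: "0 < A" and P: "?P A x" if "\<forall>j<k. x j \<in> Rn n" for x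
      using * that by blast+
    have "?P A x" for x
      using P[of "\<lambda>j. truncate n (x j)"] tr truncate_in_Rn by blast
    moreover have "0 < A" using A[of "\<lambda>_. truncate n (\<lambda>_. 0)"] truncate_in_Rn by blast
    ultimately show "A \<in> cotype2_constants k" unfolding cotype2_constants_def by blast
  qed
  then show ?thesis unfolding cotype2_const_k_def by (simp only:)
qed

lemma cotype2_constants_bdd [simp]: "bdd_below (cotype2_constants k)"
  by (rule bdd_belowI[of _ 0]) (auto simp: cotype2_constants_def)

lemma uniform_cotype2_constant: obtains C where "\<And>k. C \<in> cotype2_constants k"
proof -
  obtain B where B: "0 < B" "\<And>x i. i < n \<Longrightarrow> \<bar>x i\<bar> \<le> B * q x"
    by (rule coordinate_le_q) blast
  have "l2norm n x \<le> (real n * B) * q x" for x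
  proof -
    have "l2norm n x \<le> (\<Sum>i<n. \<bar>x i\<bar>)" by (rule L2_set_le_sum_abs)
    also have "\<dots> \<le> (\<Sum>i<n. B * q x)" using B(2) by (intro sum_mono) auto
    finally show ?thesis by (simp add: mult.assoc)
  qed
  then have cb: "cotype2_bound q (bound * (real n * B))" by (rule cotype2_bound_exists)
  define C where "C = bound * (real n * B) + 1"
  have nn: "0 \<le> bound * (real n * B)" using B(1) bound_nonneg by simp
  have "C \<in> cotype2_constants k" for k
    unfolding cotype2_constants_def
  proof (intro CollectI conjI allI)
    show "0 < C" using nn by (simp add: C_def)
    fix x :: "nat \<Rightarrow> nat \<Rightarrow> real"
    let ?E = "sign_average k (\<lambda>\<epsilon>. (q (\<lambda>i. \<Sum>j<k. \<epsilon> j * x j i))\<^sup>2)"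
    have E: "0 \<le> ?E" by (intro sign_average_nonneg) simp
    have "sqrt (\<Sum>j<k. (q (x j))\<^sup>2) \<le> sqrt ((bound * (real n * B))\<^sup>2 * ?E)"
      using cb unfolding cotype2_bound_def by (intro real_sqrt_le_mono) blast
    also have "\<dots> = (bound * (real n * B)) * sqrt ?E"
      using nn by (simp add: real_sqrt_mult)
    also have "\<dots> \<le> C * sqrt ?E" using E by (intro mult_right_mono) (auto simp: C_def)
    finally show "sqrt (\<Sum>j<k. (q (x j))\<^sup>2) \<le> C * sqrt ?E" .
  qed
  then show ?thesis using that by blast
qed

lemma Inf_cotype2_constants_le: "1 \<le> k \<Longrightarrow> Inf (cotype2_constants k) \<le> cotype2_const n K"
  unfolding cotype2_const_def
proof -
  assume k: "1 \<le> k"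
  obtain C where C: "\<And>k. C \<in> cotype2_constants k" by (rule uniform_cotype2_constant) blast
  have "bdd_above (cotype2_const_k n K ` {1..})"
    by (rule bdd_aboveI[of _ C]) (auto simp: cotype2_const_k_eq intro!: cInf_lower C)
  then show "Inf (cotype2_constants k) \<le> (SUP k\<in>{1..}. cotype2_const_k n K k)"
    unfolding cotype2_const_k_eq[symmetric] using k by (intro cSUP_upper) auto
qed

lemma q_basis_pos: "0 < q (basis_vec 0)"
proof -
  obtain B where B: "0 < B" "\<And>x i. i < n \<Longrightarrow> \<bar>x i\<bar> \<le> B * q x"
    by (rule coordinate_le_q) blast
  have "1 \<le> B * q (basis_vec 0)" using B(2)[OF n_pos, of "basis_vec 0"] by (simp add: basis_vec_def)
  then show ?thesis using B(1) nonneg[of "basis_vec 0"] by (cases "q (basis_vec 0) = 0") auto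
qed

text \<open>Test the inequality with a single vector of nonzero norm.\<close>

lemma cotype2_const_ge_1: "1 \<le> cotype2_const n K"
proof -
  obtain C where C: "\<And>k. C \<in> cotype2_constants k" by (rule uniform_cotype2_constant) blast
  have "1 \<le> Inf (cotype2_constants 1)"
  proof (rule cInf_greatest)
    show "cotype2_constants 1 \<noteq> {}" using C by blast
    fix A assume "A \<in> cotype2_constants 1"
    then have "sqrt (\<Sum>j<1::nat. (q (basis_vec 0))\<^sup>2) \<le>
        A * sqrt (sign_average 1 (\<lambda>\<epsilon>. (q (\<lambda>i. \<Sum>j<1::nat. \<epsilon> j * basis_vec 0 i))\<^sup>2))"
      unfolding cotype2_constants_def by (auto dest!: spec[of _ "\<lambda>_. basis_vec 0"])
    then have "q (basis_vec 0) \<le> A * q (basis_vec 0)"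
      by (simp add: homogeneous nonneg)
    then show "1 \<le> A" using q_basis_pos by (simp add: mult_le_cancel_right1)
  qed
  then show ?thesis using Inf_cotype2_constants_le[of 1] by simp
qed

text \<open>The infimum over the admissible constants is itself admissible because the inequality is closed
in the constant, and the supremum over $k$ is bounded by \<open>uniform_cotype2_constant\<close>.\<close>

lemma cotype2_bound_cotype2_const: "cotype2_bound q (cotype2_const n K)"
  unfolding cotype2_bound_def
proof (intro allI)
  fix k and x :: "nat \<Rightarrow> nat \<Rightarrow> real"
  let ?A = "cotype2_const n K"
  let ?E = "sign_average k (\<lambda>\<epsilon>. (q (\<lambda>i. \<Sum>j<k. \<epsilon> j * x j i))\<^sup>2)"
  let ?L = "\<Sum>j<k. (q (x j))\<^sup>2"
  have E: "0 \<le> ?E" by (intro sign_average_nonneg) simp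
  have L: "0 \<le> ?L" by (intro sum_nonneg) simp
  show "?L \<le> ?A\<^sup>2 * ?E"
  proof (cases "k = 0")
    case True
    then show ?thesis by simp
  next
    case False
    obtain C where C: "\<And>k. C \<in> cotype2_constants k" by (rule uniform_cotype2_constant) blast
    have le: "sqrt ?L \<le> A * sqrt ?E" if "A \<in> cotype2_constants k" for A
      using that unfolding cotype2_constants_def by blast
    have "sqrt ?L \<le> ?A * sqrt ?E"
    proof (cases "?E = 0")
      case True
      then show ?thesis using le[OF C] by simp
    next
      case False
      then have Epos: "0 < sqrt ?E" using E by simp
      have "sqrt ?L / sqrt ?E \<le> Inf (cotype2_constants k)"
      proof (rule cInf_greatest)
        show "cotype2_constants k \<noteq> {}" using C by blast
        show "sqrt ?L / sqrt ?E \<le> A" if "A \<in> cotype2_constants k" for A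
          using le[OF that] Epos by (simp add: pos_divide_le_eq)
      qed
      also have "\<dots> \<le> ?A" using \<open>k \<noteq> 0\<close> by (intro Inf_cotype2_constants_le) simp
      finally show ?thesis using Epos by (simp add: pos_divide_le_eq)
    qed
    then have "(sqrt ?L)\<^sup>2 \<le> (?A * sqrt ?E)\<^sup>2" using L by (intro power_mono) auto
    then show ?thesis using E L by (simp add: power_mult_distrib)
  qed
qed

end

section \<open>Uniform samples of a body and the lower bound\<close>

lemma measurable_scale: "(\<lambda>x i. c * x i) \<in> (borel :: (nat \<Rightarrow> real) measure) \<rightarrow>\<^sub>M borel"
  by measurable

context symmetric_body
begin

lemma measurable_body [measurable]: "K \<in> sets borel"
  by (rule convex_body_measurable[OF body])

lemma emeasure_finite: "emeasure (lebesgue_Rn n) K \<noteq> \<infinity>"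
proof -
  obtain B where B: "0 < B" "\<And>x i. x \<in> K \<Longrightarrow> i < n \<Longrightarrow> \<bar>x i\<bar> \<le> B"
    using convex_body_bounded[OF body] by blast
  have "emeasure (lebesgue_Rn n) K \<le> emeasure (lebesgue_Rn n) {x. \<forall>i<n. x i \<in> {- B .. - B + 2 * B}}"
    using B(2) by (intro emeasure_mono) (force simp: abs_le_iff)+
  also have "\<dots> = ennreal ((2 * B) ^ n)"
    by (rule emeasure_lebesgue_Rn_cube) (use B(1) in simp)
  finally show ?thesis by (auto simp: top_unique)
qed

lemma emeasure_pos: "0 < emeasure (lebesgue_Rn n) K"
proof -
  obtain d where d: "0 < d" "\<forall>x\<in>Rn n. (\<forall>i<n. \<bar>x i\<bar> \<le> d) \<longrightarrow> x \<in> K"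
    using contains_box by blast
  have "0 < ennreal ((2 * d) ^ n)" using d(1) by simp
  also have "\<dots> = emeasure (lebesgue_Rn n) {x. \<forall>i<n. x i \<in> {- d .. - d + 2 * d}}"
    by (rule emeasure_lebesgue_Rn_cube[symmetric]) (use d(1) in simp)
  also have "\<dots> \<le> emeasure (lebesgue_Rn n) K"
  proof (rule emeasure_mono_AE)
    show "AE x in lebesgue_Rn n. x \<in> {x. \<forall>i<n. x i \<in> {- d .. - d + 2 * d}} \<longrightarrow> x \<in> K"
      using AE_lebesgue_Rn
    proof eventually_elim
      fix x assume "x \<in> Rn n"
      then show "x \<in> {x. \<forall>i<n. x i \<in> {- d .. - d + 2 * d}} \<longrightarrow> x \<in> K"
        by (intro impI d(2)[rule_format]) (auto simp: abs_le_iff minus_le_iff)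
    qed
  qed simp
  finally show ?thesis .
qed

lemma vol_pos: "0 < vol n K"
  using emeasure_pos emeasure_finite by (simp add: vol_def measure_def enn2real_positive_iff less_top)

lemma emeasure_eq_vol: "emeasure (lebesgue_Rn n) K = ennreal (vol n K)"
  unfolding vol_def using emeasure_finite by (simp add: emeasure_eq_ennreal_measure)

definition unif :: "(nat \<Rightarrow> real) measure" where
  "unif = uniform_measure (lebesgue_Rn n) K"

lemma sets_unif [simp, measurable_cong]: "sets unif = sets borel"
  by (simp add: unif_def)

lemma space_unif [simp]: "space unif = UNIV"
  by (simp add: unif_def)

lemma prob_space_unif: "prob_space unif"
  unfolding unif_def using emeasure_pos emeasure_finite by (intro prob_space_uniform_measure) auto

lemma AE_unif: "AE x in unif. x \<in> K"
  unfolding unif_def by (intro AE_uniform_measureI) auto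

lemma emeasure_unif: "A \<in> sets borel \<Longrightarrow>
    emeasure unif A = emeasure (lebesgue_Rn n) (K \<inter> A) / emeasure (lebesgue_Rn n) K"
  unfolding unif_def by (rule emeasure_uniform_measure) auto

lemma unif_reflect: "distr unif borel (\<lambda>x i. - x i) = unif"
proof (rule measure_eqI)
  fix A assume "A \<in> sets (distr unif borel (\<lambda>x i. - x i))"
  then have A [measurable]: "A \<in> sets borel" by simp
  let ?m = "\<lambda>x :: nat \<Rightarrow> real. \<lambda>i. - x i"
  have m: "?m \<in> borel \<rightarrow>\<^sub>M borel" by measurable
  have mA [measurable]: "?m -` A \<in> sets borel" by (rule measurable_sets_borel[OF m A])
  have "emeasure (lebesgue_Rn n) (K \<inter> ?m -` A) = (\<integral>\<^sup>+x. indicator (K \<inter> A) (\<lambda>i. - x i) \<partial>lebesgue_Rn n)"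
  proof -
    have "indicator (K \<inter> A) (\<lambda>i. - x i) = (indicator (K \<inter> ?m -` A) x :: ennreal)" for x
      using uminus[of x] uminus[of "\<lambda>i. - x i"] by (auto simp: indicator_def)
    then show ?thesis by simp
  qed
  also have "\<dots> = emeasure (lebesgue_Rn n) (K \<inter> A)"
    by (subst nn_integral_reflect) auto
  finally have "emeasure (lebesgue_Rn n) (K \<inter> ?m -` A) = emeasure (lebesgue_Rn n) (K \<inter> A)" .
  then show "emeasure (distr unif borel ?m) A = emeasure unif A"
    using m by (simp add: emeasure_distr emeasure_unif)
qed simp

lemma unif_sign: "\<epsilon> = 1 \<or> \<epsilon> = -1 \<Longrightarrow> distr unif borel (\<lambda>x i. \<epsilon> * x i) = unif"
  using unif_reflect distr_id2[of borel unif] by (auto simp: id_def[symmetric])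

lemma integrable_unif_q: "integrable unif q"
proof -
  interpret prob_space unif by (rule prob_space_unif)
  show ?thesis
  proof (rule integrable_const_bound[where B = 1])
    show "AE x in unif. norm (q x) \<le> 1"
      using AE_unif by eventually_elim (simp add: nonneg q_le_1)
  qed measurable
qed

text \<open>Let $q(u) = 1/2$. The translates by $u$ and $-u$ of $H = \{q < 1/2\}$ lie in $K$ and are disjoint, since a
common point would give $q(2 u) < 1$. Hence $H$ has at most half the volume of $K$, and $q \ge 1/2$ on the
rest.\<close>

lemma integral_unif_q: "1 / 4 \<le> (\<integral>x. q x \<partial>unif)"
proof -
  interpret prob_space unif by (rule prob_space_unif)
  let ?L = "lebesgue_Rn n"
  define H where "H = {x. q x < 1 / 2}"
  have H [measurable]: "H \<in> sets borel" unfolding H_def by measurable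
  define u where "u = truncate n (\<lambda>i. 1 / (2 * q (basis_vec 0)) * basis_vec 0 i)"
  have qu: "q u = 1 / 2"
    using q_basis_pos unfolding u_def depends homogeneous by simp
  have uR: "u \<in> Rn n" unfolding u_def by (rule truncate_in_Rn)
  define v where "v = (\<lambda>i. - u i)"
  have vR: "v \<in> Rn n" using uR by (auto simp: v_def Rn_eq)
  have qv: "q v = 1 / 2" using homogeneous[of "-1" u] qu by (simp add: v_def)
  have shift: "emeasure ?L {x. (\<lambda>i. x i + w i) \<in> H} = emeasure ?L H" if w: "w \<in> Rn n" for w
  proof -
    have "(\<lambda>x. \<lambda>i. x i + w i) -` H \<in> sets borel"
      by (rule measurable_sets_borel[OF _ H]) measurable
    then have "{x. (\<lambda>i. x i + w i) \<in> H} \<in> sets borel" by (simp add: vimage_def)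
    then have "emeasure ?L {x. (\<lambda>i. x i + w i) \<in> H} = (\<integral>\<^sup>+x. indicator {x. (\<lambda>i. x i + w i) \<in> H} x \<partial>?L)"
      by simp
    also have "\<dots> = (\<integral>\<^sup>+x. indicator H (\<lambda>i. x i + w i) \<partial>?L)"
      by (intro nn_integral_cong) (simp add: indicator_def)
    also have "\<dots> = emeasure ?L H" by (subst nn_integral_translate[OF w]) auto
    finally show ?thesis .
  qed
  have meas: "{x. (\<lambda>i. x i + w i) \<in> H} \<in> sets borel" for w
    using measurable_sets_borel[OF _ H, of "\<lambda>x. \<lambda>i. x i + w i"] by (simp add: vimage_def)
  have disj: "{x. (\<lambda>i. x i + u i) \<in> H} \<inter> {x. (\<lambda>i. x i + v i) \<in> H} = {}"
  proof -
    have False if 1: "q (\<lambda>i. x i + u i) < 1 / 2" and 2: "q (\<lambda>i. x i - u i) < 1 / 2" for x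
    proof -
      have "q (\<lambda>i. 2 * u i) \<le> q (\<lambda>i. x i + u i) + q (\<lambda>i. - 1 * (x i - u i))"
        using triangle[of "\<lambda>i. x i + u i" "\<lambda>i. - 1 * (x i - u i)"] by simp
      then show False using 1 2 unfolding homogeneous qu by simp
    qed
    then show ?thesis by (auto simp: H_def v_def)
  qed
  have "emeasure ?L H + emeasure ?L H =
      emeasure ?L ({x. (\<lambda>i. x i + u i) \<in> H} \<union> {x. (\<lambda>i. x i + v i) \<in> H})"
    using plus_emeasure[of "{x. (\<lambda>i. x i + u i) \<in> H}" ?L "{x. (\<lambda>i. x i + v i) \<in> H}"]
      disj meas shift[OF uR] shift[OF vR] by simp
  also have "\<dots> \<le> emeasure ?L K"
  proof (rule emeasure_mono_AE)
    show "AE x in ?L. x \<in> {x. (\<lambda>i. x i + u i) \<in> H} \<union> {x. (\<lambda>i. x i + v i) \<in> H} \<longrightarrow> x \<in> K"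
      using AE_lebesgue_Rn
    proof eventually_elim
      fix x assume x: "x \<in> Rn n"
      have "q x < 1" if "(\<lambda>i. x i + w i) \<in> H" "q w = 1 / 2" for w
      proof -
        have "q (\<lambda>i. - 1 * w i) = 1 / 2" using that(2) unfolding homogeneous by simp
        then show ?thesis
          using triangle[of "\<lambda>i. x i + w i" "\<lambda>i. - 1 * w i"] that(1) by (simp add: H_def)
      qed
      then show "x \<in> {x. (\<lambda>i. x i + u i) \<in> H} \<union> {x. (\<lambda>i. x i + v i) \<in> H} \<longrightarrow> x \<in> K"
        using qu qv q_less_1[OF x] by blast
    qed
  qed simp
  finally have HK: "emeasure ?L H + emeasure ?L H \<le> emeasure ?L K" .
  have "emeasure unif H + emeasure unif H = (emeasure ?L (K \<inter> H) + emeasure ?L (K \<inter> H)) / emeasure ?L K"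
    by (simp add: emeasure_unif divide_ennreal_def distrib_right)
  also have "\<dots> \<le> (emeasure ?L H + emeasure ?L H) / emeasure ?L K"
    by (intro divide_right_mono_ennreal add_mono emeasure_mono) auto
  also have "\<dots> \<le> emeasure ?L K / emeasure ?L K"
    by (intro divide_right_mono_ennreal HK)
  also have "\<dots> = 1" using vol_pos by (simp add: emeasure_eq_vol divide_ennreal)
  finally have "ennreal (prob H + prob H) \<le> ennreal 1"
    by (simp only: emeasure_eq_measure ennreal_plus[OF measure_nonneg measure_nonneg] ennreal_1)
  then have "prob H + prob H \<le> 1" by (simp only: ennreal_le_iff zero_le_one)
  then have pH: "prob H \<le> 1 / 2" by simp
  have "1 / 4 \<le> 1 / 2 * prob (- H)"
    using prob_compl[of H] pH by (simp add: Compl_eq_Diff_UNIV)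
  also have "\<dots> = (\<integral>x. 1 / 2 * indicator (- H) x \<partial>unif)" by simp
  also have "\<dots> \<le> (\<integral>x. q x \<partial>unif)"
  proof (rule integral_mono[OF _ integrable_unif_q])
    show "integrable unif (\<lambda>x. (1 / 2 :: real) * indicator (- H) x)"
      by (intro integrable_mult_right integrable_real_indicator) (auto simp: emeasure_eq_measure)
    show "1 / 2 * indicator (- H) x \<le> q x" for x
      using nonneg[of x] by (auto simp: indicator_def H_def)
  qed
  finally show ?thesis .
qed

definition samples :: "nat \<Rightarrow> (nat \<Rightarrow> nat \<Rightarrow> real) measure" where
  "samples s = (\<Pi>\<^sub>M j\<in>{..<s}. unif)"

lemma prob_space_samples: "prob_space (samples s)"
  unfolding samples_def by (intro prob_space_PiM prob_space_unif)

lemma sample_measurable: "j < s \<Longrightarrow> (\<lambda>x. x j) \<in> samples s \<rightarrow>\<^sub>M borel"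
  unfolding samples_def
  using measurable_component_singleton[of j "{..<s}" "\<lambda>_. unif"]
  by (simp add: measurable_cong_sets[OF refl sets_unif])

lemma distr_sample: "j < s \<Longrightarrow> distr (samples s) unif (\<lambda>x. x j) = unif"
  unfolding samples_def by (rule distr_PiM_component) (auto simp: prob_space_unif)

lemma integral_sample:
  fixes f :: "(nat \<Rightarrow> real) \<Rightarrow> real"
  assumes j: "j < s" and [measurable]: "f \<in> borel_measurable borel"
  shows "(\<integral>x. f (x j) \<partial>samples s) = (\<integral>x. f x \<partial>unif)"
    "integrable (samples s) (\<lambda>x. f (x j)) \<longleftrightarrow> integrable unif f"
proof -
  have m: "(\<lambda>x. x j) \<in> samples s \<rightarrow>\<^sub>M unif"
    using sample_measurable[OF j] by (simp add: measurable_cong_sets[OF refl sets_unif])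
  show "(\<integral>x. f (x j) \<partial>samples s) = (\<integral>x. f x \<partial>unif)"
  proof -
    have "(\<integral>x. f x \<partial>unif) = (\<integral>x. f x \<partial>distr (samples s) unif (\<lambda>x. x j))"
      by (simp only: distr_sample[OF j])
    also have "\<dots> = (\<integral>x. f (x j) \<partial>samples s)" by (rule integral_distr[OF m]) (simp add: measurable_cong_sets[OF sets_unif refl])
    finally show ?thesis ..
  qed
  show "integrable (samples s) (\<lambda>x. f (x j)) \<longleftrightarrow> integrable unif f"
  proof -
    have "integrable unif f \<longleftrightarrow> integrable (distr (samples s) unif (\<lambda>x. x j)) f"
      by (simp only: distr_sample[OF j])
    also have "\<dots> \<longleftrightarrow> integrable (samples s) (\<lambda>x. f (x j))"
      by (rule integrable_distr_eq[OF m]) (simp add: measurable_cong_sets[OF sets_unif refl])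
    finally show ?thesis ..
  qed
qed

lemma AE_samples: "AE x in samples s. \<forall>j<s. x j \<in> K"
proof -
  have "AE x in samples s. x j \<in> K" if j: "j < s" for j
  proof -
    have m: "(\<lambda>x. x j) \<in> samples s \<rightarrow>\<^sub>M unif"
      using sample_measurable[OF j] by (simp add: measurable_cong_sets[OF refl sets_unif])
    have "AE x in distr (samples s) unif (\<lambda>x. x j). x \<in> K"
      using AE_unif by (simp only: distr_sample[OF j])
    then show ?thesis by (subst (asm) AE_distr_iff[OF m]) auto
  qed
  then have "AE x in samples s. \<forall>j\<in>{..<s}. x j \<in> K"
    by (intro AE_finite_allI) auto
  then show ?thesis by (rule AE_mp) auto
qed

lemma samples_sign:
  assumes \<epsilon>: "\<And>j. \<epsilon> j = 1 \<or> \<epsilon> j = -1"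
  shows "(\<lambda>x. \<lambda>j\<in>{..<s}. \<lambda>i. \<epsilon> j * x j i) \<in> samples s \<rightarrow>\<^sub>M samples s"
    "distr (samples s) (samples s) (\<lambda>x. \<lambda>j\<in>{..<s}. \<lambda>i. \<epsilon> j * x j i) = samples s"
proof -
  interpret U: product_sigma_finite "\<lambda>_ :: nat. unif"
    by (intro product_sigma_finite.intro prob_space_imp_sigma_finite prob_space_unif)
  let ?g = "\<lambda>x. \<lambda>j\<in>{..<s}. \<lambda>i. \<epsilon> j * x j i"
  have e: "(\<lambda>x i. c * x i) \<in> unif \<rightarrow>\<^sub>M unif" for c :: real
    by (simp add: measurable_cong_sets[OF sets_unif sets_unif] measurable_scale)
  show g: "?g \<in> samples s \<rightarrow>\<^sub>M samples s"
    unfolding samples_def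
  proof (rule measurable_restrict)
    fix j assume "j \<in> {..<s}"
    then have "(\<lambda>x. x j) \<in> Pi\<^sub>M {..<s} (\<lambda>_. unif) \<rightarrow>\<^sub>M unif"
      by (rule measurable_component_singleton)
    then show "(\<lambda>x i. \<epsilon> j * x j i) \<in> Pi\<^sub>M {..<s} (\<lambda>_. unif) \<rightarrow>\<^sub>M unif"
      by (rule measurable_compose[OF _ e])
  qed
  have sp: "space (samples s) = Pi\<^sub>E {..<s} (\<lambda>_. UNIV)" by (simp add: samples_def space_PiM)
  show "distr (samples s) (samples s) ?g = samples s"
    unfolding samples_def
  proof (rule U.PiM_eqI)
    fix A :: "nat \<Rightarrow> (nat \<Rightarrow> real) set" assume "\<And>i. i \<in> {..<s} \<Longrightarrow> A i \<in> sets unif"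
    then have A: "A j \<in> sets borel" if "j < s" for j using that by auto
    let ?f = "\<lambda>j x. \<lambda>i. \<epsilon> j * x i"
    have fA: "?f j -` A j \<in> sets borel" if "j < s" for j
      by (rule measurable_sets_borel[OF measurable_scale A[OF that]])
    have "emeasure (distr (samples s) (samples s) ?g) (Pi\<^sub>E {..<s} A) =
        emeasure (samples s) (?g -` Pi\<^sub>E {..<s} A \<inter> space (samples s))"
      by (rule emeasure_distr[OF g]) (auto simp: samples_def A intro!: sets_PiM_I_finite)
    also have "?g -` Pi\<^sub>E {..<s} A \<inter> space (samples s) = Pi\<^sub>E {..<s} (\<lambda>j. ?f j -` A j)"
      unfolding sp by (auto simp: PiE_iff)
    also have "emeasure (samples s) \<dots> = (\<Prod>j<s. emeasure unif (?f j -` A j))"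
      unfolding samples_def using fA by (intro U.emeasure_PiM) auto
    also have "\<dots> = (\<Prod>j<s. emeasure (distr unif borel (?f j)) (A j))"
    proof (intro prod.cong refl)
      fix j assume "j \<in> {..<s}"
      then have "emeasure (distr unif borel (?f j)) (A j) = emeasure unif (?f j -` A j \<inter> space unif)"
        by (intro emeasure_distr A) (auto simp: measurable_cong_sets[OF sets_unif refl] measurable_scale)
      then show "emeasure unif (?f j -` A j) = emeasure (distr unif borel (?f j)) (A j)" by simp
    qed
    also have "\<dots> = (\<Prod>j<s. emeasure unif (A j))"
      by (simp only: unif_sign[OF \<epsilon>])
    finally show "emeasure (distr (Pi\<^sub>M {..<s} (\<lambda>_. unif)) (Pi\<^sub>M {..<s} (\<lambda>_. unif)) ?g) (Pi\<^sub>E {..<s} A) =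
        (\<Prod>j<s. emeasure unif (A j))" by (simp only: samples_def)
  qed auto
qed

lemma integral_samples_sign:
  fixes f :: "(nat \<Rightarrow> nat \<Rightarrow> real) \<Rightarrow> real"
  assumes \<epsilon>: "\<And>j. \<epsilon> j = 1 \<or> \<epsilon> j = -1" and [measurable]: "f \<in> borel_measurable (samples s)"
  shows "(\<integral>x. f (\<lambda>j\<in>{..<s}. \<lambda>i. \<epsilon> j * x j i) \<partial>samples s) = (\<integral>x. f x \<partial>samples s)"
proof -
  let ?g = "\<lambda>x. \<lambda>j\<in>{..<s}. \<lambda>i. \<epsilon> j * x j i"
  have "(\<integral>x. f x \<partial>samples s) = (\<integral>x. f x \<partial>distr (samples s) (samples s) ?g)"
    by (simp only: samples_sign(2)[OF \<epsilon>])
  also have "\<dots> = (\<integral>x. f (?g x) \<partial>samples s)"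
    by (rule integral_distr[OF samples_sign(1)[OF \<epsilon>]]) simp
  finally show ?thesis ..
qed

text \<open>This turns the normalized integral over $K^s$ in \<^const>\<open>multi_norm\<close> into an expectation over
independent samples.\<close>

lemma samples_density:
  "samples s = density (\<Pi>\<^sub>M j\<in>{..<s}. lebesgue_Rn n)
     (\<lambda>x. ennreal (indicator ({..<s} \<rightarrow>\<^sub>E K) x / vol n K ^ s))"
proof -
  interpret U: product_sigma_finite "\<lambda>_ :: nat. unif"
    by (intro product_sigma_finite.intro prob_space_imp_sigma_finite prob_space_unif)
  interpret L: product_sigma_finite "\<lambda>_ :: nat. lebesgue_Rn n"
    by (intro product_sigma_finite.intro sigma_finite_lebesgue_Rn)
  let ?P = "\<Pi>\<^sub>M j\<in>{..<s}. lebesgue_Rn n"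
  have box: "Pi\<^sub>E {..<s} A \<in> sets ?P" if "\<And>j. j < s \<Longrightarrow> A j \<in> sets borel" for A
    using that by (intro sets_PiM_I_finite) auto
  have boxK [measurable]: "({..<s} \<rightarrow>\<^sub>E K) \<in> sets ?P"
    by (rule box) simp
  have "density ?P (\<lambda>x. ennreal (indicator ({..<s} \<rightarrow>\<^sub>E K) x / vol n K ^ s)) = Pi\<^sub>M {..<s} (\<lambda>_. unif)"
  proof (rule U.PiM_eqI)
    show "sets (density ?P (\<lambda>x. ennreal (indicator ({..<s} \<rightarrow>\<^sub>E K) x / vol n K ^ s))) =
        sets (Pi\<^sub>M {..<s} (\<lambda>_. unif))"
      by (simp, intro sets_PiM_cong) auto
    fix A :: "nat \<Rightarrow> (nat \<Rightarrow> real) set" assume "\<And>i. i \<in> {..<s} \<Longrightarrow> A i \<in> sets unif"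
    then have A: "A j \<in> sets borel" if "j < s" for j using that by auto
    have "emeasure (density ?P (\<lambda>x. ennreal (indicator ({..<s} \<rightarrow>\<^sub>E K) x / vol n K ^ s))) (Pi\<^sub>E {..<s} A) =
        (\<integral>\<^sup>+x. ennreal (indicator ({..<s} \<rightarrow>\<^sub>E K) x / vol n K ^ s) * indicator (Pi\<^sub>E {..<s} A) x \<partial>?P)"
      using box[OF A] by (intro emeasure_density) auto
    also have "\<dots> = (\<integral>\<^sup>+x. ennreal (1 / vol n K ^ s) * indicator (Pi\<^sub>E {..<s} (\<lambda>j. K \<inter> A j)) x \<partial>?P)"
      by (intro nn_integral_cong) (auto simp: indicator_def PiE_iff)
    also have "\<dots> = ennreal (1 / vol n K ^ s) * emeasure ?P (Pi\<^sub>E {..<s} (\<lambda>j. K \<inter> A j))"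
      using A by (intro nn_integral_cmult_indicator box) auto
    also have "emeasure ?P (Pi\<^sub>E {..<s} (\<lambda>j. K \<inter> A j)) = (\<Prod>j<s. emeasure (lebesgue_Rn n) (K \<inter> A j))"
      using A by (intro L.emeasure_PiM) auto
    also have "ennreal (1 / vol n K ^ s) = (\<Prod>j<s. inverse (ennreal (vol n K)))"
      using vol_pos by (simp add: inverse_ennreal ennreal_power power_one_over inverse_eq_divide)
    also have "(\<Prod>j<s. inverse (ennreal (vol n K))) * (\<Prod>j<s. emeasure (lebesgue_Rn n) (K \<inter> A j)) =
        (\<Prod>j<s. emeasure unif (A j))"
      unfolding prod.distrib[symmetric] using A
      by (intro prod.cong refl) (simp add: emeasure_unif emeasure_eq_vol divide_ennreal_def mult.commute)
    finally show "emeasure (density ?P (\<lambda>x. ennreal (indicator ({..<s} \<rightarrow>\<^sub>E K) x / vol n K ^ s))) (Pi\<^sub>E {..<s} A) =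
        (\<Prod>j<s. emeasure unif (A j))" .
  qed simp
  then show ?thesis by (simp add: samples_def)
qed

lemma combination_measurable [measurable]:
  "(\<lambda>x. q (\<lambda>i. \<Sum>j<s. t j * x j i)) \<in> borel_measurable (samples s)"
  by (intro measurable_compose[OF _ measurable_seminorm] measurable_fun_sum measurable_fun_cmult
      sample_measurable) auto

lemma multi_norm_eq: "multi_norm n s K t = (\<integral>x. q (\<lambda>i. \<Sum>j<s. t j * x j i) \<partial>samples s)"
proof -
  let ?P = "\<Pi>\<^sub>M j\<in>{..<s}. lebesgue_Rn n"
  have boxK [measurable]: "({..<s} \<rightarrow>\<^sub>E K) \<in> sets ?P"
    by (intro sets_PiM_I_finite) auto
  have "sets (samples s) = sets ?P" unfolding samples_density by simp
  then have m: "(\<lambda>x. q (\<lambda>i. \<Sum>j<s. t j * x j i)) \<in> borel_measurable ?P"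
    using combination_measurable measurable_cong_sets by blast
  have "(\<integral>x. q (\<lambda>i. \<Sum>j<s. t j * x j i) \<partial>samples s) =
      (\<integral>x. (indicator ({..<s} \<rightarrow>\<^sub>E K) x / vol n K ^ s) *\<^sub>R q (\<lambda>i. \<Sum>j<s. t j * x j i) \<partial>?P)"
    unfolding samples_density using vol_pos by (intro integral_density m) auto
  also have "\<dots> = (\<integral>x. 1 / vol n K ^ s *
      (indicator ({..<s} \<rightarrow>\<^sub>E K) x *\<^sub>R body_norm K (\<lambda>i. \<Sum>j<s. t j * x j i)) \<partial>?P)"
  proof (intro Bochner_Integration.integral_cong refl)
    fix x
    have "body_norm K (\<lambda>i. \<Sum>j<s. t j * x j i) = q (\<lambda>i. \<Sum>j<s. t j * x j i)" if "x \<in> {..<s} \<rightarrow>\<^sub>E K"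
    proof (rule q_eq)
      have "x j \<in> Rn n" if "j < s" for j using \<open>x \<in> _\<close> that subset_Rn by auto
      then show "(\<lambda>i. \<Sum>j<s. t j * x j i) \<in> Rn n" by (auto simp: Rn_eq)
    qed
    then show "(indicator ({..<s} \<rightarrow>\<^sub>E K) x / vol n K ^ s) *\<^sub>R q (\<lambda>i. \<Sum>j<s. t j * x j i) =
        1 / vol n K ^ s * (indicator ({..<s} \<rightarrow>\<^sub>E K) x *\<^sub>R body_norm K (\<lambda>i. \<Sum>j<s. t j * x j i))"
      by (auto simp: indicator_def)
  qed
  also have "\<dots> = multi_norm n s K t"
    by (simp add: multi_norm_def set_lebesgue_integral_def)
  finally show ?thesis ..
qed

text \<open>The samples may be multiplied by signs because $K$ is symmetric, so \<open>cotype2_expectation\<close>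
applies to the vectors $t_j x_j$.\<close>

lemma multi_norm_lower:
  "1 / (4 * sqrt 2) / cotype2_const n K * l2norm s t \<le> multi_norm n s K t"
proof -
  let ?A = "cotype2_const n K" and ?e = "\<integral>x. q x \<partial>unif"
  have A: "0 < ?A" using cotype2_const_ge_1 by simp
  have "L2_set (\<lambda>j. \<integral>x. q (\<lambda>i. t j * x j i) \<partial>samples s) {..<s} \<le>
      sqrt 2 * ?A * (\<integral>x. q (\<lambda>i. \<Sum>j<s. t j * x j i) \<partial>samples s)"
  proof (rule cotype2_expectation[OF cotype2_bound_cotype2_const A])
    show "(\<lambda>x i. t j * x j i) \<in> samples s \<rightarrow>\<^sub>M borel" if "j < s" for j
      using sample_measurable[OF that] by (intro measurable_fun_cmult) auto
    show "integrable (samples s) (\<lambda>x. q (\<lambda>i. t j * x j i))" if "j < s" for j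
      unfolding homogeneous using integral_sample(2)[OF that measurable_seminorm] integrable_unif_q by simp
    fix \<epsilon> :: "nat \<Rightarrow> real" assume \<epsilon>: "\<And>i. \<epsilon> i = 1 \<or> \<epsilon> i = -1"
    have "(\<integral>x. q (\<lambda>i. \<Sum>j<s. t j * x j i) \<partial>samples s) =
        (\<integral>x. q (\<lambda>i. \<Sum>j<s. t j * (\<lambda>j\<in>{..<s}. \<lambda>i. \<epsilon> j * x j i) j i) \<partial>samples s)"
      by (rule integral_samples_sign[OF \<epsilon> combination_measurable, symmetric])
    also have "\<dots> = (\<integral>x. q (\<lambda>i. \<Sum>j<s. \<epsilon> j * (t j * x j i)) \<partial>samples s)"
      by (intro Bochner_Integration.integral_cong refl arg_cong[where f = q] ext sum.cong) auto
    finally show "(\<integral>x. q (\<lambda>i. \<Sum>j<s. \<epsilon> j * (t j * x j i)) \<partial>samples s) =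
        (\<integral>x. q (\<lambda>i. \<Sum>j<s. t j * x j i) \<partial>samples s)" ..
  qed
  also have "L2_set (\<lambda>j. \<integral>x. q (\<lambda>i. t j * x j i) \<partial>samples s) {..<s} = L2_set (\<lambda>j. ?e * \<bar>t j\<bar>) {..<s}"
    by (intro L2_set_cong refl) (simp add: homogeneous integral_sample(1) mult.commute)
  also have "\<dots> = ?e * l2norm s t"
    by (subst L2_set_right_distrib[symmetric]) (auto simp: nonneg L2_set_def)
  finally have "?e * l2norm s t \<le> sqrt 2 * ?A * multi_norm n s K t"
    by (simp add: multi_norm_eq)
  moreover have "1 / 4 * l2norm s t \<le> ?e * l2norm s t"
    by (intro mult_right_mono integral_unif_q) auto
  ultimately have "1 / 4 * l2norm s t \<le> multi_norm n s K t * (sqrt 2 * ?A)" by (simp add: mult_ac)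
  then have "1 / 4 * l2norm s t / (sqrt 2 * ?A) \<le> multi_norm n s K t"
    using A by (subst pos_divide_le_eq) auto
  then show ?thesis by (simp add: field_simps)
qed

end

section \<open>Isotropic position and the upper bound\<close>

definition matrix_map :: "nat \<Rightarrow> (nat \<Rightarrow> nat \<Rightarrow> real) \<Rightarrow> (nat \<Rightarrow> real) \<Rightarrow> nat \<Rightarrow> real" where
  "matrix_map n a x = (\<lambda>i. \<Sum>j<n. x j * a j i)"

lemma measurable_matrix_map [measurable]: "matrix_map n a \<in> borel \<rightarrow>\<^sub>M borel"
  unfolding matrix_map_def by (rule measurable_coordinatewise_then_product) measurable

lemma matrix_map_linear:
  "matrix_map n a (\<lambda>i. x i + y i) = (\<lambda>i. matrix_map n a x i + matrix_map n a y i)"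
  "matrix_map n a (\<lambda>i. x i - y i) = (\<lambda>i. matrix_map n a x i - matrix_map n a y i)"
  "matrix_map n a (\<lambda>i. c * x i) = (\<lambda>i. c * matrix_map n a x i)"
  by (auto simp: matrix_map_def sum.distrib sum_subtractf sum_distrib_left algebra_simps)

lemma matrix_map_sum:
  "matrix_map n a (\<lambda>i. \<Sum>j\<in>J. c j * x j i) = (\<lambda>i. \<Sum>j\<in>J. c j * matrix_map n a (x j) i)"
proof
  fix i
  have "matrix_map n a (\<lambda>i. \<Sum>j\<in>J. c j * x j i) i = (\<Sum>l<n. \<Sum>j\<in>J. c j * (x j l * a l i))"
    by (simp add: matrix_map_def sum_distrib_right mult.assoc)
  also have "\<dots> = (\<Sum>j\<in>J. \<Sum>l<n. c j * (x j l * a l i))" by (rule sum.swap)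
  finally show "matrix_map n a (\<lambda>i. \<Sum>j\<in>J. c j * x j i) i = (\<Sum>j\<in>J. c j * matrix_map n a (x j) i)"
    by (simp add: matrix_map_def sum_distrib_left)
qed

lemma matrix_map_truncate [simp]: "matrix_map n a (truncate n x) = matrix_map n a x"
  by (simp add: matrix_map_def truncate_def)

lemma matrix_map_in_Rn: "(\<And>j. j < n \<Longrightarrow> a j \<in> Rn n) \<Longrightarrow> matrix_map n a x \<in> Rn n"
  by (auto simp: Rn_eq matrix_map_def)

lemma basis_vec_in_Rn: "j < n \<Longrightarrow> basis_vec j \<in> Rn n"
  by (auto simp: Rn_eq basis_vec_def)

lemma linear_Rn_matrix_map:
  assumes T: "linear_Rn n T" and x: "x \<in> Rn n"
  shows "T x = matrix_map n (\<lambda>j. T (basis_vec j)) x"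
proof -
  have lin: "T (\<lambda>i. a * x i + b * y i) = (\<lambda>i. a * T x i + b * T y i)" if "x \<in> Rn n" "y \<in> Rn n" for a b x y
    using T that unfolding linear_Rn_def by blast
  have "T (\<lambda>i. \<Sum>j<m. x j * basis_vec j i) = (\<lambda>i. \<Sum>j<m. x j * T (basis_vec j) i)" if "m \<le> n" for m
    using that
  proof (induction m)
    case 0
    show ?case using lin[OF x x, of 0 0] by simp
  next
    case (Suc m)
    have "(\<lambda>i. \<Sum>j<m. x j * basis_vec j i) \<in> Rn n"
      using Suc.prems by (auto simp: Rn_eq basis_vec_def)
    moreover have "basis_vec m \<in> Rn n" using Suc.prems by (intro basis_vec_in_Rn) simp
    ultimately have "T (\<lambda>i. 1 * (\<Sum>j<m. x j * basis_vec j i) + x m * basis_vec m i) =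
        (\<lambda>i. 1 * T (\<lambda>i. \<Sum>j<m. x j * basis_vec j i) i + x m * T (basis_vec m) i)"
      by (rule lin)
    then show ?case using Suc by simp
  qed
  from this[of n] have "T (\<lambda>i. \<Sum>j<n. x j * basis_vec j i) = matrix_map n (\<lambda>j. T (basis_vec j)) x"
    by (simp add: matrix_map_def)
  moreover have "(\<lambda>i. \<Sum>j<n. x j * basis_vec j i) = truncate n x"
    by (auto simp: truncate_def basis_vec_def fun_eq_iff if_distrib[of "(*) _"] cong: if_cong)
  ultimately show ?thesis using truncate_eq[OF x] by simp
qed

text \<open>A linear map on the carrier $R^n$ is arbitrary outside it; the matrix maps agree with it and its inverse on
$R^n$ and are linear and measurable everywhere.\<close>

lemma linear_Rn_inverse:
  assumes T: "invertible_linear_Rn n T"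
  shows "\<exists>T' S. (\<forall>x\<in>Rn n. T x = matrix_map n T' x) \<and>
    (\<forall>x. matrix_map n T' x \<in> Rn n) \<and> (\<forall>x. matrix_map n S x \<in> Rn n) \<and>
    (\<forall>x. matrix_map n T' (matrix_map n S x) = truncate n x) \<and>
    (\<forall>x. matrix_map n S (matrix_map n T' x) = truncate n x)"
proof -
  define T' where "T' j = T (basis_vec j)" for j
  have lin: "linear_Rn n T" and bij: "bij_betw T (Rn n) (Rn n)"
    using T by (auto simp: invertible_linear_Rn_def)
  have T: "T x = matrix_map n T' x" if "x \<in> Rn n" for x
    unfolding T'_def by (rule linear_Rn_matrix_map[OF lin that])
  have TR: "matrix_map n T' x \<in> Rn n" for x
  proof (rule matrix_map_in_Rn)
    show "T' j \<in> Rn n" if "j < n" for j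
      using lin basis_vec_in_Rn[OF that] unfolding T'_def linear_Rn_def by blast
  qed
  define S where "S j = inv_into (Rn n) T (basis_vec j)" for j
  have S: "S j \<in> Rn n" "T (S j) = basis_vec j" if "j < n" for j
  proof -
    have "basis_vec j \<in> T ` Rn n" using bij basis_vec_in_Rn[OF that] unfolding bij_betw_def by blast
    then show "S j \<in> Rn n" "T (S j) = basis_vec j" unfolding S_def
      by (rule inv_into_into, rule f_inv_into_f)
  qed
  have SR: "matrix_map n S x \<in> Rn n" for x by (rule matrix_map_in_Rn) (rule S(1))
  have TS: "matrix_map n T' (matrix_map n S x) = truncate n x" for x
  proof -
    have "matrix_map n T' (matrix_map n S x) = (\<lambda>i. \<Sum>j<n. x j * matrix_map n T' (S j) i)"
      unfolding matrix_map_def[of n S] by (rule matrix_map_sum)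
    also have "\<dots> = (\<lambda>i. \<Sum>j<n. x j * basis_vec j i)"
      using S T by (intro ext sum.cong refl) (metis lessThan_iff)
    also have "\<dots> = truncate n x"
      by (auto simp: truncate_def basis_vec_def fun_eq_iff if_distrib[of "(*) _"] cong: if_cong)
    finally show ?thesis .
  qed
  have ST: "matrix_map n S (matrix_map n T' x) = truncate n x" for x
  proof -
    have "T (matrix_map n S (matrix_map n T' x)) = T (truncate n x)"
      using T[OF SR] T[OF truncate_in_Rn] TS truncate_eq[OF TR] by simp
    then show ?thesis
      using bij SR truncate_in_Rn unfolding bij_betw_def by (meson inj_onD)
  qed
  show ?thesis using T TR SR TS ST by blast
qed

text \<open>Test the isotropy condition with the directions $e_k$ and $(e_k + e_l)/\sqrt 2$.\<close>

lemma isotropic_second_moments: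
  assumes sphere: "\<And>\<xi>. \<xi> \<in> unit_sphere n \<Longrightarrow> (\<integral>x. (dot n x \<xi>)\<^sup>2 \<partial>\<mu>) = L\<^sup>2"
    and int: "\<And>k l. k < n \<Longrightarrow> l < n \<Longrightarrow> integrable \<mu> (\<lambda>x. x k * x l)"
    and kl: "k < n" "l < n"
  shows "(\<integral>x. x k * x l \<partial>\<mu>) = (if k = l then L\<^sup>2 else 0)"
proof -
  have diag: "(\<integral>x. x k * x k \<partial>\<mu>) = L\<^sup>2" if k: "k < n" for k
  proof -
    have d: "dot n x (basis_vec k) = x k" for x
      using k by (simp add: dot_def basis_vec_def if_distrib[of "(*) _"] cong: if_cong)
    have "l2norm n (basis_vec k) = 1" by (simp add: l2norm_dot d) (simp add: basis_vec_def)
    then have "basis_vec k \<in> unit_sphere n"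
      using basis_vec_in_Rn[OF k] by (simp add: unit_sphere_def del: topspace_Euclidean_space)
    from sphere[OF this] show ?thesis by (simp add: d power2_eq_square)
  qed
  show ?thesis
  proof (cases "k = l")
    case True
    then show ?thesis using diag kl by simp
  next
    case False
    define \<xi> where "\<xi> = (\<lambda>i. (basis_vec k i + basis_vec l i) / sqrt 2)"
    have d: "dot n x \<xi> = (x k + x l) / sqrt 2" for x
    proof -
      have "dot n x \<xi> = (\<Sum>i<n. (if i = k then x i / sqrt 2 else 0) + (if i = l then x i / sqrt 2 else 0))"
        unfolding dot_def \<xi>_def basis_vec_def by (intro sum.cong refl) (auto simp: field_simps)
      then show ?thesis using kl by (simp add: sum.distrib add_divide_distrib)
    qed
    have "dot n \<xi> \<xi> = 1"
      unfolding d using False by (simp add: \<xi>_def basis_vec_def field_simps)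
    then have "l2norm n \<xi> = 1" by (simp add: l2norm_dot)
    moreover have "\<xi> \<in> Rn n" using kl by (auto simp: \<xi>_def Rn_eq basis_vec_def)
    ultimately have "\<xi> \<in> unit_sphere n" by (simp add: unit_sphere_def del: topspace_Euclidean_space)
    from sphere[OF this] have "L\<^sup>2 = (\<integral>x. (x k * x k + 2 * (x k * x l) + x l * x l) / 2 \<partial>\<mu>)"
      by (simp add: d power_divide power2_sum) (simp add: power2_eq_square algebra_simps)
    also have "\<dots> = (L\<^sup>2 + 2 * (\<integral>x. x k * x l \<partial>\<mu>) + L\<^sup>2) / 2"
      using int kl diag by simp
    finally show ?thesis using False by simp
  qed
qed

lemma seminorm_Rn_compose:
  assumes "seminorm_Rn n q"
  shows "seminorm_Rn n (\<lambda>x. q (matrix_map n a x))"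
proof -
  interpret seminorm_Rn n q by fact
  show ?thesis
    by standard (simp_all add: matrix_map_linear triangle homogeneous)
qed

lemma cotype2_bound_compose:
  assumes "cotype2_bound q A"
  shows "cotype2_bound (\<lambda>x. q (matrix_map n a x)) A"
  unfolding cotype2_bound_def matrix_map_sum
  by (intro allI) (rule assms[unfolded cotype2_bound_def, rule_format])

context symmetric_body
begin

text \<open>The map $T$ takes the uniform measure of $K$ to that of $C$, because Lebesgue measure is only scaled. Thus
$\sum_j t_j\, T x_j$ for samples $x_j$ has covariance $(L_K \|t\|_2)^2 I$; the mixed terms vanish by
symmetry of $K$. The estimate for isotropic vectors applies to it with the norm of $C$.\<close>

lemma multi_norm_upper:
  assumes image: "isotropic_image n K C" and \<sigma>: "rotation_invariant_prob n \<sigma>"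
  shows "multi_norm n s K t \<le>
    (sqrt pi * isotropic_constant n C * cotype2_const n K * sqrt (real n) * mean_norm \<sigma> C) * l2norm s t"
proof -
  obtain T where T: "invertible_linear_Rn n T" and CT: "C = T ` K" and iso: "isotropic n C"
    using image unfolding isotropic_image_def by blast
  obtain T' S where inv: "\<forall>x\<in>Rn n. T x = matrix_map n T' x"
    "\<forall>x. matrix_map n T' x \<in> Rn n" "\<forall>x. matrix_map n S x \<in> Rn n"
    "\<forall>x. matrix_map n T' (matrix_map n S x) = truncate n x"
    "\<forall>x. matrix_map n S (matrix_map n T' x) = truncate n x"
    using linear_Rn_inverse[OF T] by blast
  note T' = inv(1)[rule_format] and TR = inv(2)[rule_format] and SR = inv(3)[rule_format]
    and TS = inv(4)[rule_format] and ST = inv(5)[rule_format]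
  let ?T = "matrix_map n T'" and ?S = "matrix_map n S" and ?L = "lebesgue_Rn n"
  have C: "C = ?T ` K" unfolding CT using T' subset_Rn by (intro image_cong refl) blast
  have bodyC: "convex_body n C" and volC: "vol n C = 1" using iso by (auto simp: isotropic_def)
  have C_meas [measurable]: "C \<in> sets borel" by (rule convex_body_measurable[OF bodyC])
  have mem_iff: "?T x \<in> C \<longleftrightarrow> x \<in> K" if "x \<in> Rn n" for x
  proof
    assume "?T x \<in> C"
    then obtain k where k: "k \<in> K" "?T x = ?T k" unfolding C by blast
    then have "truncate n x = truncate n k" using ST by metis
    then have "x = k" using that k(1) subset_Rn by (metis subsetD truncate_eq)
    then show "x \<in> K" using k(1) by simp
  qed (auto simp: C)
  have emC: "emeasure ?L C = 1"
  proof -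
    have "emeasure ?L C \<noteq> \<infinity>" using volC unfolding vol_def measure_def by auto
    then have "emeasure ?L C = ennreal (vol n C)"
      unfolding vol_def by (simp add: emeasure_eq_ennreal_measure)
    then show ?thesis by (simp add: volC)
  qed
  obtain c where c: "\<And>a. a \<in> borel_measurable borel \<Longrightarrow>
     (\<integral>\<^sup>+x. a (?T x) \<partial>?L) = c * (\<integral>\<^sup>+x. a x \<partial>?L)"
    using nn_integral_linear[OF measurable_matrix_map measurable_matrix_map matrix_map_linear(2) TR SR TS]
    by blast
  have em: "emeasure ?L (K \<inter> ?T -` A) = c * emeasure ?L (C \<inter> A)" if A [measurable]: "A \<in> sets borel" for A
  proof -
    have [measurable]: "?T -` A \<in> sets borel"
      by (rule measurable_sets_borel[OF measurable_matrix_map A])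
    have "emeasure ?L (K \<inter> ?T -` A) = (\<integral>\<^sup>+x. indicator (K \<inter> ?T -` A) x \<partial>?L)" by simp
    also have "\<dots> = (\<integral>\<^sup>+x. indicator (C \<inter> A) (?T x) \<partial>?L)"
      by (rule nn_integral_cong_AE, rule AE_mp[OF AE_lebesgue_Rn], intro AE_I2 impI)
        (auto simp: mem_iff indicator_def simp del: topspace_Euclidean_space)
    also have "\<dots> = c * emeasure ?L (C \<inter> A)" by (subst c) auto
    finally show ?thesis .
  qed
  have cK: "c = emeasure ?L K" using em[of UNIV] emC by simp
  define \<mu> where "\<mu> = density ?L (indicator C)"
  have sets_\<mu> [simp, measurable_cong]: "sets \<mu> = sets borel" by (simp add: \<mu>_def)
  have push: "distr unif borel ?T = \<mu>"
  proof (rule measure_eqI)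
    fix A assume "A \<in> sets (distr unif borel ?T)"
    then have A [measurable]: "A \<in> sets borel" by simp
    have TA: "?T -` A \<in> sets borel"
      by (rule measurable_sets_borel[OF measurable_matrix_map A])
    have "emeasure (distr unif borel ?T) A = emeasure unif (?T -` A)"
      by (subst emeasure_distr) (auto simp: measurable_cong_sets[OF sets_unif refl])
    also have "\<dots> = c * emeasure ?L (C \<inter> A) / c"
      by (simp add: emeasure_unif[OF TA] em cK)
    also have "\<dots> = emeasure ?L (C \<inter> A)"
    proof -
      have "c * inverse c = 1"
        unfolding cK emeasure_eq_vol using vol_pos
        by (simp add: inverse_ennreal ennreal_mult[symmetric] ennreal_1[symmetric] del: ennreal_1)
      then show ?thesis
        by (simp add: divide_ennreal_def mult.commute[of c] mult.assoc)
    qed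
    also have "\<dots> = emeasure \<mu> A"
      unfolding \<mu>_def by (subst emeasure_density) (auto simp: indicator_inter_arith[symmetric] intro!: borel_measurable_indicator)
    finally show "emeasure (distr unif borel ?T) A = emeasure \<mu> A" .
  qed simp
  have T_unif [measurable]: "?T \<in> unif \<rightarrow>\<^sub>M borel"
    by (simp add: measurable_cong_sets[OF sets_unif refl])
  obtain B where B: "0 < B" "\<And>x i. x \<in> C \<Longrightarrow> i < n \<Longrightarrow> \<bar>x i\<bar> \<le> B"
    using convex_body_bounded[OF bodyC] by blast
  have TB: "\<bar>?T x i\<bar> \<le> B" if "x \<in> K" "i < n" for x i
    using B(2)[of "?T x" i] that by (simp add: C)
  interpret U: prob_space unif by (rule prob_space_unif)
  have int_unif: "integrable unif (\<lambda>x. ?T x k * ?T x l)" if "k < n" "l < n" for k l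
  proof (rule U.integrable_const_bound[where B = "B * B"])
    show "AE x in unif. norm (?T x k * ?T x l) \<le> B * B"
      using AE_unif
    proof eventually_elim
      fix x assume "x \<in> K"
      then show "norm (?T x k * ?T x l) \<le> B * B"
        using TB that B(1) by (simp add: abs_mult mult_mono)
    qed
    show "(\<lambda>x. ?T x k * ?T x l) \<in> borel_measurable unif"
      by (rule borel_measurable_times[OF T_unif[THEN measurable_product_then_coordinatewise]
            T_unif[THEN measurable_product_then_coordinatewise]])
  qed
  have int_\<mu>: "integrable \<mu> (\<lambda>x. x k * x l)" if "k < n" "l < n" for k l
    unfolding push[symmetric] by (subst integrable_distr_eq) (auto intro: int_unif that)
  obtain L where L: "0 < L" "\<And>\<xi>. \<xi> \<in> unit_sphere n \<Longrightarrow> (LINT x:C|?L. (dot n x \<xi>)\<^sup>2) = L\<^sup>2"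
    using iso unfolding isotropic_def by blast
  have basis_sphere: "basis_vec 0 \<in> unit_sphere n"
    using basis_vec_in_Rn[OF n_pos] n_pos
    by (simp add: unit_sphere_def L2_set_def basis_vec_def if_distrib[of "\<lambda>x. x\<^sup>2"] del: topspace_Euclidean_space cong: if_cong)
  have L_eq: "isotropic_constant n C = L"
    unfolding isotropic_constant_def
  proof (rule the_equality)
    show "0 < L \<and> (\<forall>\<xi>\<in>unit_sphere n. (LINT x:C|?L. (dot n x \<xi>)\<^sup>2) = L\<^sup>2)" using L by blast
    fix L' assume L': "0 < L' \<and> (\<forall>\<xi>\<in>unit_sphere n. (LINT x:C|?L. (dot n x \<xi>)\<^sup>2) = L'\<^sup>2)"
    then have "L'\<^sup>2 = L\<^sup>2" using L(2)[OF basis_sphere] basis_sphere by simp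
    then show "L' = L" using L' L(1) by (simp add: power2_eq_iff)
  qed
  have sphere\<mu>: "(\<integral>x. (dot n x \<xi>)\<^sup>2 \<partial>\<mu>) = L\<^sup>2" if "\<xi> \<in> unit_sphere n" for \<xi>
  proof -
    have "\<mu> = density ?L (\<lambda>x. ennreal (indicator C x))"
      by (simp add: \<mu>_def ennreal_indicator)
    then have "(\<integral>x. (dot n x \<xi>)\<^sup>2 \<partial>\<mu>) = (\<integral>x. indicator C x *\<^sub>R (dot n x \<xi>)\<^sup>2 \<partial>?L)"
      by (simp only:) (intro integral_density AE_I2; (measurable | simp))
    then show ?thesis using L(2)[OF that] by (simp add: set_lebesgue_integral_def)
  qed
  have cov_unif: "(\<integral>x. ?T x k * ?T x l \<partial>unif) = (if k = l then L\<^sup>2 else 0)" if "k < n" "l < n" for k l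
  proof -
    have "(\<integral>x. x k * x l \<partial>\<mu>) = (\<integral>x. ?T x k * ?T x l \<partial>unif)"
      unfolding push[symmetric] by (rule integral_distr) auto
    then show ?thesis using isotropic_second_moments[OF sphere\<mu> int_\<mu> that] by simp
  qed
  define p where "p x = q (?S x)" for x
  interpret p: seminorm_Rn n p
    unfolding p_def by (rule seminorm_Rn_compose) (rule seminorm_Rn_axioms)
  have p_cotype: "cotype2_bound p (cotype2_const n K)"
    unfolding p_def by (rule cotype2_bound_compose[OF cotype2_bound_cotype2_const])
  have p_norm: "body_norm C y = p y" if y: "y \<in> Rn n" for y
  proof -
    have "y \<in> (\<lambda>y i. r * y i) ` C \<longleftrightarrow> ?S y \<in> (\<lambda>y i. r * y i) ` K" for r
    proof
      assume "y \<in> (\<lambda>y i. r * y i) ` C"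
      then obtain k where k: "k \<in> K" "y = (\<lambda>i. r * ?T k i)" unfolding C by blast
      then have "?S y = (\<lambda>i. r * ?S (?T k) i)" by (simp only: matrix_map_linear)
      also have "?S (?T k) = k" using k(1) subset_Rn ST truncate_eq by (metis subsetD)
      finally show "?S y \<in> (\<lambda>y i. r * y i) ` K" using k(1) by blast
    next
      assume "?S y \<in> (\<lambda>y i. r * y i) ` K"
      then obtain k where k: "k \<in> K" "?S y = (\<lambda>i. r * k i)" by blast
      have "y = ?T (?S y)" using TS truncate_eq[OF y] by simp
      also have "\<dots> = (\<lambda>i. r * ?T k i)" unfolding k(2) by (rule matrix_map_linear)
      finally show "y \<in> (\<lambda>y i. r * y i) ` C" using k(1) unfolding C by blast
    qed
    then have "body_norm C y = body_norm K (?S y)" by (simp add: body_norm_def)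
    then show ?thesis by (simp add: p_def q_eq[OF SR])
  qed
  have pT: "p (?T x) = q x" for x
    unfolding p_def ST by (rule depends)
  let ?\<tau> = "distr \<sigma> borel (\<lambda>\<xi>. \<xi>)"
  note \<tau> = rotation_invariant_distr[OF \<sigma>]
  have mean: "mean_norm \<sigma> C = (\<integral>\<xi>. p \<xi> \<partial>?\<tau>)"
  proof -
    have "(\<integral>\<xi>. p \<xi> \<partial>?\<tau>) = (\<integral>\<xi>. p \<xi> \<partial>\<sigma>)" by (rule integral_distr[OF \<tau>(1)]) simp
    also have "\<dots> = mean_norm \<sigma> C"
      unfolding mean_norm_def
    proof (intro Bochner_Integration.integral_cong refl)
      fix \<xi> assume "\<xi> \<in> space \<sigma>"
      then have "\<xi> \<in> Rn n" using \<sigma> by (auto simp: rotation_invariant_prob_def unit_sphere_def)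
      then show "p \<xi> = body_norm C \<xi>" by (simp only: p_norm)
    qed
    finally show ?thesis ..
  qed
  have A: "0 < cotype2_const n K" using cotype2_const_ge_1 by simp
  have goal: "(\<integral>x. q (\<lambda>i. \<Sum>j<s. t j * x j i) \<partial>samples s) \<le>
      sqrt pi * cotype2_const n K * (L * l2norm s t) * sqrt n * (\<integral>\<xi>. p \<xi> \<partial>?\<tau>)"
  \<comment> \<open>For $t = 0$ the covariance vanishes, which the estimate for isotropic vectors excludes.\<close>
  proof (cases "l2norm s t = 0")
    case True
    then have "t j = 0" if "j < s" for j using that unfolding l2norm_eq_0_iff by simp
    then have "(\<lambda>i. \<Sum>j<s. t j * x j i) = (\<lambda>i. 0)" for x :: "nat \<Rightarrow> nat \<Rightarrow> real" by simp
    then show ?thesis using True by (simp add: zero)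
  next
    case False
    then have "0 < l2norm s t" using l2norm_nonneg[of t s] by linarith
    then have a: "0 < L * l2norm s t" using L(1) by simp
    let ?P = "samples s"
    interpret P: prob_space ?P by (rule prob_space_samples)
    define X where "X x = (\<lambda>i. \<Sum>j<s. t j * ?T (x j) i)" for x :: "nat \<Rightarrow> nat \<Rightarrow> real"
    have Tx [measurable]: "(\<lambda>x. ?T (x j)) \<in> ?P \<rightarrow>\<^sub>M borel" if "j < s" for j
      by (rule measurable_compose[OF sample_measurable[OF that] measurable_matrix_map])
    have X: "X \<in> ?P \<rightarrow>\<^sub>M borel" unfolding X_def by measurable
    have Tc: "(\<lambda>x. ?T (x j) k) \<in> borel_measurable ?P" if "j < s" for j k
      by (rule measurable_product_then_coordinatewise[OF Tx[OF that]])
    have int: "integrable ?P (\<lambda>x. ?T (x j) k * ?T (x j') l)" if "j < s" "j' < s" "k < n" "l < n" for j j' k l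
    proof (rule P.integrable_const_bound[where B = "B * B"])
      show "AE x in ?P. norm (?T (x j) k * ?T (x j') l) \<le> B * B"
        using AE_samples
      proof eventually_elim
        fix x assume "\<forall>j<s. x j \<in> K"
        then show "norm (?T (x j) k * ?T (x j') l) \<le> B * B"
          using TB that B(1) by (simp add: abs_mult mult_mono)
      qed
      show "(\<lambda>x. ?T (x j) k * ?T (x j') l) \<in> borel_measurable ?P"
        by (intro borel_measurable_times Tc that)
    qed
    have cov: "(\<integral>x. ?T (x j) k * ?T (x j') l \<partial>?P) = (if j = j' \<and> k = l then L\<^sup>2 else 0)"
      if j: "j < s" "j' < s" and kl: "k < n" "l < n" for j j' k l
    proof (cases "j = j'")
      case True
      have m: "(\<lambda>x. ?T x k * ?T x l) \<in> borel_measurable borel"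
        by (rule borel_measurable_times[OF measurable_matrix_map[THEN measurable_product_then_coordinatewise]
              measurable_matrix_map[THEN measurable_product_then_coordinatewise]])
      show ?thesis
        using integral_sample(1)[OF j(1) m] cov_unif[OF kl] True by simp
    next
      case False
      \<comment> \<open>Flipping the sign of one sample changes the sign of the integral.\<close>
      define \<epsilon> where "\<epsilon> i = (if i = j then -1 else 1 :: real)" for i
      have "(\<integral>x. ?T (x j) k * ?T (x j') l \<partial>?P) =
          (\<integral>x. ?T ((\<lambda>j\<in>{..<s}. \<lambda>i. \<epsilon> j * x j i) j) k * ?T ((\<lambda>j\<in>{..<s}. \<lambda>i. \<epsilon> j * x j i) j') l \<partial>?P)"
        by (rule integral_samples_sign[symmetric])
          (auto simp: \<epsilon>_def intro!: borel_measurable_times Tc j)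
      also have "\<dots> = (\<integral>x. - (?T (x j) k * ?T (x j') l) \<partial>?P)"
        using j False matrix_map_linear(3)[of n T' "-1"] by (simp add: \<epsilon>_def)
      finally show ?thesis using False by simp
    qed
    have covX: "(\<integral>x. X x k * X x l \<partial>?P) = (if k = l then (L * l2norm s t)\<^sup>2 else 0)"
      if kl: "k < n" "l < n" for k l
    proof -
      have "X x k * X x l = (\<Sum>j<s. \<Sum>j'<s. (t j * t j') * (?T (x j) k * ?T (x j') l))" for x
        by (simp add: X_def sum_product mult_ac)
      then have "(\<integral>x. X x k * X x l \<partial>?P) =
          (\<Sum>j<s. \<Sum>j'<s. (t j * t j') * (\<integral>x. ?T (x j) k * ?T (x j') l \<partial>?P))"
        using int kl
        by (simp only:, subst Bochner_Integration.integral_sum; (intro sum.cong refl)?)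
          (auto intro!: Bochner_Integration.integrable_sum)
      also have "\<dots> = (\<Sum>j<s. \<Sum>j'<s. if j = j' then (if k = l then L\<^sup>2 else 0) * (t j)\<^sup>2 else 0)"
        by (intro sum.cong refl) (auto simp: cov kl power2_eq_square)
      also have "\<dots> = (if k = l then L\<^sup>2 else 0) * (l2norm s t)\<^sup>2"
        by (simp add: l2norm_square dot_self sum_distrib_left)
      finally show ?thesis by (simp add: power_mult_distrib)
    qed
    have bounded: "AE x in ?P. \<forall>i<n. \<bar>X x i\<bar> \<le> (\<Sum>j<s. \<bar>t j\<bar>) * B"
      using AE_samples
    proof eventually_elim
      fix x assume x: "\<forall>j<s. x j \<in> K"
      show "\<forall>i<n. \<bar>X x i\<bar> \<le> (\<Sum>j<s. \<bar>t j\<bar>) * B"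
      proof (intro allI impI)
        fix i assume i: "i < n"
        have "\<bar>X x i\<bar> \<le> (\<Sum>j<s. \<bar>t j * ?T (x j) i\<bar>)" unfolding X_def by (rule sum_abs)
        also have "\<dots> \<le> (\<Sum>j<s. \<bar>t j\<bar> * B)"
          using x TB[OF _ i] by (intro sum_mono) (auto simp: abs_mult intro!: mult_left_mono)
        finally show "\<bar>X x i\<bar> \<le> (\<Sum>j<s. \<bar>t j\<bar>) * B" by (simp add: sum_distrib_right)
      qed
    qed
    have "0 \<le> (\<Sum>j<s. \<bar>t j\<bar>) * B" using B(1) by (intro mult_nonneg_nonneg sum_nonneg) auto
    from p.cotype2_isotropic_vector[OF p_cotype A n_pos \<tau>(2,3) prob_space_samples X bounded this covX a]
    have "(\<integral>x. p (X x) \<partial>?P) \<le> sqrt pi * cotype2_const n K * (L * l2norm s t) * sqrt n * (\<integral>\<xi>. p \<xi> \<partial>?\<tau>)"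
      by simp
    moreover have "p (X x) = q (\<lambda>i. \<Sum>j<s. t j * x j i)" for x
      unfolding X_def matrix_map_sum[symmetric] pT ..
    ultimately show ?thesis by simp
  qed
  then show ?thesis unfolding multi_norm_eq L_eq mean by (simp add: mult_ac)
qed

end

theorem theorem1p5:
  shows "\<exists>c\<^sub>3 c\<^sub>4 :: real. c\<^sub>3 > 0 \<and> c\<^sub>4 > 0 \<and>
    (\<forall>(n::nat) K. n \<ge> 1 \<and> convex_body n K \<and> centrally_symmetric K \<longrightarrow>
      (\<forall>(s::nat) t :: nat \<Rightarrow> real. s \<ge> 1 \<longrightarrow>
         c\<^sub>3 / cotype2_const n K * L2_set t {..<s} \<le> multi_norm n s K t \<and>
         (\<forall>K_iso \<sigma>. isotropic_image n K K_iso \<and> rotation_invariant_prob n \<sigma> \<longrightarrow>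
            multi_norm n s K t \<le>
              (c\<^sub>4 * isotropic_constant n K_iso * cotype2_const n K * sqrt (real n)
                 * mean_norm \<sigma> K_iso) * L2_set t {..<s})))"
proof (rule exI[of _ "1 / (4 * sqrt 2)"], rule exI[of _ "sqrt pi"], intro conjI allI impI)
  fix n :: nat and K assume "n \<ge> 1 \<and> convex_body n K \<and> centrally_symmetric K"
  then interpret symmetric_body n K by unfold_locales auto
  fix s :: nat and t :: "nat \<Rightarrow> real"
  show "1 / (4 * sqrt 2) / cotype2_const n K * L2_set t {..<s} \<le> multi_norm n s K t"
    by (rule multi_norm_lower)
  fix K_iso \<sigma> assume "isotropic_image n K K_iso \<and> rotation_invariant_prob n \<sigma>"
  then show "multi_norm n s K t \<le>
      (sqrt pi * isotropic_constant n K_iso * cotype2_const n K * sqrt (real n)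
         * mean_norm \<sigma> K_iso) * L2_set t {..<s}"
    by (intro multi_norm_upper) auto
qed auto


end
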